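(* Let $\widetilde\mu$ be an infinitely divisible distribution on $\mathbb{R}^d$ with Lévy–Khintchine triplet $(\widetilde\Sigma,\widetilde\nu,\widetilde\gamma)$. The following are equivalent: (a) $\widetilde\mu\in G(\mathbb{R}^d)$; (b) $\widetilde\nu=\mathcal{A}_1(\nu)$ for some $\nu\in\mathfrak{M}_L^B(\mathbb{R}^d)\cap\mathfrak{M}_L^1(\mathbb{R}^d)$; (c) $\widetilde\nu=\mathcal{A}_1(\Upsilon^0(\rho))$ for some $\rho\in\mathfrak{M}_L^1(\mathbb{R}^d)$. In (b) or (c), the representing measure $\nu$, respectively $\rho$, is unique.
   Context: A Lévy measure on $\mathbb{R}^d$ is a measure $\nu$ with $\nu(\{0\})=0$ and $\int(1\wedge|x|^2)\nu(\mathrm{d}x)<\infty$; their class is $\mathfrak{M}_L(\mathbb{R}^d)$, and $\mathfrak{M}_L^1(\mathbb{R}^d)$ is the class of those with $\int(1\wedge|x|)\nu(\mathrm{d}x)<\infty$. A polar decomposition of $\nu\in\mathfrak{M}_L(\mathbb{R}^d)$ is a pair $(\lambda,\{\nu_\xi\})$, $\lambda$ a measure on the unit sphere $\mathbb{S}$, $\nu_\xi$ measures on $(0,\infty)$ with $\nu_\xi(E)$ measurable in $\xi$, $0<\nu_\xi((0,\infty))\le\infty$, and $\nu(B)=\int_{\mathbb{S}}\lambda(\mathrm{d}\xi)\int_0^\infty1_B(r\xi)\nu_\xi(\mathrm{d}r)$. $\mathfrak{M}_L^B(\mathbb{R}^d)$ (Lévy measures of the Goldie–Steutel–Bondesson class)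 is the class of $\nu\in\mathfrak{M}_L(\mathbb{R}^d)$ with a polar decomposition such that $\nu_\xi(\mathrm{d}r)=\ell_\xi(r)\mathrm{d}r$, $\ell_\xi(r)$ measurable in $(\xi,r)$ and completely monotone in $r>0$. $G(\mathbb{R}^d)$ (generalized type $G$ distributions) is the class of infinitely divisible $\mu$ on $\mathbb{R}^d$ whose Lévy measure has a polar decomposition with $\nu_\xi(\mathrm{d}r)=g_\xi(r^2)\mathrm{d}r$, where $g_\xi(u)$ is measurable in $(\xi,u)$ and completely monotone in $u\in(0,\infty)$. $a_1(r;s)=2\pi^{-1}(s-r^2)^{-1/2}$ for $0<r<s^{1/2}$, $0$ otherwise; $\mathcal{A}_1(\nu)(B)=\int_{\mathbb{R}^d\setminus\{0\}}\nu(\mathrm{d}x)\int_0^\infty a_1(r;|x|)1_B(rx/|x|)\mathrm{d}r$. $\Upsilon^0(\rho)(B)=\int_0^\infty\rho(u^{-1}B)e^{-u}\mathrm{d}u$. *)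

theory Defs
  imports "HOL-Probability.Probability"
begin

definition completely_monotone :: "(real \<Rightarrow> real) \<Rightarrow> bool" where
  "completely_monotone f \<longleftrightarrow>
     (\<exists>D :: nat \<Rightarrow> real \<Rightarrow> real.
        (\<forall>x>0. D 0 x = f x) \<and>
        (\<forall>n. \<forall>x>0. (D n has_real_derivative D (Suc n) x) (at x)) \<and>
        (\<forall>n. \<forall>x>0. (-1) ^ n * D n x \<ge> 0))"

definition levy_measure :: "'a::euclidean_space measure \<Rightarrow> bool" where
  "levy_measure \<nu> \<longleftrightarrow> sets \<nu> = sets borel \<and> emeasure \<nu> {0} = 0 \<and>
     (\<integral>\<^sup>+ x. ennreal (min 1 (norm x ^ 2)) \<partial>\<nu>) < \<infinity>"

definition levy_measure1 :: "'a::euclidean_space measure \<Rightarrow> bool" where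
  "levy_measure1 \<nu> \<longleftrightarrow> levy_measure \<nu> \<and>
     (\<integral>\<^sup>+ x. ennreal (min 1 (norm x)) \<partial>\<nu>) < \<infinity>"

text \<open>Polar decomposition (\<lambda>, {\<nu>_\<xi>}): \<lambda> a measure on the unit sphere, each \<nu>_\<xi> a measure
  on (0,\<infinity>) (represented as a Borel measure on the reals giving no mass to (-\<infinity>,0]).\<close>
definition polar_decomposition ::
  "'a::euclidean_space measure \<Rightarrow> 'a measure \<Rightarrow> ('a \<Rightarrow> real measure) \<Rightarrow> bool" where
  "polar_decomposition \<nu> lam nx \<longleftrightarrow>
     sets lam = sets (restrict_space borel (sphere 0 1)) \<and>
     (\<forall>\<xi>\<in>sphere 0 1. sets (nx \<xi>) = sets borel \<and> emeasure (nx \<xi>) {..0} = 0 \<and>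
                       0 < emeasure (nx \<xi>) {0<..}) \<and>
     (\<forall>E\<in>sets borel. (\<lambda>\<xi>. emeasure (nx \<xi>) E) \<in> borel_measurable lam) \<and>
     (\<forall>B\<in>sets borel. emeasure \<nu> B =
        (\<integral>\<^sup>+ \<xi>. (\<integral>\<^sup>+ r. indicator B (r *\<^sub>R \<xi>) \<partial>(nx \<xi>)) \<partial>lam))"

definition levy_measure_B :: "'a::euclidean_space measure \<Rightarrow> bool" where
  "levy_measure_B \<nu> \<longleftrightarrow> levy_measure \<nu> \<and>
     (\<exists>lam (l :: 'a \<Rightarrow> real \<Rightarrow> real).
        polar_decomposition \<nu> lam
          (\<lambda>\<xi>. density lborel (\<lambda>r. ennreal (indicator {0<..} r * l \<xi> r))) \<and>
        (\<lambda>p. l (fst p) (snd p)) \<in> borel_measurable (lam \<Otimes>\<^sub>M restrict_space borel {0<..}) \<and>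
        (\<forall>\<xi>\<in>sphere 0 1. completely_monotone (l \<xi>)))"

definition charf :: "'a::euclidean_space measure \<Rightarrow> 'a \<Rightarrow> complex" where
  "charf \<mu> z = (\<integral> x. cis (z \<bullet> x) \<partial>\<mu>)"

definition LK_triplet ::
  "'a::euclidean_space measure \<Rightarrow> ('a \<Rightarrow> 'a) \<Rightarrow> 'a measure \<Rightarrow> 'a \<Rightarrow> bool" where
  "LK_triplet \<mu> \<Sigma> \<nu> \<gamma> \<longleftrightarrow>
     prob_space \<mu> \<and> sets \<mu> = sets borel \<and>
     linear \<Sigma> \<and> (\<forall>x y. \<Sigma> x \<bullet> y = x \<bullet> \<Sigma> y) \<and> (\<forall>x. 0 \<le> x \<bullet> \<Sigma> x) \<and>
     levy_measure \<nu> \<and>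
     (\<forall>z. charf \<mu> z =
        exp (complex_of_real (- (z \<bullet> \<Sigma> z) / 2) + \<i> * complex_of_real (\<gamma> \<bullet> z) +
             (\<integral> x. cis (z \<bullet> x) - 1 - \<i> * complex_of_real (z \<bullet> x) *
                       (if norm x \<le> 1 then 1 else 0) \<partial>\<nu>)))"

definition infinitely_divisible :: "'a::euclidean_space measure \<Rightarrow> bool" where
  "infinitely_divisible \<mu> \<longleftrightarrow> (\<exists>\<Sigma> \<nu> \<gamma>. LK_triplet \<mu> \<Sigma> \<nu> \<gamma>)"

definition typeG :: "'a::euclidean_space measure set" where
  "typeG = {\<mu>. \<exists>\<Sigma> \<nu> \<gamma>. LK_triplet \<mu> \<Sigma> \<nu> \<gamma> \<and>
     (\<exists>lam (g :: 'a \<Rightarrow> real \<Rightarrow> real).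
        polar_decomposition \<nu> lam
          (\<lambda>\<xi>. density lborel (\<lambda>r. ennreal (indicator {0<..} r * g \<xi> (r\<^sup>2)))) \<and>
        (\<lambda>p. g (fst p) (snd p)) \<in> borel_measurable (lam \<Otimes>\<^sub>M restrict_space borel {0<..}) \<and>
        (\<forall>\<xi>\<in>sphere 0 1. completely_monotone (g \<xi>)))}"

definition a1 :: "real \<Rightarrow> real \<Rightarrow> real" where
  "a1 r s = (if 0 < r \<and> r < sqrt s then 2 / pi * (s - r\<^sup>2) powr (-1/2) else 0)"

definition A1 :: "'a::euclidean_space measure \<Rightarrow> 'a measure" where
  "A1 \<nu> = measure_of UNIV (sets borel)
     (\<lambda>B. \<integral>\<^sup>+ x. indicator (-{0}) x *
            (\<integral>\<^sup>+ r. ennreal (a1 r (norm x)) * indicator B (r *\<^sub>R (x /\<^sub>R norm x)) \<partial>lborel) \<partial>\<nu>)"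

definition Upsilon0 :: "'a::euclidean_space measure \<Rightarrow> 'a measure" where
  "Upsilon0 \<rho> = measure_of UNIV (sets borel)
     (\<lambda>B. \<integral>\<^sup>+ u. indicator {0<..} u * emeasure \<rho> ((\<lambda>x. u *\<^sub>R x) -` B) *
            ennreal (exp (- u)) \<partial>lborel)"

end

theory Submission
  imports Defs
begin

text \<open>
  Write \<open>\<rho>\<close> in polar coordinates.  Both \<open>\<Upsilon>\<^sup>0\<close> and \<open>\<A>\<^sub>1 \<circ> \<Upsilon>\<^sup>0\<close> replace a mass point at radius
  \<open>s\<close> by a measure on the same ray, with density \<open>exp (- r / s) / s\<close> and
  \<open>2 (\<pi> s) powr (-1/2) exp (- r\<^sup>2 / s)\<close> respectively.  Hence the radial densities of the images are
  mixtures of \<open>exp (- u / s)\<close> with \<open>u = r\<close> or \<open>u = r\<^sup>2\<close>, and Bernstein's theorem says that these are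
  exactly the completely monotone functions of \<open>u\<close>.  Bernstein's theorem is obtained from the
  Hausdorff moment problem, where the measure depends measurably on its moments; this gives
  measurability in the direction \<open>\<xi>\<close>, and, applied to Radon-Nikodym derivatives of moments, also the
  disintegration of \<open>\<rho>\<close> along rays.  The representing measure is unique because testing its image
  against \<open>r ^ (2 j + 1) exp (- r\<^sup>2)\<close> gives the moments of \<open>s / (1 + s)\<close> in every cone.  Membership
  of \<open>\<mu>\<close> in the class \<open>G\<close> is a statement about \<open>\<nu>t\<close> because the Levy measure in the Levy-Khintchine
  formula is unique.
\<close>

section \<open>Uniqueness of characteristic functions\<close>

text \<open>The measure \<open>lam\<close> in a polar decomposition is not assumed sigma-finite.
  Directions are therefore never interchanged with anything under \<open>lam\<close>; Fubini is used
  inside one fixed direction, between the radius and a probability measure on the parameter. For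
  this, Bernstein's theorem has to deliver a probability kernel in the direction. Dividing by
  \<open>g 1\<close> normalises it, and a measure picked by choice in each direction is still
  measurable, because it is determined by moments through limits that are the same for all measures.
  Mixing measures and Levy measures may be infinite near the origin, so each argument with moments
  or characteristic functions multiplies by a weight vanishing there and divides it out at the end.
  The class \<open>levy_measure1\<close> comes from the scale of the kernels: a point at radius s is
  spread at scale s by \<open>k_exp\<close> and at scale \<open>sqrt s\<close> by
  \<open>k_gauss\<close>, so \<open>min 1 s\<close> before mixing corresponds to
  \<open>min 1 r\<close> and \<open>min 1 (r ^ 2)\<close> after it. Uniqueness in (b) is inherited
  from (c), since every admissible measure in (b) is an image under \<open>Upsilon0\<close>.\<close>

definition gauss :: "'a::euclidean_space measure" where
  "gauss = density lborel (\<lambda>x. ennreal (\<Prod>b\<in>Basis. std_normal_density (x \<bullet> b)))"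

lemma sets_gauss [simp, measurable_cong]: "sets gauss = sets borel"
  by (simp add: gauss_def)

lemma space_gauss [simp]: "space gauss = UNIV"
  by (simp add: gauss_def)

lemma prob_space_gauss: "prob_space (gauss :: 'a::euclidean_space measure)"
proof
  have "emeasure (gauss :: 'a measure) (space gauss) = (\<integral>\<^sup>+x. ennreal (\<Prod>b\<in>Basis. std_normal_density ((x::'a) \<bullet> b)) \<partial>lborel)"
    by (simp add: gauss_def emeasure_density)
  also have "\<dots> = (\<integral>\<^sup>+x. (\<Prod>b\<in>Basis. ennreal (std_normal_density ((x::'a) \<bullet> b))) \<partial>lborel)"
    by (intro nn_integral_cong prod_ennreal[symmetric]) auto
  also have "\<dots> = (\<Prod>b\<in>(Basis::'a set). \<integral>\<^sup>+x. ennreal (std_normal_density x) \<partial>lborel)"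
    by (rule nn_integral_lborel_prod) auto
  also have "\<dots> = 1"
    using prob_space.emeasure_space_1[OF prob_space_normal_density[of 1 0]]
    by (simp add: emeasure_density)
  finally show "emeasure (gauss :: 'a measure) (space gauss) = 1" .
qed

lemma prod_std_normal_density:
  "(\<Prod>b\<in>Basis. std_normal_density ((x::'a::euclidean_space) \<bullet> b)) =
     (1 / sqrt (2 * pi)) ^ DIM('a) * exp (- (norm x)\<^sup>2 / 2)"
proof -
  have "(norm x)\<^sup>2 = (\<Sum>b\<in>Basis. (x \<bullet> b)\<^sup>2)"
    unfolding power2_norm_eq_inner by (subst euclidean_inner) (simp add: power2_eq_square)
  hence "exp (- (norm x)\<^sup>2 / 2) = (\<Prod>b\<in>Basis. exp (- (x \<bullet> b)\<^sup>2 / 2))"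
    by (simp add: exp_sum[symmetric] sum_negf sum_divide_distrib[symmetric])
  thus ?thesis by (simp add: std_normal_density_def prod_dividef power_one_over)
qed

lemma charf_gauss: "charf gauss (z :: 'a::euclidean_space) = exp (- (norm z)\<^sup>2 / 2)"
proof -
  interpret product_sigma_finite "\<lambda>_::'a. lborel :: real measure" ..
  have int: "integrable lborel (\<lambda>x. std_normal_density x *\<^sub>R iexp (t * x))" for t
  proof -
    interpret N: real_distribution std_normal_distribution by (rule real_dist_normal_dist)
    have "integrable std_normal_distribution (\<lambda>x. iexp (t * x))" by (rule N.integrable_iexp) auto
    thus ?thesis by (subst (asm) integrable_density) auto
  qed
  have val: "(\<integral>x. std_normal_density x *\<^sub>R iexp (t * x) \<partial>lborel) = complex_of_real (exp (- t\<^sup>2 / 2))" for t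
    using fun_cong[OF char_std_normal_distribution, of t]
    unfolding char_def by (subst (asm) integral_density) auto
  have [measurable]: "(\<lambda>x::'a. cis (z \<bullet> x)) \<in> borel_measurable borel"
    unfolding cis_conv_exp by (intro borel_measurable_continuous_onI continuous_intros)
  have "charf gauss z = (\<integral>x. (\<Prod>b\<in>Basis. std_normal_density (x \<bullet> b)) *\<^sub>R cis (z \<bullet> x) \<partial>lborel)"
    unfolding charf_def gauss_def by (subst integral_density) (auto intro!: prod_nonneg)
  \<comment> \<open>\<open>lborel\<close> is the image of a product of one-dimensional Lebesgue
    measures, over which both the density and the character factorise.\<close>
  also have "\<dots> = (\<integral>f. (\<Prod>b\<in>Basis. std_normal_density ((\<Sum>i\<in>Basis. f i *\<^sub>R i) \<bullet> b)) *\<^sub>R cis (z \<bullet> (\<Sum>i\<in>Basis. f i *\<^sub>R i)) \<partial>(\<Pi>\<^sub>M b\<in>(Basis::'a set). lborel))"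
    by (subst lborel_eq, subst integral_distr) auto
  also have "\<dots> = (\<integral>f. (\<Prod>b\<in>Basis. std_normal_density (f b) *\<^sub>R iexp ((z \<bullet> b) * f b)) \<partial>(\<Pi>\<^sub>M b\<in>(Basis::'a set). lborel))"
  proof (rule Bochner_Integration.integral_cong[OF refl])
    fix f :: "'a \<Rightarrow> real"
    have "cis (z \<bullet> (\<Sum>i\<in>Basis. f i *\<^sub>R i)) = (\<Prod>b\<in>Basis. iexp ((z \<bullet> b) * f b))"
      by (simp add: cis_conv_exp inner_sum_right exp_sum sum_distrib_left mult.commute)
    thus "(\<Prod>b\<in>Basis. std_normal_density ((\<Sum>i\<in>Basis. f i *\<^sub>R i) \<bullet> b)) *\<^sub>R cis (z \<bullet> (\<Sum>i\<in>Basis. f i *\<^sub>R i)) =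
       (\<Prod>b\<in>Basis. std_normal_density (f b) *\<^sub>R iexp ((z \<bullet> b) * f b))"
      by (simp add: scaleR_conv_of_real prod.distrib)
  qed
  also have "\<dots> = (\<Prod>b\<in>Basis. complex_of_real (exp (- (z \<bullet> b)\<^sup>2 / 2)))"
    by (subst product_integral_prod) (simp_all only: val int finite_Basis)
  also have "\<dots> = exp (- (norm z)\<^sup>2 / 2)"
  proof -
    have "(norm z)\<^sup>2 = (\<Sum>b\<in>Basis. (z \<bullet> b)\<^sup>2)"
      unfolding power2_norm_eq_inner by (subst euclidean_inner) (simp add: power2_eq_square)
    hence "exp (- (norm z)\<^sup>2 / 2) = (\<Prod>b\<in>Basis. exp (- (z \<bullet> b)\<^sup>2 / 2))"
      by (simp add: exp_sum[symmetric] sum_negf sum_divide_distrib[symmetric])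
    thus ?thesis by simp
  qed
  finally show ?thesis .
qed

text \<open>The Gaussian kernel is itself the characteristic function of \<open>gauss\<close> at
  \<open>s *\<^sub>R (x - y)\<close>. Fubini then moves the integral over \<open>M\<close> onto the
  character, so Gaussian smoothings of \<open>M\<close> depend on \<open>charf M\<close>
  alone.\<close>

lemma gauss_smoothing:
  fixes M :: "'a::euclidean_space measure"
  assumes "finite_measure M" and sM[measurable_cong]: "sets M = sets borel"
  shows "complex_of_real (\<integral>x. exp (- (norm (s *\<^sub>R (x - y)))\<^sup>2 / 2) \<partial>M) = (\<integral>z. charf M (s *\<^sub>R z) * cis (- (s * (z \<bullet> y))) \<partial>gauss)"
proof -
  interpret M: finite_measure M by fact
  interpret G: prob_space "gauss :: 'a measure" by (rule prob_space_gauss)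
  interpret P: pair_sigma_finite M "gauss :: 'a measure" ..
  interpret finite_measure "M \<Otimes>\<^sub>M (gauss :: 'a measure)"
    by (intro finite_measure_pair_measure G.finite_measure_axioms M.finite_measure_axioms)
  let ?h = "\<lambda>x z. cis (z \<bullet> (s *\<^sub>R (x - y)))"
  have [measurable]: "(\<lambda>p. ?h (fst p) (snd p)) \<in> borel_measurable (borel \<Otimes>\<^sub>M borel)"
    unfolding cis_conv_exp borel_prod by (intro borel_measurable_continuous_onI continuous_intros)
  have "integrable (M \<Otimes>\<^sub>M gauss) (\<lambda>(x, z). ?h x z)"
    by (rule integrable_const_bound[where B=1]) (simp_all add: split_beta del: inner_scaleR_right)
  hence "(\<integral>z. (\<integral>x. ?h x z \<partial>M) \<partial>gauss) = (\<integral>x. (\<integral>z. ?h x z \<partial>gauss) \<partial>M)"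
    by (rule P.Fubini_integral)
  also have "(\<lambda>x. \<integral>z. ?h x z \<partial>gauss) = (\<lambda>x. complex_of_real (exp (- (norm (s *\<^sub>R (x - y)))\<^sup>2 / 2)))"
  proof
    fix x
    show "(\<integral>z. ?h x z \<partial>gauss) = complex_of_real (exp (- (norm (s *\<^sub>R (x - y)))\<^sup>2 / 2))"
      using charf_gauss[of "s *\<^sub>R (x - y)"] unfolding charf_def
      by (subst inner_commute) simp
  qed
  also have "(\<lambda>z. \<integral>x. ?h x z \<partial>M) = (\<lambda>z. charf M (s *\<^sub>R z) * cis (- (s * (z \<bullet> y))))"
  proof
    fix z
    have "?h x z = cis ((s *\<^sub>R z) \<bullet> x) * cis (- (s * (z \<bullet> y)))" for x
      by (simp add: cis_mult inner_diff_right right_diff_distrib)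
    thus "(\<integral>x. ?h x z \<partial>M) = charf M (s *\<^sub>R z) * cis (- (s * (z \<bullet> y)))"
      by (simp add: charf_def)
  qed
  finally show ?thesis by simp
qed

text \<open>Adding independent noise of size 1/s gives \<open>M\<close> a Lebesgue density, and that
  density is the integral evaluated in \<open>gauss_smoothing\<close>.\<close>

lemma gauss_convolution:
  fixes M :: "'a::euclidean_space measure" and f :: "'a \<Rightarrow> ennreal"
  assumes "finite_measure M" and sM[measurable_cong]: "sets M = sets borel"
    and [measurable]: "f \<in> borel_measurable borel" and s: "s > 0"
  shows "(\<integral>\<^sup>+x. \<integral>\<^sup>+z. f (x + z /\<^sub>R s) \<partial>gauss \<partial>M) =
    (\<integral>\<^sup>+y. f y * ennreal ((s / sqrt (2 * pi)) ^ DIM('a) *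
        (\<integral>x. exp (- (norm (s *\<^sub>R (x - y)))\<^sup>2 / 2) \<partial>M)) \<partial>lborel)"
proof -
  interpret M: finite_measure M by fact
  interpret P: pair_sigma_finite M "lborel :: 'a measure" ..
  let ?e = "\<lambda>x y. exp (- (norm (s *\<^sub>R ((x::'a) - y)))\<^sup>2 / 2)"
  let ?K = "(s / sqrt (2 * pi)) ^ DIM('a)"
  have K: "?K \<ge> 0" using s by simp
  have [measurable]: "(\<lambda>x. \<Prod>b\<in>Basis. std_normal_density (x \<bullet> b)) \<in> borel_measurable (borel :: 'a measure)"
    by measurable
  have "(\<integral>\<^sup>+z. f (x + z /\<^sub>R s) \<partial>gauss) = (\<integral>\<^sup>+y. f y * (ennreal ?K * ennreal (?e x y)) \<partial>lborel)" for x
  proof -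
    let ?d = "\<lambda>x. (1 / sqrt (2 * pi)) ^ DIM('a) * exp (- (norm (x::'a))\<^sup>2 / 2)"
    have "(\<integral>\<^sup>+z. f (x + z /\<^sub>R s) \<partial>gauss) = (\<integral>\<^sup>+z. ennreal (?d z) * f (x + z /\<^sub>R s) \<partial>lborel)"
      unfolding gauss_def prod_std_normal_density by (subst nn_integral_density) auto
    \<comment> \<open>Substitution \<open>z = s *\<^sub>R y - s *\<^sub>R x\<close>; its Jacobian
      \<open>s ^ DIM('a)\<close> is absorbed into \<open>?K\<close>.\<close>
    also have "\<dots> = (\<integral>\<^sup>+y. ennreal (s ^ DIM('a)) * (ennreal (?d (- s *\<^sub>R x + s *\<^sub>R y)) * f (x + (- s *\<^sub>R x + s *\<^sub>R y) /\<^sub>R s)) \<partial>lborel)"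
      using s by (subst lborel_affine[of s "- s *\<^sub>R x"])
        (auto simp: nn_integral_density nn_integral_distr)
    also have "\<dots> = (\<integral>\<^sup>+y. f y * (ennreal ?K * ennreal (?e x y)) \<partial>lborel)"
    proof (rule nn_integral_cong)
      fix y
      have "x + (- s *\<^sub>R x + s *\<^sub>R y) /\<^sub>R s = y"
        using s by (simp add: scaleR_right_diff_distrib)
      moreover have "norm (- s *\<^sub>R x + s *\<^sub>R y) = norm (s *\<^sub>R (x - y))"
        by (simp add: scaleR_right_diff_distrib norm_minus_commute)
      ultimately show "ennreal (s ^ DIM('a)) * (ennreal (?d (- s *\<^sub>R x + s *\<^sub>R y)) * f (x + (- s *\<^sub>R x + s *\<^sub>R y) /\<^sub>R s)) = f y * (ennreal ?K * ennreal (?e x y))"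
        using s by (simp add: ennreal_mult'[symmetric] mult_ac power_divide flip: mult.assoc)
    qed
    finally show ?thesis .
  qed
  hence "(\<integral>\<^sup>+x. \<integral>\<^sup>+z. f (x + z /\<^sub>R s) \<partial>gauss \<partial>M) = (\<integral>\<^sup>+x. \<integral>\<^sup>+y. f y * (ennreal ?K * ennreal (?e x y)) \<partial>lborel \<partial>M)"
    by simp
  also have "\<dots> = (\<integral>\<^sup>+y. \<integral>\<^sup>+x. f y * (ennreal ?K * ennreal (?e x y)) \<partial>M \<partial>lborel)"
    by (rule P.Fubini'[symmetric]) measurable
  also have "\<dots> = (\<integral>\<^sup>+y. f y * ennreal (?K * (\<integral>x. ?e x y \<partial>M)) \<partial>lborel)"
  proof (rule nn_integral_cong)
    fix y
    have "integrable M (\<lambda>x. ?e x y)"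
      by (rule M.integrable_const_bound[where B=1]) (auto intro!: AE_I2)
    hence "(\<integral>\<^sup>+x. ennreal (?e x y) \<partial>M) = ennreal (\<integral>x. ?e x y \<partial>M)"
      by (intro nn_integral_eq_integral) auto
    thus "(\<integral>\<^sup>+x. f y * (ennreal ?K * ennreal (?e x y)) \<partial>M) = f y * ennreal (?K * (\<integral>x. ?e x y \<partial>M))"
      using K by (simp add: nn_integral_cmult ennreal_mult')
  qed
  finally show ?thesis .
qed

text \<open>The noise tends to 0 pointwise and \<open>f\<close> is continuous, so dominated
  convergence applies on the finite product measure.\<close>

lemma gauss_approximation:
  fixes M :: "'a::euclidean_space measure" and f :: "'a \<Rightarrow> real"
  assumes "finite_measure M" and sM[measurable_cong]: "sets M = sets borel"
    and cont: "continuous_on UNIV f" and f: "\<And>x. 0 \<le> f x" "\<And>x. f x \<le> 1"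
  shows "(\<lambda>n. \<integral>\<^sup>+x. \<integral>\<^sup>+z. ennreal (f (x + z /\<^sub>R real (Suc n))) \<partial>gauss \<partial>M) \<longlonglongrightarrow> (\<integral>\<^sup>+x. f x \<partial>M)"
proof -
  interpret M: finite_measure M by fact
  interpret G: prob_space "gauss :: 'a measure" by (rule prob_space_gauss)
  interpret P: pair_sigma_finite M "gauss :: 'a measure" ..
  interpret MG: finite_measure "M \<Otimes>\<^sub>M (gauss :: 'a measure)"
    by (intro finite_measure_pair_measure G.finite_measure_axioms M.finite_measure_axioms)
  have [measurable]: "f \<in> borel_measurable borel"
    using cont by (rule borel_measurable_continuous_onI)
  have "(\<lambda>n. \<integral>\<^sup>+p. ennreal (f (fst p + snd p /\<^sub>R real (Suc n))) \<partial>(M \<Otimes>\<^sub>M (gauss :: 'a measure)))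
     \<longlonglongrightarrow> (\<integral>\<^sup>+p. ennreal (f (fst p)) \<partial>(M \<Otimes>\<^sub>M (gauss :: 'a measure)))"
  proof (rule nn_integral_dominated_convergence[where w="\<lambda>_. 1"])
    show "(\<integral>\<^sup>+p. 1 \<partial>(M \<Otimes>\<^sub>M (gauss :: 'a measure))) < \<infinity>"
      using MG.emeasure_finite[of "space (M \<Otimes>\<^sub>M gauss)"] by (simp add: less_top del: MG.emeasure_finite)
    show "AE p in M \<Otimes>\<^sub>M (gauss :: 'a measure). (\<lambda>n. ennreal (f (fst p + snd p /\<^sub>R real (Suc n)))) \<longlonglongrightarrow> ennreal (f (fst p))"
    proof (intro AE_I2 tendsto_ennrealI)
      fix p :: "'a \<times> 'a"
      have "(\<lambda>n. fst p + inverse (real (Suc n)) *\<^sub>R snd p) \<longlonglongrightarrow> fst p + 0 *\<^sub>R snd p"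
        by (intro tendsto_intros LIMSEQ_inverse_real_of_nat)
      thus "(\<lambda>n. f (fst p + snd p /\<^sub>R real (Suc n))) \<longlonglongrightarrow> f (fst p)"
        using cont by (intro isCont_tendsto_compose[of "fst p" f]) (auto simp: continuous_on_eq_continuous_at)
    qed
  qed (use f in auto)
  thus ?thesis
    by (simp add: G.nn_integral_fst[symmetric] G.emeasure_space_1[simplified] del: of_nat_Suc)
qed

text \<open>Equal characteristic functions give equal Gaussian smoothings, hence equal integrals of
  continuous functions with values in [0, 1], hence equal masses of open sets, which form a
  generating pi-system. Finite rather than probability measures are treated because the theorem is
  applied to weighted Levy measures.\<close>

theorem charf_unique:
  fixes M N :: "'a::euclidean_space measure"
  assumes "finite_measure M" "sets M = sets borel" "finite_measure N" "sets N = sets borel"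
    and eq: "\<And>z. charf M z = charf N z"
  shows "M = N"
proof -
  interpret M: finite_measure M by fact
  interpret N: finite_measure N by fact
  note [measurable_cong] = assms(2,4)
  have smooth: "(\<integral>x. exp (- (norm (s *\<^sub>R (x - y)))\<^sup>2 / 2) \<partial>M) = (\<integral>x. exp (- (norm (s *\<^sub>R (x - y)))\<^sup>2 / 2) \<partial>N)" for s y
    by (rule of_real_eq_iff[where 'a=complex, THEN iffD1])
       (simp only: gauss_smoothing[OF assms(1,2)] gauss_smoothing[OF assms(3,4)] eq)
  have cont: "(\<integral>\<^sup>+x. f x \<partial>M) = (\<integral>\<^sup>+x. f x \<partial>N)"
    if f: "continuous_on UNIV f" "\<And>x. 0 \<le> f x" "\<And>x. f x \<le> 1" for f :: "'a \<Rightarrow> real"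
  proof -
    have [measurable]: "f \<in> borel_measurable borel"
      using f(1) by (rule borel_measurable_continuous_onI)
    have fm: "(\<lambda>x. ennreal (f x)) \<in> borel_measurable borel" by measurable
    have "(\<integral>\<^sup>+x. \<integral>\<^sup>+z. ennreal (f (x + z /\<^sub>R s)) \<partial>gauss \<partial>M) = (\<integral>\<^sup>+x. \<integral>\<^sup>+z. ennreal (f (x + z /\<^sub>R s)) \<partial>gauss \<partial>N)"
      if "s > 0" for s
      unfolding gauss_convolution[OF assms(1,2) fm that]
        gauss_convolution[OF assms(3,4) fm that] smooth ..
    from this[of "real (Suc _)"] show ?thesis
      using gauss_approximation[OF assms(1,2) f] gauss_approximation[OF assms(3,4) f]
      by (intro LIMSEQ_unique) auto
  qed
  have open_eq: "emeasure M U = emeasure N U" if U: "open U" for U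
  \<comment> \<open>\<open>infdist\<close> to the empty set is 0, so the approximating functions
    used for proper open sets would vanish identically here.\<close>
  proof (cases "U = UNIV")
    case True
    thus ?thesis using cont[of "\<lambda>_. 1"] sets_eq_imp_space_eq[OF assms(2)] sets_eq_imp_space_eq[OF assms(4)] by simp
  next
    case False
    define f where "f n x = min 1 (real n * infdist x (- U))" for n x
    have [measurable]: "f n \<in> borel_measurable borel" for n
      unfolding f_def by (intro borel_measurable_continuous_onI continuous_intros)
    have lim: "(\<lambda>n. ennreal (f n x)) \<longlonglongrightarrow> indicator U x" for x
    proof (cases "x \<in> U")
      case True
      hence pos: "infdist x (- U) > 0"
        using U False by (metis Compl_iff Compl_empty_eq closed_Compl double_compl infdist_pos_not_in_closed)
      obtain m where m: "1 \<le> real m * infdist x (- U)"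
        using reals_Archimedean3[OF pos] by (metis less_imp_le)
      have "\<forall>\<^sub>F n in sequentially. f n x = 1"
        unfolding eventually_sequentially
      proof (intro exI[of _ m] allI impI)
        fix n assume "m \<le> n"
        hence "real m * infdist x (- U) \<le> real n * infdist x (- U)"
          by (intro mult_right_mono) (auto simp: infdist_nonneg)
        thus "f n x = 1" using m by (simp add: f_def)
      qed
      hence "\<forall>\<^sub>F n in sequentially. ennreal (f n x) = 1" by eventually_elim simp
      thus ?thesis using True by (auto intro: tendsto_eventually)
    next
      case False
      thus ?thesis by (simp add: f_def)
    qed
    have *: "(\<lambda>n. \<integral>\<^sup>+x. f n x \<partial>L) \<longlonglongrightarrow> emeasure L U" if "finite_measure L" "sets L = sets borel" for L
    proof -
      interpret L: finite_measure L by fact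
      note [measurable_cong] = that(2)
      have "(\<lambda>n. \<integral>\<^sup>+x. f n x \<partial>L) \<longlonglongrightarrow> (\<integral>\<^sup>+x. indicator U x \<partial>L)"
      proof (rule nn_integral_dominated_convergence[where w="\<lambda>_. 1"])
        show "(\<integral>\<^sup>+x. 1 \<partial>L) < \<infinity>"
          using L.emeasure_finite[of "space L"] by (simp add: less_top del: L.emeasure_finite)
        show "AE x in L. (\<lambda>n. ennreal (f n x)) \<longlonglongrightarrow> indicator U x" by (intro AE_I2 lim)
        show "AE x in L. ennreal (f n x) \<le> 1" for n by (simp add: f_def)
        show "indicator U \<in> borel_measurable L" by (intro borel_measurable_indicator) (simp add: that(2) U)
      qed simp_all
      thus ?thesis using U by (simp add: that)
    qed
    have "(\<integral>\<^sup>+x. f n x \<partial>M) = (\<integral>\<^sup>+x. f n x \<partial>N)" for n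
      by (rule cont) (auto simp: f_def infdist_nonneg intro!: continuous_intros)
    thus ?thesis
      using *[OF assms(1,2)] *[OF assms(3,4)] by (intro LIMSEQ_unique) auto
  qed
  show ?thesis
  proof (rule measure_eqI_generator_eq[where E="{S. open S}" and \<Omega>=UNIV and A="\<lambda>_. UNIV"])
    show "Int_stable {S :: 'a set. open S}" by (auto simp: Int_stable_def)
    show "sets M = sigma_sets UNIV {S. open S}" "sets N = sigma_sets UNIV {S. open S}"
      using assms by (simp_all add: sets_borel)
    show "emeasure M UNIV \<noteq> \<infinity>" for i :: nat by simp
  qed (use open_eq in auto)
qed

section \<open>Uniqueness of the Levy measure\<close>

text \<open>The density \<open>inverse (h x)\<close> undoes \<open>h\<close>. This removes a weight
  that was introduced to make an infinite measure finite.\<close>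

lemma density_cancel:
  assumes sets: "sets M = sets N" and h: "h \<in> borel_measurable M"
    and eq: "density M h = density N h"
    and M: "AE x in M. 0 < h x \<and> h x < \<infinity>" and N: "AE x in N. 0 < h x \<and> h x < \<infinity>"
  shows "M = N"
proof -
  have h': "h \<in> borel_measurable N" using h sets by (simp cong: measurable_cong_sets)
  have *: "density (density L h) (\<lambda>x. inverse (h x)) = L"
    if "h \<in> borel_measurable L" "AE x in L. 0 < h x \<and> h x < \<infinity>" for L
  proof -
    note [measurable] = that(1)
    have "density (density L h) (\<lambda>x. inverse (h x)) = density L (\<lambda>x. h x * inverse (h x))"
      by (rule density_density_eq) simp_all
    also have "\<dots> = density L (\<lambda>_. 1)"
    proof (rule density_cong)
      show "AE x in L. h x * inverse (h x) = 1"
        using that(2) by eventually_elim (auto simp: ennreal_divide_self[unfolded divide_ennreal_def])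
    qed simp_all
    finally show ?thesis by (simp add: density_1)
  qed
  show ?thesis using *[OF h M, unfolded eq] *[OF h' N] by (rule trans[OF sym])
qed

definition lk_integrand :: "'a::euclidean_space \<Rightarrow> 'a \<Rightarrow> complex" where
  "lk_integrand z x = cis (z \<bullet> x) - 1 - \<i> * complex_of_real (z \<bullet> x) * (if norm x \<le> 1 then 1 else 0)"

lemma borel_measurable_cis_inner [measurable]:
  "(\<lambda>x::'a::euclidean_space. cis (z \<bullet> x)) \<in> borel_measurable borel"
  unfolding cis_conv_exp by (intro borel_measurable_continuous_onI continuous_intros)

lemma borel_measurable_lk_integrand [measurable]: "lk_integrand z \<in> borel_measurable borel"
  unfolding lk_integrand_def by measurable

text \<open>Inside the unit ball this is the second-order Taylor remainder of the exponential;
  outside it the integrand is a difference of two numbers of modulus 1.\<close>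

lemma norm_lk_integrand_le: "cmod (lk_integrand z x) \<le> (2 + (norm z)\<^sup>2) * min 1 ((norm x)\<^sup>2)"
proof (cases "norm x \<le> 1")
  case True
  have "cmod (lk_integrand z x) \<le> (z \<bullet> x)\<^sup>2 / 2"
    using iexp_approx1[of "z \<bullet> x" 1] True
    by (simp add: lk_integrand_def cis_conv_exp power2_eq_square algebra_simps)
  also have "\<dots> \<le> (norm z * norm x)\<^sup>2"
  proof -
    have "(z \<bullet> x)\<^sup>2 \<le> (norm z * norm x)\<^sup>2"
      using Cauchy_Schwarz_ineq2[of z x] by (metis abs_ge_zero power2_abs power_mono)
    thus ?thesis using zero_le_power2[of "z \<bullet> x"] by linarith
  qed
  also have "\<dots> \<le> (2 + (norm z)\<^sup>2) * (norm x)\<^sup>2"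
    by (simp add: power_mult_distrib mult_right_mono)
  also have "(norm x)\<^sup>2 = min 1 ((norm x)\<^sup>2)"
    using True by (simp add: power_le_one)
  finally show ?thesis .
next
  case False
  have "cmod (lk_integrand z x) \<le> 2"
    using False norm_triangle_ineq4[of "cis (z \<bullet> x)" 1] by (simp add: lk_integrand_def)
  moreover have "1 \<le> (norm x)\<^sup>2" using False by (simp add: one_le_power)
  ultimately show ?thesis by (simp add: min_def) (smt (verit) zero_le_power2)
qed

lemma levy_measure_min_integrable:
  assumes "levy_measure \<nu>"
  shows "integrable \<nu> (\<lambda>x. min 1 ((norm x)\<^sup>2))"
proof (rule integrableI_nonneg)
  have [measurable_cong]: "sets \<nu> = sets borel" using assms by (simp add: levy_measure_def)
  show "(\<lambda>x. min 1 ((norm x)\<^sup>2)) \<in> borel_measurable \<nu>" by measurable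
qed (use assms in \<open>auto simp: levy_measure_def\<close>)

lemma levy_measure_integrableI:
  fixes f :: "'a::euclidean_space \<Rightarrow> 'b::{banach, second_countable_topology}"
  assumes "levy_measure \<nu>" "f \<in> borel_measurable borel" "\<And>x. norm (f x) \<le> C * min 1 ((norm x)\<^sup>2)"
  shows "integrable \<nu> f"
proof (rule Bochner_Integration.integrable_bound)
  have [measurable_cong]: "sets \<nu> = sets borel" using assms by (simp add: levy_measure_def)
  show "f \<in> borel_measurable \<nu>" using assms(2) by measurable
  show "integrable \<nu> (\<lambda>x. C * min 1 ((norm x)\<^sup>2))"
    using levy_measure_min_integrable[OF assms(1)] by simp
  show "AE x in \<nu>. norm (f x) \<le> norm (C * min 1 ((norm x)\<^sup>2))"
    using assms(3) by (intro AE_I2) (simp add: order_trans[OF _ abs_ge_self])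
qed

lemma lk_integrand_integrable: "levy_measure \<nu> \<Longrightarrow> integrable \<nu> (lk_integrand z)"
  by (rule levy_measure_integrableI[OF _ _ norm_lk_integrand_le]) auto

lemma continuous_lk_integral:
  assumes "levy_measure \<nu>"
  shows "continuous_on UNIV (\<lambda>z. \<integral>x. lk_integrand z x \<partial>\<nu>)"
proof (rule continuous_on_sequentiallyI)
  fix u :: "nat \<Rightarrow> 'a" and a assume u: "u \<longlonglongrightarrow> a"
  have [measurable_cong]: "sets \<nu> = sets borel" using assms by (simp add: levy_measure_def)
  obtain K where K: "\<And>n. norm (u n) \<le> K"
    using convergent_imp_Bseq[OF convergentI[OF u]] by (auto simp: Bseq_def)
  show "(\<lambda>n. \<integral>x. lk_integrand (u n) x \<partial>\<nu>) \<longlonglongrightarrow> (\<integral>x. lk_integrand a x \<partial>\<nu>)"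
  proof (rule integral_dominated_convergence[where w="\<lambda>x. (2 + K\<^sup>2) * min 1 ((norm x)\<^sup>2)"])
    show "integrable \<nu> (\<lambda>x. (2 + K\<^sup>2) * min 1 ((norm x)\<^sup>2))"
      using levy_measure_min_integrable[OF assms] by simp
    show "AE x in \<nu>. (\<lambda>n. lk_integrand (u n) x) \<longlonglongrightarrow> lk_integrand a x"
      unfolding lk_integrand_def cis_conv_exp using u by (intro AE_I2 tendsto_intros)
    show "AE x in \<nu>. norm (lk_integrand (u n) x) \<le> (2 + K\<^sup>2) * min 1 ((norm x)\<^sup>2)" for n
    proof (rule AE_I2)
      fix x
      have "(norm (u n))\<^sup>2 \<le> K\<^sup>2" using K by (intro power_mono) auto
      thus "norm (lk_integrand (u n) x) \<le> (2 + K\<^sup>2) * min 1 ((norm x)\<^sup>2)"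
        by (intro order_trans[OF norm_lk_integrand_le] mult_right_mono) auto
    qed
  qed simp_all
qed

definition lk_exponent :: "('a::euclidean_space \<Rightarrow> 'a) \<Rightarrow> 'a measure \<Rightarrow> 'a \<Rightarrow> 'a \<Rightarrow> complex" where
  "lk_exponent \<Sigma> \<nu> \<gamma> z = complex_of_real (- (z \<bullet> \<Sigma> z) / 2) + \<i> * complex_of_real (\<gamma> \<bullet> z) +
     (\<integral>x. lk_integrand z x \<partial>\<nu>)"

lemma LK_triplet_charf: "LK_triplet \<mu> \<Sigma> \<nu> \<gamma> \<Longrightarrow> charf \<mu> z = exp (lk_exponent \<Sigma> \<nu> \<gamma> z)"
  by (simp add: LK_triplet_def lk_exponent_def lk_integrand_def)

lemma continuous_lk_exponent:
  assumes "linear \<Sigma>" "levy_measure \<nu>"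
  shows "continuous_on UNIV (lk_exponent \<Sigma> \<nu> \<gamma>)"
  unfolding lk_exponent_def
  by (intro continuous_intros continuous_lk_integral assms linear_continuous_on
        linear_conv_bounded_linear[THEN iffD1]) simp

text \<open>The exponential determines the exponent only up to multiples of
  \<open>2 * pi * \<i>\<close>. The difference of the two exponents is continuous with values in
  this discrete set, hence constant, and it vanishes at 0.\<close>

lemma lk_exponent_unique:
  assumes 1: "LK_triplet \<mu> \<Sigma>1 \<nu>1 \<gamma>1" and 2: "LK_triplet \<mu> \<Sigma>2 \<nu>2 \<gamma>2"
  shows "lk_exponent \<Sigma>1 \<nu>1 \<gamma>1 = lk_exponent \<Sigma>2 \<nu>2 \<gamma>2"
proof -
  define f where "f z = lk_exponent \<Sigma>1 \<nu>1 \<gamma>1 z - lk_exponent \<Sigma>2 \<nu>2 \<gamma>2 z" for z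
  have cont: "continuous_on UNIV f"
    unfolding f_def using 1 2
    by (intro continuous_on_diff continuous_lk_exponent) (auto simp: LK_triplet_def)
  have exp: "exp (f z) = 1" for z
    using LK_triplet_charf[OF 1, of z] LK_triplet_charf[OF 2, of z] by (simp add: f_def exp_diff)
  have "f constant_on UNIV"
  proof (rule continuous_discrete_range_constant[OF _ cont])
    fix x
    have "2 * pi \<le> norm (f y - f x)" if "f y \<noteq> f x" for y
    proof -
      have "exp (f y - f x) = 1" by (simp add: exp_diff exp)
      then obtain n :: int where n: "Re (f y - f x) = 0" "Im (f y - f x) = of_int (2 * n) * pi"
        unfolding exp_eq_1 by auto
      have "n \<noteq> 0" using n that by (auto simp: complex_eq_iff)
      hence "2 * pi \<le> \<bar>Im (f y - f x)\<bar>"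
        unfolding n by (simp add: abs_mult)
      also have "\<dots> \<le> norm (f y - f x)" by (rule abs_Im_le_cmod)
      finally show ?thesis .
    qed
    thus "\<exists>e>0. \<forall>y. y \<in> UNIV \<and> f y \<noteq> f x \<longrightarrow> e \<le> norm (f y - f x)"
      by (intro exI[of _ "2 * pi"]) auto
  qed (rule connected_UNIV)
  then obtain c where c: "\<And>z. f z = c" by (auto simp: constant_on_def)
  have "linear \<Sigma>1" "linear \<Sigma>2" using 1 2 by (simp_all add: LK_triplet_def)
  hence "f 0 = 0"
    by (simp add: f_def lk_exponent_def lk_integrand_def linear_0)
  hence "f z = 0" for z using c by metis
  thus ?thesis by (auto simp: f_def)
qed

section \<open>Second differences of the Levy-Khintchine exponent\<close>

text \<open>This is the squared modulus of \<open>cis (w \<bullet> x) - 1\<close>, the factor that a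
  negated second difference with step \<open>w\<close> in the frequency puts on
  \<open>cis (z \<bullet> x)\<close>.\<close>

abbreviation cos_weight :: "'a::euclidean_space \<Rightarrow> 'a \<Rightarrow> real" where
  "cos_weight w x \<equiv> 2 - 2 * cos (w \<bullet> x)"

abbreviation cos_weight_sq :: "'a::euclidean_space \<Rightarrow> 'a \<Rightarrow> ennreal" where
  "cos_weight_sq w \<equiv> (\<lambda>x. ennreal ((cos_weight w x)\<^sup>2))"

text \<open>The weight equals \<open>4 * (sin ((w \<bullet> x) / 2))\<^sup>2\<close>, which is at
  most \<open>(w \<bullet> x)\<^sup>2\<close>.\<close>

lemma cos_weight_bounds:
  "0 \<le> cos_weight w x" "cos_weight w x \<le> 4" "cos_weight w x \<le> (4 + (norm w)\<^sup>2) * min 1 ((norm x)\<^sup>2)"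
proof -
  show "0 \<le> cos_weight w x" "cos_weight w x \<le> 4"
    using cos_ge_minus_one[of "w \<bullet> x"] cos_le_one[of "w \<bullet> x"] by linarith+
  have sin: "\<bar>sin (y::real)\<bar> \<le> \<bar>y\<bar>" for y by (rule abs_sin_x_le_abs_x)
  have "cos_weight w x = 4 * (sin ((w \<bullet> x) / 2))\<^sup>2"
    using cos_double_sin[of "(w \<bullet> x) / 2"] by simp
  also have "\<dots> \<le> 4 * ((w \<bullet> x) / 2)\<^sup>2"
    using power_mono[OF sin[of "(w \<bullet> x) / 2"], of 2] by (simp add: power_divide)
  also have "\<dots> = (w \<bullet> x)\<^sup>2" by (simp add: power_divide)
  also have "\<dots> \<le> (norm w)\<^sup>2 * (norm x)\<^sup>2"
    using Cauchy_Schwarz_ineq2[of w x] by (metis abs_ge_zero power2_abs power_mono power_mult_distrib)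
  finally have "cos_weight w x \<le> (norm w)\<^sup>2 * (norm x)\<^sup>2" .
  with \<open>cos_weight w x \<le> 4\<close> show "cos_weight w x \<le> (4 + (norm w)\<^sup>2) * min 1 ((norm x)\<^sup>2)"
    by (simp add: min_def distrib_right) (smt (verit) zero_le_power2)
qed

text \<open>Second differences kill the linear drift, reduce the quadratic form to a constant in
  \<open>z\<close>, and cancel the compensator inside the integral.\<close>

lemma second_difference_lk_exponent:
  assumes lin: "linear \<Sigma>" and sym: "\<And>x y. \<Sigma> x \<bullet> y = x \<bullet> \<Sigma> y" and levy: "levy_measure \<nu>"
  shows "lk_exponent \<Sigma> \<nu> \<gamma> (z + w) + lk_exponent \<Sigma> \<nu> \<gamma> (z - w) - 2 * lk_exponent \<Sigma> \<nu> \<gamma> z =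
    - complex_of_real (w \<bullet> \<Sigma> w) - (\<integral>x. cos_weight w x * cis (z \<bullet> x) \<partial>\<nu>)"
proof -
  note I = lk_integrand_integrable[OF levy]
  have pt: "lk_integrand (z + w) x + lk_integrand (z - w) x - 2 * lk_integrand z x = - (cos_weight w x * cis (z \<bullet> x))" for x
    by (simp add: lk_integrand_def inner_add_left inner_diff_left complex_eq_iff cos_add cos_diff sin_add sin_diff algebra_simps)
  have "(\<integral>x. lk_integrand (z + w) x \<partial>\<nu>) + (\<integral>x. lk_integrand (z - w) x \<partial>\<nu>) - 2 * (\<integral>x. lk_integrand z x \<partial>\<nu>)
      = (\<integral>x. lk_integrand (z + w) x + lk_integrand (z - w) x - 2 * lk_integrand z x \<partial>\<nu>)"
    by (simp add: I)
  also have "\<dots> = - (\<integral>x. cos_weight w x * cis (z \<bullet> x) \<partial>\<nu>)"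
    unfolding pt by simp
  finally have int: "(\<integral>x. lk_integrand (z + w) x \<partial>\<nu>) + (\<integral>x. lk_integrand (z - w) x \<partial>\<nu>) - 2 * (\<integral>x. lk_integrand z x \<partial>\<nu>)
      = - (\<integral>x. cos_weight w x * cis (z \<bullet> x) \<partial>\<nu>)" .
  have quad: "(z + w) \<bullet> \<Sigma> (z + w) + (z - w) \<bullet> \<Sigma> (z - w) - 2 * (z \<bullet> \<Sigma> z) = 2 * (w \<bullet> \<Sigma> w)"
    by (simp add: linear_add[OF lin] linear_diff[OF lin] inner_add_left inner_add_right inner_diff_left inner_diff_right)
  have quad': "complex_of_real (- ((z + w) \<bullet> \<Sigma> (z + w)) / 2) + complex_of_real (- ((z - w) \<bullet> \<Sigma> (z - w)) / 2)
      - 2 * complex_of_real (- (z \<bullet> \<Sigma> z) / 2) = - complex_of_real (w \<bullet> \<Sigma> w)"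
    using arg_cong[OF quad, of complex_of_real] by (simp add: field_simps)
  have drift: "\<i> * complex_of_real (\<gamma> \<bullet> (z + w)) + \<i> * complex_of_real (\<gamma> \<bullet> (z - w)) - 2 * (\<i> * complex_of_real (\<gamma> \<bullet> z)) = 0"
    by (simp add: inner_add_right inner_diff_right algebra_simps)
  have regroup: "(q1 + l1 + i1) + (q2 + l2 + i2) - 2 * (q3 + l3 + i3) = (q1 + q2 - 2 * q3) + (l1 + l2 - 2 * l3) + (i1 + i2 - 2 * i3)"
    for q1 l1 i1 q2 l2 i2 q3 l3 i3 :: complex by (simp add: algebra_simps)
  show ?thesis
    unfolding lk_exponent_def regroup quad' drift int by simp
qed

text \<open>A second difference in \<open>z\<close> leaves an additive constant coming from the Gaussian part;
  another one removes it.\<close>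
lemma levy_measure_weighted_unique:
  assumes 1: "LK_triplet \<mu> \<Sigma>1 \<nu>1 \<gamma>1" and 2: "LK_triplet \<mu> \<Sigma>2 \<nu>2 \<gamma>2"
  shows "density \<nu>1 (cos_weight_sq w) = density \<nu>2 (cos_weight_sq w)"
proof -
  define F where "F \<nu> z = (\<integral>x. cos_weight w x * cis (z \<bullet> x) \<partial>\<nu>)" for \<nu> z
  have lk: "linear \<Sigma>1" "\<And>x y. \<Sigma>1 x \<bullet> y = x \<bullet> \<Sigma>1 y" "levy_measure \<nu>1"
    "linear \<Sigma>2" "\<And>x y. \<Sigma>2 x \<bullet> y = x \<bullet> \<Sigma>2 y" "levy_measure \<nu>2"
    using 1 2 by (auto simp: LK_triplet_def)
  have F_eq: "complex_of_real (w \<bullet> \<Sigma>1 w) + F \<nu>1 z = complex_of_real (w \<bullet> \<Sigma>2 w) + F \<nu>2 z" for z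
  proof -
    have "- complex_of_real (w \<bullet> \<Sigma>1 w) - F \<nu>1 z = - complex_of_real (w \<bullet> \<Sigma>2 w) - F \<nu>2 z"
      unfolding F_def second_difference_lk_exponent[OF lk(1,2,3), symmetric, where \<gamma>=\<gamma>1]
        second_difference_lk_exponent[OF lk(4,5,6), symmetric, where \<gamma>=\<gamma>2] lk_exponent_unique[OF 1 2] ..
    thus ?thesis by (metis add_uminus_conv_diff minus_add_distrib neg_equal_iff_equal)
  qed
  \<comment> \<open>A further second difference, now of \<open>F\<close>, multiplies the integrand
    by the weight once more; this is where the square comes from.\<close>
  have *: "finite_measure (density \<nu> (cos_weight_sq w))"
    "charf (density \<nu> (cos_weight_sq w)) z = 2 * F \<nu> z - F \<nu> (z + w) - F \<nu> (z - w)"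
    if levy: "levy_measure \<nu>" for \<nu> z
  proof -
    have [measurable_cong]: "sets \<nu> = sets borel" using levy by (simp add: levy_measure_def)
    have I: "integrable \<nu> (\<lambda>x. cos_weight w x * cis (z \<bullet> x))" for z
    proof (rule levy_measure_integrableI[OF levy])
      fix x
      have "norm (cos_weight w x * cis (z \<bullet> x)) = \<bar>cos_weight w x\<bar>"
        by (simp only: norm_mult norm_cis norm_of_real mult_1_right)
      thus "norm (cos_weight w x * cis (z \<bullet> x)) \<le> (4 + (norm w)\<^sup>2) * min 1 ((norm x)\<^sup>2)"
        using cos_weight_bounds(1,3)[of w x] by linarith
    qed measurable
    have "integrable \<nu> (\<lambda>x. (cos_weight w x)\<^sup>2)"
    proof (rule levy_measure_integrableI[OF levy])
      fix x
      have "norm ((cos_weight w x)\<^sup>2) \<le> 4 * cos_weight w x"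
        using mult_right_mono[OF cos_weight_bounds(2,1)[of w x]] unfolding real_norm_def abs_power2 by (simp only: power2_eq_square)
      also have "\<dots> \<le> (4 * (4 + (norm w)\<^sup>2)) * min 1 ((norm x)\<^sup>2)"
        using mult_left_mono[OF cos_weight_bounds(3)[of w x], of 4] by (simp only: mult.assoc)
      finally show "norm ((cos_weight w x)\<^sup>2) \<le> (4 * (4 + (norm w)\<^sup>2)) * min 1 ((norm x)\<^sup>2)" .
    qed measurable
    hence "(\<integral>\<^sup>+x. ennreal ((cos_weight w x)\<^sup>2) \<partial>\<nu>) < \<infinity>"
      by (simp add: integrable_iff_bounded)
    thus "finite_measure (density \<nu> (cos_weight_sq w))"
      by (intro finite_measureI) (simp add: emeasure_density)
    have pt: "2 * (cos_weight w x * cis (z \<bullet> x)) - cos_weight w x * cis ((z + w) \<bullet> x) - cos_weight w x * cis ((z - w) \<bullet> x)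
       = (cos_weight w x)\<^sup>2 *\<^sub>R cis (z \<bullet> x)" for x
      by (simp add: inner_add_left inner_diff_left complex_eq_iff cos_add cos_diff sin_add sin_diff algebra_simps power2_eq_square)
    have "2 * F \<nu> z - F \<nu> (z + w) - F \<nu> (z - w) = (\<integral>x. 2 * (cos_weight w x * cis (z \<bullet> x)) - cos_weight w x * cis ((z + w) \<bullet> x) - cos_weight w x * cis ((z - w) \<bullet> x) \<partial>\<nu>)"
      unfolding F_def using I[of z] I[of "z + w"] I[of "z - w"] by simp
    also have "\<dots> = charf (density \<nu> (cos_weight_sq w)) z"
      unfolding pt charf_def by (subst integral_density) auto
    finally show "charf (density \<nu> (cos_weight_sq w)) z = 2 * F \<nu> z - F \<nu> (z + w) - F \<nu> (z - w)" ..
  qed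
  show ?thesis
  proof (rule charf_unique)
    \<comment> \<open>Here \<open>c1\<close> and \<open>c2\<close> are the Gaussian constants of
      \<open>F_eq\<close>; the coefficients 2, -1, -1 add up to 0, so they drop out.\<close>
    have cancel: "2 * a1 - b1 - d1 = 2 * a2 - b2 - d2"
      if "c1 + a1 = c2 + a2" "c1 + b1 = c2 + b2" "c1 + d1 = c2 + d2" for a1 b1 c1 d1 a2 b2 c2 d2 :: complex
      using that by (auto simp: complex_eq_iff)
    show "charf (density \<nu>1 (cos_weight_sq w)) z = charf (density \<nu>2 (cos_weight_sq w)) z" for z
      unfolding *(2)[OF lk(3)] *(2)[OF lk(6)] by (rule cancel) (rule F_eq)+
  qed (use * lk in \<open>auto simp: levy_measure_def\<close>)
qed

text \<open>Otherwise \<open>sqrt 2\<close> would be a quotient of integers. This provides two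
  frequencies whose weights have 0 as their only common zero.\<close>

lemma cos_sqrt2_zero:
  assumes "cos x = 1" "cos (sqrt 2 * x) = 1"
  shows "x = 0"
proof -
  obtain m :: int where m: "x = of_int m * 2 * pi" using assms(1) by (auto simp: cos_one_2pi_int)
  obtain n :: int where n: "sqrt 2 * x = of_int n * 2 * pi" using assms(2) by (auto simp: cos_one_2pi_int)
  have "sqrt 2 * of_int m = of_int n" using m n by simp
  hence "(sqrt 2 * of_int m)\<^sup>2 = (of_int n)\<^sup>2" by (rule arg_cong)
  hence "of_int (2 * m\<^sup>2) = (of_int (n\<^sup>2) :: real)"
    by (simp add: power_mult_distrib)
  hence eq: "2 * m\<^sup>2 = n\<^sup>2" by (simp only: of_int_eq_iff)
  have "m = 0"
  proof (rule ccontr)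
    assume "m \<noteq> 0"
    then obtain g a b where ab: "m = g * a" "n = g * b" "g \<noteq> 0" "coprime a b"
      using gcd_coprime_exists[of m n] by (metis gcd_eq_0_iff mult.commute)
    have "g\<^sup>2 * (2 * a\<^sup>2) = g\<^sup>2 * b\<^sup>2"
      using eq unfolding ab(1,2) by (simp add: power_mult_distrib)
    hence *: "2 * a\<^sup>2 = b\<^sup>2" using ab(3) by simp
    hence "even (b\<^sup>2)" by (metis dvd_triv_left)
    hence "even b" by simp
    then obtain c where "b = 2 * c" by auto
    hence "a\<^sup>2 = 2 * c\<^sup>2" using * by (simp add: power_mult_distrib)
    hence "even (a\<^sup>2)" by simp
    hence "even a" by simp
    with \<open>even b\<close> ab(4) show False using coprime_common_divisor[of a b 2] by simp
  qed
  thus ?thesis using m by simp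
qed

text \<open>A single weight vanishes wherever \<open>w \<bullet> x\<close> is a multiple of
  \<open>2 * pi\<close>. Summing over each basis vector and its multiple by \<open>sqrt 2\<close>
  leaves the origin as the only zero; Levy measures do not charge it, so the weight can be
  cancelled.\<close>

theorem LK_levy_measure_unique:
  assumes 1: "LK_triplet \<mu> \<Sigma>1 \<nu>1 \<gamma>1" and 2: "LK_triplet \<mu> \<Sigma>2 \<nu>2 \<gamma>2"
  shows "\<nu>1 = (\<nu>2 :: 'a::euclidean_space measure)"
proof (rule density_cancel)
  let ?W = "Basis \<union> (\<lambda>b. sqrt 2 *\<^sub>R b) ` Basis :: 'a set"
  let ?h = "\<lambda>x. \<Sum>w\<in>?W. ennreal ((cos_weight w x)\<^sup>2)"
  have levy: "levy_measure \<nu>1" "levy_measure \<nu>2" using 1 2 by (simp_all add: LK_triplet_def)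
  note [measurable_cong] = levy[unfolded levy_measure_def, THEN conjunct1]
  show "sets \<nu>1 = sets \<nu>2" using levy by (simp add: levy_measure_def)
  show "?h \<in> borel_measurable \<nu>1" by measurable
  show "density \<nu>1 ?h = density \<nu>2 ?h"
  proof (rule measure_eqI)
    fix A assume "A \<in> sets (density \<nu>1 ?h)"
    hence [measurable]: "A \<in> sets borel" using levy by (simp add: levy_measure_def)
    have single: "emeasure (density \<nu>1 (cos_weight_sq w)) A = emeasure (density \<nu>2 (cos_weight_sq w)) A" for w
      by (simp only: levy_measure_weighted_unique[OF 1 2])
    have expand: "emeasure (density \<nu> ?h) A = (\<Sum>w\<in>?W. emeasure (density \<nu> (cos_weight_sq w)) A)"
      if [measurable_cong]: "sets \<nu> = sets borel" for \<nu>
    proof -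
      have "emeasure (density \<nu> ?h) A = (\<integral>\<^sup>+x. ?h x * indicator A x \<partial>\<nu>)"
        by (rule emeasure_density) measurable
      also have "\<dots> = (\<integral>\<^sup>+x. (\<Sum>w\<in>?W. ennreal ((cos_weight w x)\<^sup>2) * indicator A x) \<partial>\<nu>)"
        by (simp only: sum_distrib_right)
      also have "\<dots> = (\<Sum>w\<in>?W. \<integral>\<^sup>+x. ennreal ((cos_weight w x)\<^sup>2) * indicator A x \<partial>\<nu>)"
        by (rule nn_integral_sum) measurable
      also have "\<dots> = (\<Sum>w\<in>?W. emeasure (density \<nu> (cos_weight_sq w)) A)"
        by (intro sum.cong refl emeasure_density[symmetric]) measurable
      finally show ?thesis .
    qed
    show "emeasure (density \<nu>1 ?h) A = emeasure (density \<nu>2 ?h) A"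
      unfolding expand[OF levy(1)[unfolded levy_measure_def, THEN conjunct1]] expand[OF levy(2)[unfolded levy_measure_def, THEN conjunct1]] single ..
  qed (use levy in \<open>simp add: levy_measure_def\<close>)
  have pos: "0 < ?h x \<and> ?h x < \<infinity>" if "x \<noteq> 0" for x
  proof -
    obtain b where b: "b \<in> Basis" "x \<bullet> b \<noteq> 0" using \<open>x \<noteq> 0\<close> euclidean_all_zero_iff[of x] by blast
    have "cos (b \<bullet> x) \<noteq> 1 \<or> cos ((sqrt 2 *\<^sub>R b) \<bullet> x) \<noteq> 1"
      using cos_sqrt2_zero[of "b \<bullet> x"] b by (auto simp: inner_commute)
    hence "\<exists>w\<in>?W. cos (w \<bullet> x) \<noteq> 1" using b by blast
    then obtain w where w: "w \<in> ?W" "cos (w \<bullet> x) \<noteq> 1" by blast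
    have "0 < ennreal ((cos_weight w x)\<^sup>2)" using w(2) by simp
    also have "\<dots> \<le> ?h x" using w(1) by (intro member_le_sum) auto
    finally show ?thesis by (simp add: less_top)
  qed
  have "AE x in \<nu>. x \<noteq> 0" if "levy_measure \<nu>" for \<nu> :: "'a measure"
    using that by (intro AE_I[of _ _ "{0}"]) (auto simp: levy_measure_def)
  note ae = this[OF levy(1)] this[OF levy(2)]
  show "AE x in \<nu>1. 0 < ?h x \<and> ?h x < \<infinity>" using ae(1) by eventually_elim (rule pos)
  show "AE x in \<nu>2. 0 < ?h x \<and> ?h x < \<infinity>" using ae(2) by eventually_elim (rule pos)
qed

section \<open>The Hausdorff moment problem\<close>

definition unit_interval_measure :: "real measure \<Rightarrow> bool" where
  "unit_interval_measure M \<longleftrightarrow> finite_measure M \<and> sets M = sets borel \<and> (AE t in M. t \<in> {0..1})"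

text \<open>A continuous step falling from 1 at \<open>a\<close> to 0 at
  \<open>a + inverse (real (Suc i))\<close> is replaced by a Bernstein polynomial with error below
  \<open>inverse (real (Suc i))\<close>. The closed endpoint gives the indicator of
  \<open>{..a}\<close> in the limit, and the bound 2 serves dominated convergence.\<close>

lemma Bernstein_approx_indicator:
  obtains N :: "nat \<Rightarrow> nat" and c :: "nat \<Rightarrow> nat \<Rightarrow> real" where
    "\<And>i t. t \<in> {0..1} \<Longrightarrow> \<bar>\<Sum>k\<le>N i. c i k * Bernstein (N i) k t\<bar> \<le> 2"
    "\<And>t. t \<in> {0..1} \<Longrightarrow> (\<lambda>i. \<Sum>k\<le>N i. c i k * Bernstein (N i) k t) \<longlonglongrightarrow> indicator {..a} t"
proof -
  define f where "f i = cts_step a (a + inverse (real (Suc i)))" for i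
  have "\<exists>N. \<forall>n x. N \<le> n \<and> x \<in> {0..1} \<longrightarrow> \<bar>f i x - (\<Sum>k\<le>n. f i (k/n) * Bernstein n k x)\<bar> < inverse (real (Suc i))" for i
    unfolding f_def
    by (intro Bernstein_Weierstrass continuous_on_subset[OF uniformly_continuous_imp_continuous[OF cts_step_uniformly_continuous]]) simp_all
  then obtain N where N: "\<And>i x. x \<in> {0..1} \<Longrightarrow> \<bar>f i x - (\<Sum>k\<le>N i. f i (k/N i) * Bernstein (N i) k x)\<bar> < inverse (real (Suc i))"
    by (metis order_refl)
  have f01: "0 \<le> f i x" "f i x \<le> 1" for i x
  proof -
    have "0 \<le> cts_step a b x \<and> cts_step a b x \<le> 1" if "a < b" for b
      using that by (auto simp: cts_step_def divide_le_eq_1)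
    thus "0 \<le> f i x" "f i x \<le> 1" by (simp_all add: f_def)
  qed
  show ?thesis
  proof (rule that[of "\<lambda>i k. f i (k / N i)" N])
    fix i and t :: real assume "t \<in> {0..1}"
    from N[OF this, of i] f01[of i t] inverse_le_1_iff[of "real (Suc i)"]
    show "\<bar>\<Sum>k\<le>N i. f i (k / N i) * Bernstein (N i) k t\<bar> \<le> 2" by linarith
  next
    fix t :: real assume t: "t \<in> {0..1}"
    have "(\<lambda>i. f i t) \<longlonglongrightarrow> indicator {..a} t"
    proof (cases "t \<le> a")
      case True
      thus ?thesis by (simp add: f_def cts_step_def)
    next
      case False
      hence "\<forall>\<^sub>F i in sequentially. inverse (real (Suc i)) < t - a"
        using order_tendstoD(2)[OF LIMSEQ_inverse_real_of_nat, of "t - a"] by simp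
      hence "\<forall>\<^sub>F i in sequentially. f i t = 0"
        by eventually_elim (use False in \<open>auto simp: f_def cts_step_def\<close>)
      thus ?thesis using False by (auto intro: tendsto_eventually)
    qed
    moreover have "(\<lambda>i. f i t - (\<Sum>k\<le>N i. f i (k / N i) * Bernstein (N i) k t)) \<longlonglongrightarrow> 0"
    proof (rule Lim_null_comparison)
      show "\<forall>\<^sub>F i in sequentially. norm (f i t - (\<Sum>k\<le>N i. f i (k / N i) * Bernstein (N i) k t)) \<le> inverse (real (Suc i))"
        using N[OF t] by (auto intro!: always_eventually less_imp_le)
    qed (rule LIMSEQ_inverse_real_of_nat)
    ultimately have "(\<lambda>i. f i t - (f i t - (\<Sum>k\<le>N i. f i (k / N i) * Bernstein (N i) k t))) \<longlonglongrightarrow> indicator {..a} t - 0"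
      by (intro tendsto_diff)
    thus "(\<lambda>i. \<Sum>k\<le>N i. f i (k / N i) * Bernstein (N i) k t) \<longlonglongrightarrow> indicator {..a} t" by simp
  qed
qed

text \<open>Order of arguments: \<open>n\<close> is the power of \<open>1 - t\<close> and
  \<open>k\<close> the power of \<open>t\<close>.\<close>

abbreviation mixed_moment :: "real measure \<Rightarrow> nat \<Rightarrow> nat \<Rightarrow> real" where
  "mixed_moment M n k \<equiv> (\<integral>t. t ^ k * (1 - t) ^ n \<partial>M)"

lemma unit_power_bound: "t \<in> {0..1} \<Longrightarrow> \<bar>t ^ k * (1 - t) ^ n\<bar> \<le> (1::real)"
  by (auto simp: abs_mult power_le_one intro!: mult_le_one)

lemma integrable_mixed_moment:
  assumes "unit_interval_measure M"
  shows "integrable M (\<lambda>t. t ^ k * (1 - t) ^ n)"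
proof -
  interpret finite_measure M using assms by (simp add: unit_interval_measure_def)
  have [measurable_cong]: "sets M = sets borel" and ae: "AE t in M. t \<in> {0..1}"
    using assms by (auto simp: unit_interval_measure_def)
  show ?thesis
  proof (rule integrable_const_bound[where B=1])
    show "AE t in M. norm (t ^ k * (1 - t) ^ n) \<le> 1"
      using ae by eventually_elim (use unit_power_bound in auto)
  qed measurable
qed

text \<open>The degrees \<open>N\<close> and the coefficients \<open>c\<close> do not depend on the
  measure. This uniformity gives both uniqueness (equal moments, equal limits) and measurability of
  kernels (limits of measurable functions).\<close>

lemma cdf_eq_lim_moments:
  obtains N :: "nat \<Rightarrow> nat" and c :: "nat \<Rightarrow> nat \<Rightarrow> real" where
    "\<And>M. unit_interval_measure M \<Longrightarrow>
      (\<lambda>i. \<Sum>k\<le>N i. c i k * mixed_moment M (N i - k) k) \<longlonglongrightarrow> measure M {..a}"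
proof -
  obtain c N where c: "\<And>i t. t \<in> {0..1} \<Longrightarrow> \<bar>\<Sum>k\<le>N i. c i k * Bernstein (N i) k t\<bar> \<le> 2"
    "\<And>t. t \<in> {0..1} \<Longrightarrow> (\<lambda>i. \<Sum>k\<le>N i. c i k * Bernstein (N i) k t) \<longlonglongrightarrow> indicator {..a} t"
    by (rule Bernstein_approx_indicator[of a], rule that)
  show ?thesis
  proof (rule that[of "\<lambda>i k. c i k * real (N i choose k)" N])
    fix M assume M: "unit_interval_measure M"
    interpret finite_measure M using M by (simp add: unit_interval_measure_def)
    have [measurable_cong]: "sets M = sets borel" and ae: "AE t in M. t \<in> {0..1}"
      using M by (auto simp: unit_interval_measure_def)
    have [measurable]: "Bernstein n k \<in> borel_measurable borel" for n k
      unfolding Bernstein_def by measurable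
    have "(\<lambda>i. \<integral>t. (\<Sum>k\<le>N i. c i k * Bernstein (N i) k t) \<partial>M) \<longlonglongrightarrow> (\<integral>t. indicator {..a} t \<partial>M)"
    proof (rule integral_dominated_convergence[where w="\<lambda>_. 2"])
      show "AE t in M. (\<lambda>i. \<Sum>k\<le>N i. c i k * Bernstein (N i) k t) \<longlonglongrightarrow> indicator {..a} t"
        using ae by eventually_elim (rule c)
      show "AE t in M. norm (\<Sum>k\<le>N i. c i k * Bernstein (N i) k t) \<le> 2" for i
        using ae by eventually_elim (use c in auto)
    qed auto
    also have "(\<lambda>i. \<integral>t. (\<Sum>k\<le>N i. c i k * Bernstein (N i) k t) \<partial>M) =
       (\<lambda>i. \<Sum>k\<le>N i. c i k * real (N i choose k) * mixed_moment M (N i - k) k)"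
      using integrable_mixed_moment[OF M]
      by (simp add: Bernstein_def mult.assoc)
    finally show "(\<lambda>i. \<Sum>k\<le>N i. c i k * real (N i choose k) * mixed_moment M (N i - k) k) \<longlonglongrightarrow> measure M {..a}"
      by simp
  qed
qed

lemma mixed_moments_determine:
  assumes M: "unit_interval_measure M" and N: "unit_interval_measure N"
    and eq: "\<And>n k. mixed_moment M n k = mixed_moment N n k"
  shows "M = N"
proof (rule measure_eqI_generator_eq[where E="range atMost" and \<Omega>=UNIV and A="\<lambda>i. {..real i}"])
  interpret M: finite_measure M using M by (simp add: unit_interval_measure_def)
  interpret N: finite_measure N using N by (simp add: unit_interval_measure_def)
  have "measure M {..a} = measure N {..a}" for a
  proof -
    obtain c m where *: "\<And>M. unit_interval_measure M \<Longrightarrow>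
        (\<lambda>i. \<Sum>k\<le>m i. c i k * mixed_moment M (m i - k) k) \<longlonglongrightarrow> measure M {..a}"
      by (rule cdf_eq_lim_moments[of a], rule that)
    from *[OF M] *[OF N] show ?thesis unfolding eq by (rule LIMSEQ_unique)
  qed
  thus "X \<in> range atMost \<Longrightarrow> emeasure M X = emeasure N X" for X
    by (auto simp: M.emeasure_eq_measure N.emeasure_eq_measure)
  show "sets M = sigma_sets UNIV (range atMost)" "sets N = sigma_sets UNIV (range atMost)"
    using M N by (auto simp: unit_interval_measure_def borel_eq_atMost)
  show "(\<Union>i. {..real i}) = UNIV" by (auto intro: real_arch_simple)
  show "emeasure M {..real i} \<noteq> \<infinity>" for i by simp
  show "Int_stable (range (atMost :: real \<Rightarrow> _))" by (auto simp: Int_stable_def)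
qed auto

text \<open>Multiplying by \<open>1 - t\<close> is a difference of consecutive powers of
  \<open>t\<close>, so pure moments fix the mixed ones by recursion on \<open>n\<close>.\<close>

lemma pure_moments_determine:
  assumes M: "unit_interval_measure M" and N: "unit_interval_measure N"
    and eq: "\<And>k. (\<integral>t. t ^ k \<partial>M) = (\<integral>t. t ^ k \<partial>N)"
  shows "M = N"
proof (rule mixed_moments_determine[OF M N])
  have Suc: "mixed_moment L (Suc n) k = mixed_moment L n k - mixed_moment L n (Suc k)"
    if "unit_interval_measure L" for L n k
    unfolding Bochner_Integration.integral_diff[OF integrable_mixed_moment[OF that] integrable_mixed_moment[OF that], symmetric]
    by (simp add: algebra_simps)
  show "mixed_moment M n k = mixed_moment N n k" for n k
    by (induction n arbitrary: k) (simp_all add: eq Suc[OF M] Suc[OF N] del: power_Suc)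
qed

text \<open>The mass of each half-line is a pointwise limit of fixed linear combinations of moments,
  and half-lines generate the Borel sets. No regularity in the selection of \<open>K x\<close>
  enters, so it may come from \<open>SOME\<close>.\<close>

lemma measurable_kernel_of_moments:
  assumes K: "\<And>x. x \<in> space X \<Longrightarrow> unit_interval_measure (K x)" "\<And>x. x \<in> space X \<Longrightarrow> prob_space (K x)"
    and [measurable]: "\<And>n k. (\<lambda>x. mixed_moment (K x) n k) \<in> borel_measurable X"
  shows "K \<in> X \<rightarrow>\<^sub>M prob_algebra borel"
proof (rule measurable_prob_algebra_generated[where \<Omega>=UNIV and G="range atMost"])
  show "sets (borel :: real measure) = sigma_sets UNIV (range atMost)" by (simp add: borel_eq_atMost)
  show "Int_stable (range (atMost :: real \<Rightarrow> _))" by (auto simp: Int_stable_def)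
  fix A :: "real set" assume "A \<in> range atMost"
  then obtain a where A: "A = {..a}" by auto
  obtain c m where *: "\<And>M. unit_interval_measure M \<Longrightarrow>
      (\<lambda>i. \<Sum>k\<le>m i. c i k * mixed_moment M (m i - k) k) \<longlonglongrightarrow> measure M {..a}"
    by (rule cdf_eq_lim_moments[of a], rule that)
  have "(\<lambda>x. measure (K x) A) \<in> borel_measurable X"
    unfolding A
    by (rule borel_measurable_LIMSEQ_real[OF *[OF K(1)]]) measurable
  hence "(\<lambda>x. ennreal (measure (K x) A)) \<in> borel_measurable X" by measurable
  thus "(\<lambda>x. emeasure (K x) A) \<in> borel_measurable X"
    by (subst measurable_cong) (auto simp: finite_measure.emeasure_eq_measure[OF prob_space.finite_measure[OF K(2)]])
qed (use K in \<open>auto simp: unit_interval_measure_def\<close>)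

section \<open>Existence of a measure with prescribed moments\<close>

lemma sum_choose_Suc:
  fixes x :: "nat \<Rightarrow> real"
  shows "(\<Sum>k\<le>Suc n. real (Suc n choose k) * x k) = (\<Sum>k\<le>n. real (n choose k) * x k) + (\<Sum>k\<le>n. real (n choose k) * x (Suc k))"
proof -
  have "(\<Sum>k\<le>n. real (n choose k) * x k) = (\<Sum>k\<le>Suc n. real (n choose k) * x k)" by simp
  also have "\<dots> = x 0 + (\<Sum>k\<le>n. real (n choose Suc k) * x (Suc k))"
    by (subst sum.atMost_Suc_shift) simp
  finally have "(\<Sum>k\<le>n. real (n choose k) * x k) = x 0 + (\<Sum>k\<le>n. real (n choose Suc k) * x (Suc k))" .
  thus ?thesis
    by (subst sum.atMost_Suc_shift) (simp add: distrib_right sum.distrib)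
qed

lemma sum_choose_absorb:
  fixes F :: "nat \<Rightarrow> real"
  shows "(\<Sum>k\<le>Suc n. real (Suc n choose k) * (real k * F k)) = real (Suc n) * (\<Sum>k\<le>n. real (n choose k) * F (Suc k))"
proof -
  have "real (Suc n choose Suc k) * real (Suc k) = real (Suc n) * real (n choose k)" for k
    using Suc_times_binomial_eq[of n k] by (metis of_nat_mult)
  thus ?thesis
    by (subst sum.atMost_Suc_shift) (simp add: sum_distrib_left flip: mult.assoc del: binomial_Suc_Suc of_nat_Suc)
qed

text \<open>\<open>q n k\<close> is a candidate for \<open>mixed_moment M n k\<close>. The recursion
  expresses \<open>t + (1 - t) = 1\<close>, and nonnegativity is Hausdorff's condition that the
  sequence \<open>q 0\<close> be completely monotone.\<close>

locale hausdorff_moments =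
  fixes q :: "nat \<Rightarrow> nat \<Rightarrow> real"
  assumes q_nonneg: "0 \<le> q n k" and q_rec: "q n k = q (Suc n) k + q n (Suc k)" and q_00: "q 0 0 = 1"
begin

lemma q_expand: "q a b = (\<Sum>k\<le>n. real (n choose k) * q (a + n - k) (b + k))"
proof (induction n arbitrary: a b)
  case (Suc n)
  have "q a b = q (Suc a) b + q a (Suc b)" by (rule q_rec)
  also have "\<dots> = (\<Sum>k\<le>n. real (n choose k) * q (a + Suc n - k) (b + k)) + (\<Sum>k\<le>n. real (n choose k) * q (a + Suc n - Suc k) (b + Suc k))"
    using Suc.IH[of "Suc a" b] Suc.IH[of a "Suc b"] by simp
  also have "\<dots> = (\<Sum>k\<le>Suc n. real (Suc n choose k) * q (a + Suc n - k) (b + k))"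
    by (rule sum_choose_Suc[symmetric])
  finally show ?case .
qed simp

text \<open>These are the factorial moments of the weights \<open>w n\<close> below when
  \<open>b = 0\<close>. In the induction on \<open>j\<close> the factor \<open>real k\<close> of the
  falling factorial is absorbed into the binomial coefficient, which raises \<open>b\<close> by one;
  hence the general \<open>b\<close>.\<close>

lemma q_falling:
  "(\<Sum>k\<le>n. real (n choose k) * (q (n - k) (b + k) * (\<Prod>i<j. real k - real i))) = (\<Prod>i<j. real n - real i) * q 0 (b + j)"
proof (induction j arbitrary: n b)
  case 0
  show ?case using q_expand[of 0 b n] by simp
next
  case (Suc j)
  show ?case
  proof (cases n)
    case 0
    thus ?thesis by (simp add: prod.lessThan_Suc_shift del: prod.lessThan_Suc)
  next
    case (Suc m)
    have "(\<Prod>i<Suc j. real k - real i) = real k * (\<Prod>i<j. real k - real (Suc i))" for k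
      by (simp add: prod.lessThan_Suc_shift del: prod.lessThan_Suc)
    hence "(\<Sum>k\<le>n. real (n choose k) * (q (n - k) (b + k) * (\<Prod>i<Suc j. real k - real i))) =
       (\<Sum>k\<le>Suc m. real (Suc m choose k) * (real k * (q (Suc m - k) (b + k) * (\<Prod>i<j. real k - real (Suc i)))))"
      unfolding Suc by (intro sum.cong refl) simp
    also have "\<dots> = real (Suc m) * (\<Sum>k\<le>m. real (m choose k) * (q (m - k) (Suc b + k) * (\<Prod>i<j. real k - real i)))"
      by (subst sum_choose_absorb) simp
    also have "\<dots> = (\<Prod>i<Suc j. real n - real i) * q 0 (b + Suc j)"
      unfolding Suc.IH by (simp add: Suc prod.lessThan_Suc_shift del: prod.lessThan_Suc)
    finally show ?thesis .
  qed
qed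

text \<open>If \<open>q\<close> comes from a measure on [0, 1], this is the probability of
  \<open>k\<close> successes in \<open>n\<close> trials whose success probability is drawn from that
  measure.\<close>

definition w :: "nat \<Rightarrow> nat \<Rightarrow> real" where "w n k = real (n choose k) * q (n - k) k"

lemma w_nonneg: "0 \<le> w n k" by (simp add: w_def q_nonneg)

lemma sum_w: "(\<Sum>k\<le>n. w n k) = 1"
  using q_expand[of 0 0 n] q_00 by (simp add: w_def)

text \<open>A product of factors bounded by 1 moves by at most the sum of the changes of its
  factors. The condition \<open>n > 2 * j\<close> keeps the factors bounded even where
  \<open>k < i\<close>. The bound is uniform in \<open>k\<close>.\<close>

lemma falling_ratio_close:
  assumes n: "n > 2 * j" and k: "k \<le> n"
  shows "\<bar>(\<Prod>i<j. (real k - real i) / (real n - real i)) - (real k / real n) ^ j\<bar> \<le> real j * (real j / (real n - real j))"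
proof -
  have "\<bar>(\<Prod>i<j. (real k - real i) / (real n - real i)) - (\<Prod>i<j. real k / real n)\<bar>
     \<le> (\<Sum>i<j. \<bar>(real k - real i) / (real n - real i) - real k / real n\<bar>)"
    unfolding real_norm_def[symmetric]
  proof (rule norm_prod_diff)
    fix i assume "i \<in> {..<j}"
    hence "\<bar>real k - real i\<bar> \<le> \<bar>real n - real i\<bar>" using n k by (auto simp: abs_if)
    thus "norm ((real k - real i) / (real n - real i)) \<le> 1"
      by (simp add: divide_le_eq_1)
    show "norm (real k / real n) \<le> 1" using n k by (simp add: divide_le_eq_1)
  qed
  also have "\<dots> \<le> (\<Sum>i<j. real j / (real n - real j))"
  proof (rule sum_mono)
    fix i assume i: "i \<in> {..<j}"
    have pos: "real n - real i > 0" "real n - real j > 0" "real n > 0" using n i by auto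
    have "(real k - real i) / (real n - real i) - real k / real n = - (real i * ((real n - real k) / real n) / (real n - real i))"
      using pos by (simp add: field_simps)
    hence "\<bar>(real k - real i) / (real n - real i) - real k / real n\<bar> = real i * ((real n - real k) / real n) / (real n - real i)"
      using pos k by simp
    also have "\<dots> \<le> real j * 1 / (real n - real j)"
      using pos k i by (intro frac_le mult_mono) auto
    finally show "\<bar>(real k - real i) / (real n - real i) - real k / real n\<bar> \<le> real j / (real n - real j)" by simp
  qed
  finally show ?thesis by simp
qed

lemma empirical_moments: "(\<lambda>n. \<Sum>k\<le>n. w n k * (real k / real n) ^ j) \<longlonglongrightarrow> q 0 j"
proof -
  have "(\<lambda>n. (\<Sum>k\<le>n. w n k * (real k / real n) ^ j) - q 0 j) \<longlonglongrightarrow> 0"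
  proof (rule Lim_null_comparison)
    show "(\<lambda>n. real j * (real j / (real n - real j))) \<longlonglongrightarrow> 0"
      by real_asymp
    show "\<forall>\<^sub>F n in sequentially. norm ((\<Sum>k\<le>n. w n k * (real k / real n) ^ j) - q 0 j) \<le> real j * (real j / (real n - real j))"
      using eventually_gt_at_top[of "2 * j"]
    proof eventually_elim
      case (elim n)
      have nz: "(\<Prod>i<j. real n - real i) \<noteq> 0" using elim by auto
      have "q 0 j = (\<Sum>k\<le>n. w n k * (\<Prod>i<j. (real k - real i) / (real n - real i)))"
        using q_falling[of n 0 j] nz
        by (simp add: w_def prod_dividef sum_divide_distrib[symmetric] mult.assoc)
      hence "\<bar>(\<Sum>k\<le>n. w n k * (real k / real n) ^ j) - q 0 j\<bar> =
          \<bar>\<Sum>k\<le>n. w n k * ((\<Prod>i<j. (real k - real i) / (real n - real i)) - (real k / real n) ^ j)\<bar>"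
        by (simp add: right_diff_distrib sum_subtractf abs_minus_commute)
      also have "\<dots> \<le> (\<Sum>k\<le>n. w n k * (real j * (real j / (real n - real j))))"
        using falling_ratio_close[OF elim] w_nonneg
        by (intro order_trans[OF sum_abs] sum_mono) (simp only: abs_mult abs_of_nonneg atMost_iff mult_left_mono)
      also have "\<dots> = real j * (real j / (real n - real j))"
        by (simp only: sum_distrib_right[symmetric] sum_w mult_1)
      finally show ?case by simp
    qed
  qed
  thus ?thesis by (rule LIM_zero_cancel)
qed

text \<open>The law of the proportion of successes; by the law of large numbers it should converge
  to the measure sought.\<close>

definition empirical :: "nat \<Rightarrow> real measure" where
  "empirical n = distr (point_measure {..n} (\<lambda>k. ennreal (w n k))) borel (\<lambda>k. real k / real n)"

lemma measurable_point [measurable]: "f \<in> point_measure A p \<rightarrow>\<^sub>M borel" for f :: "nat \<Rightarrow> real"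
  by (simp add: measurable_point_measure_eq1)

lemma integral_empirical:
  assumes [measurable]: "f \<in> borel_measurable borel"
  shows "(\<integral>x. f x \<partial>empirical n) = (\<Sum>k\<le>n. w n k * f (real k / real n))"
  unfolding empirical_def
  by (subst integral_distr) (simp_all add: lebesgue_integral_point_measure_finite w_nonneg)

lemma real_distribution_empirical: "real_distribution (empirical n)"
proof -
  have "prob_space (point_measure {..n} (\<lambda>k. ennreal (w n k)))"
    by (rule prob_spaceI) (simp add: emeasure_point_measure_finite space_point_measure w_nonneg sum_w)
  then interpret prob_space "empirical n"
    unfolding empirical_def by (rule prob_space.prob_space_distr) measurable
  show ?thesis by unfold_locales (simp add: empirical_def)
qed

lemma tight_empirical: "tight empirical"
  unfolding tight_def
proof (intro conjI allI impI)
  fix \<epsilon> :: real assume "\<epsilon> > 0"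
  have "measure (empirical n) {-1<..1} = 1" for n
  proof -
    interpret real_distribution "empirical n" by (rule real_distribution_empirical)
    have "measure (empirical n) {-1<..1} = (\<integral>x. indicator {-1<..1} x \<partial>empirical n)" by simp
    also have "\<dots> = (\<Sum>k\<le>n. w n k * indicator {-1<..1} (real k / real n))"
      by (rule integral_empirical) measurable
    also have "\<dots> = (\<Sum>k\<le>n. w n k)"
    proof (rule sum.cong[OF refl])
      fix k assume "k \<in> {..n}"
      hence "real k / real n \<le> 1" by (cases "n = 0") auto
      moreover have "-1 < real k / real n" by (rule less_le_trans[of _ 0]) auto
      ultimately show "w n k * indicator {-1<..1} (real k / real n) = w n k" by simp
    qed
    finally show ?thesis by (simp add: sum_w)
  qed
  thus "\<exists>a b. a < b \<and> (\<forall>n. 1 - \<epsilon> < measure (empirical n) {a<..b})"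
    using \<open>\<epsilon> > 0\<close> by (intro exI[of _ "-1"] exI[of _ 1]) auto
qed (rule real_distribution_empirical)

text \<open>The laws \<open>empirical n\<close> all live on [0, 1], so a subsequence converges
  weakly. Its limit has the moments \<open>q 0 j\<close> by \<open>empirical_moments\<close>, and
  the recursion supplies the mixed ones.\<close>

theorem hausdorff_moment_problem:
  "\<exists>M. prob_space M \<and> unit_interval_measure M \<and> (\<forall>n k. mixed_moment M n k = q n k)"
proof -
  obtain r M where r: "strict_mono r" and M: "real_distribution M" and conv: "weak_conv_m (\<lambda>n. empirical (r n)) M"
    using tight_imp_convergent_subsubsequence[OF tight_empirical strict_mono_id] by (auto simp: comp_def)
  interpret M: real_distribution M by (rule M)
  have lim: "(\<lambda>n. \<integral>x. f x \<partial>empirical (r n)) \<longlonglongrightarrow> (\<integral>x. f x \<partial>M)"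
    if "\<And>x. isCont f x" "\<And>x. \<bar>f x\<bar> \<le> B" for f :: "real \<Rightarrow> real" and B
    using that by (intro weak_conv_imp_integral_bdd_continuous_conv[OF real_distribution_empirical M conv]) auto
  have unit: "real k / real n \<in> {0..1}" if "k \<le> n" for k n
    using that by (cases "n = 0") auto
  \<comment> \<open>Weak convergence admits only bounded continuous test functions on the whole
    line. Clamping to [0, 1] makes powers bounded without changing them on the support.\<close>
  define cl :: "real \<Rightarrow> real" where "cl t = max 0 (min 1 t)" for t
  have cl: "cl t \<in> {0..1}" "t \<in> {0..1} \<Longrightarrow> cl t = t" for t by (auto simp: cl_def)
  have cl_cont: "isCont cl t" for t unfolding cl_def by (intro continuous_intros)
  have [measurable]: "cl \<in> borel_measurable borel" unfolding cl_def by measurable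
  have ae: "AE t in M. t \<in> {0..1}"
  proof -
    \<comment> \<open>Positive exactly outside [0, 1]; its integrals vanish along the sequence,
      hence in the limit.\<close>
    define f where "f t = min 1 \<bar>t - cl t\<bar>" for t
    have [measurable]: "f \<in> borel_measurable borel" unfolding f_def by measurable
    have "(\<integral>x. f x \<partial>empirical n) = 0" for n
      using unit by (subst integral_empirical) (auto simp: f_def cl intro!: sum.neutral)
    moreover have "(\<lambda>n. \<integral>x. f x \<partial>empirical (r n)) \<longlonglongrightarrow> (\<integral>x. f x \<partial>M)"
      by (rule lim[of _ 1]) (auto simp: f_def intro!: continuous_intros cl_cont)
    ultimately have "(\<integral>x. f x \<partial>M) = 0" by (simp add: LIMSEQ_const_iff)
    moreover have "integrable M f"
      by (rule M.integrable_const_bound[where B=1]) (auto simp: f_def)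
    ultimately have "AE t in M. f t = 0"
      by (subst (asm) integral_nonneg_eq_0_iff_AE) (auto simp: f_def)
    thus ?thesis
    proof eventually_elim
      case (elim t)
      hence "t = cl t" by (auto simp: f_def min_def split: if_splits)
      thus ?case using cl(1)[of t] by simp
    qed
  qed
  have uim: "unit_interval_measure M"
    using ae M.finite_measure_axioms by (simp add: unit_interval_measure_def)
  have pure: "mixed_moment M 0 j = q 0 j" for j
  proof -
    have [measurable]: "(\<lambda>t. cl t ^ j) \<in> borel_measurable borel" by measurable
    have "(\<integral>t. cl t ^ j \<partial>empirical n) = (\<Sum>k\<le>n. w n k * (real k / real n) ^ j)" for n
      using unit by (subst integral_empirical) (auto simp: cl intro!: sum.cong)
    hence "(\<lambda>n. \<integral>t. cl t ^ j \<partial>empirical (r n)) \<longlonglongrightarrow> q 0 j"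
      using LIMSEQ_subseq_LIMSEQ[OF empirical_moments[of j] r] by (simp add: comp_def)
    moreover have "(\<lambda>n. \<integral>t. cl t ^ j \<partial>empirical (r n)) \<longlonglongrightarrow> (\<integral>t. cl t ^ j \<partial>M)"
    proof (rule lim)
      show "\<bar>cl x ^ j\<bar> \<le> 1" for x using unit_power_bound[OF cl(1), of x j 0] by simp
    qed (intro continuous_intros cl_cont)
    ultimately have "(\<integral>t. cl t ^ j \<partial>M) = q 0 j" by (metis LIMSEQ_unique)
    moreover have "(\<integral>t. cl t ^ j \<partial>M) = (\<integral>t. t ^ j \<partial>M)"
    proof (rule integral_cong_AE)
      show "AE t in M. cl t ^ j = t ^ j" using ae by eventually_elim (simp add: cl)
    qed measurable
    ultimately show ?thesis by simp
  qed
  have "mixed_moment M n k = q n k" for n k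
  proof (induction n arbitrary: k)
    case (Suc n)
    have "mixed_moment M (Suc n) k = mixed_moment M n k - mixed_moment M n (Suc k)"
      unfolding Bochner_Integration.integral_diff[OF integrable_mixed_moment[OF uim] integrable_mixed_moment[OF uim], symmetric]
      by (simp add: algebra_simps)
    also have "\<dots> = q n k - q n (Suc k)" by (simp only: Suc)
    also have "\<dots> = q (Suc n) k" using q_rec[of n k] by simp
    finally show ?case .
  qed (rule pure)
  thus ?thesis using uim M.prob_space_axioms by blast
qed

end

section \<open>Bernstein's theorem\<close>

lemma completely_monotone_nonneg: "completely_monotone g \<Longrightarrow> x > 0 \<Longrightarrow> 0 \<le> g x"
  unfolding completely_monotone_def by (metis mult_1 power_0)

lemma completely_monotone_continuous:
  assumes "completely_monotone g" "x > 0"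
  shows "isCont g x"
proof -
  obtain D where D: "\<And>x. x > 0 \<Longrightarrow> D 0 x = g x"
     "\<And>n x. x > 0 \<Longrightarrow> (D n has_real_derivative D (Suc n) x) (at x)"
    using assms(1) unfolding completely_monotone_def by metis
  have "\<forall>\<^sub>F y in nhds x. D 0 y = g y"
    using eventually_nhds_in_open[of "{0<..}" x] assms(2) by (auto elim!: eventually_mono simp: D)
  moreover have "isCont (D 0) x" using D(2)[OF assms(2)] by (rule DERIV_isCont)
  ultimately show ?thesis using isCont_cong by blast
qed

lemma completely_monotone_antimono:
  assumes "completely_monotone g" "0 < x" "x \<le> y"
  shows "g y \<le> g x"
proof -
  obtain D where D: "\<And>x. x > 0 \<Longrightarrow> D 0 x = g x"
     "\<And>n x. x > 0 \<Longrightarrow> (D n has_real_derivative D (Suc n) x) (at x)"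
     "\<And>n x. x > 0 \<Longrightarrow> (-1) ^ n * D n x \<ge> 0"
    using assms(1) unfolding completely_monotone_def by metis
  have "D 0 y \<le> D 0 x"
  proof (rule DERIV_nonpos_imp_nonincreasing[OF assms(3)])
    fix z assume "x \<le> z"
    thus "\<exists>d. (D 0 has_real_derivative d) (at z) \<and> d \<le> 0"
      using D(2)[of z 0] D(3)[of z 1] assms(2) by auto
  qed
  thus ?thesis using D(1) assms by simp
qed

lemma completely_monotone_scale:
  assumes "completely_monotone g" "h > 0"
  shows "completely_monotone (\<lambda>x. g (h * x))"
proof -
  obtain D where D: "\<And>x. x > 0 \<Longrightarrow> D 0 x = g x"
     "\<And>n x. x > 0 \<Longrightarrow> (D n has_real_derivative D (Suc n) x) (at x)"
     "\<And>n x. x > 0 \<Longrightarrow> (-1) ^ n * D n x \<ge> 0"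
    using assms(1) unfolding completely_monotone_def by metis
  show ?thesis
    unfolding completely_monotone_def
  proof (intro exI[of _ "\<lambda>n x. h ^ n * D n (h * x)"] conjI allI impI)
    fix n and x :: real assume x: "x > 0"
    have "((\<lambda>x. D n (h * x)) has_real_derivative D (Suc n) (h * x) * h) (at x)"
      using D(2)[of "h * x" n] x assms(2)
      by (intro DERIV_chain2[where f="D n" and g="\<lambda>x. h * x"]) (auto intro!: derivative_eq_intros)
    from DERIV_cmult[OF this, of "h ^ n"]
    show "((\<lambda>x. h ^ n * D n (h * x)) has_real_derivative h ^ Suc n * D (Suc n) (h * x)) (at x)"
      by (simp add: mult_ac)
    have "0 \<le> h ^ n * ((-1) ^ n * D n (h * x))" using D(3)[of "h * x" n] x assms(2) by simp
    thus "0 \<le> (-1) ^ n * (h ^ n * D n (h * x))" by (simp only: mult.left_commute)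
  qed (use D(1) assms(2) in simp)
qed

text \<open>The sign condition holds because \<open>(-1) ^ n * D n\<close> is nonincreasing, its
  derivative being controlled by the sign of \<open>D (Suc n)\<close>.\<close>

lemma completely_monotone_difference:
  assumes "completely_monotone g"
  shows "completely_monotone (\<lambda>x. g x - g (x + 1))"
proof -
  obtain D where D: "\<And>x. x > 0 \<Longrightarrow> D 0 x = g x"
     "\<And>n x. x > 0 \<Longrightarrow> (D n has_real_derivative D (Suc n) x) (at x)"
     "\<And>n x. x > 0 \<Longrightarrow> (-1) ^ n * D n x \<ge> 0"
    using assms(1) unfolding completely_monotone_def by metis
  show ?thesis
    unfolding completely_monotone_def
  proof (intro exI[of _ "\<lambda>n x. D n x - D n (x + 1)"] conjI allI impI)
    fix n and x :: real assume x: "x > 0"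
    have "((\<lambda>x. D n (x + 1)) has_real_derivative D (Suc n) (x + 1) * 1) (at x)"
      using D(2)[of "x + 1" n] x
      by (intro DERIV_chain2[where f="D n" and g="\<lambda>x. x + 1"]) (auto intro!: derivative_eq_intros)
    with D(2)[OF x, of n]
    show "((\<lambda>x. D n x - D n (x + 1)) has_real_derivative D (Suc n) x - D (Suc n) (x + 1)) (at x)"
      by (auto intro: DERIV_diff)
    have "(-1) ^ n * D n (x + 1) \<le> (-1) ^ n * D n x"
    proof (rule DERIV_nonpos_imp_nonincreasing[of x "x + 1"])
      fix z assume "x \<le> z"
      hence "z > 0" using x by simp
      thus "\<exists>d. ((\<lambda>x. (-1) ^ n * D n x) has_real_derivative d) (at z) \<and> d \<le> 0"
        using DERIV_cmult[OF D(2)[OF \<open>z > 0\<close>], of "(-1) ^ n"] D(3)[of z "Suc n"] by auto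
    qed simp
    thus "0 \<le> (-1) ^ n * (D n x - D n (x + 1))" by (simp add: right_diff_distrib)
  qed (use D(1) in simp)
qed

section \<open>Moments attached to a completely monotone function\<close>

text \<open>If \<open>g u\<close> is the integral of \<open>t powr (u - 1)\<close>, then this is the
  mixed moment of \<open>t ^ k * (1 - t) ^ n\<close>. Sampling starts at 1 because \<open>g\<close>
  may be unbounded at 0.\<close>

fun cm_diff :: "(real \<Rightarrow> real) \<Rightarrow> nat \<Rightarrow> nat \<Rightarrow> real" where
  "cm_diff g 0 k = g (real (Suc k))"
| "cm_diff g (Suc n) k = cm_diff g n k - cm_diff g n (Suc k)"

text \<open>Moves the difference from the sequence into the function, so that inductions can use
  that differences of completely monotone functions are completely monotone.\<close>

lemma cm_diff_shift: "cm_diff g (Suc n) k = cm_diff (\<lambda>x. g x - g (x + 1)) n k"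
proof (induction n arbitrary: k)
  case (Suc n)
  have "cm_diff g (Suc (Suc n)) k = cm_diff g (Suc n) k - cm_diff g (Suc n) (Suc k)" by (rule cm_diff.simps)
  thus ?case unfolding Suc by simp
qed (simp add: add_ac)

lemma cm_diff_nonneg: "completely_monotone g \<Longrightarrow> 0 \<le> cm_diff g n k"
proof (induction n arbitrary: g k)
  case (Suc n)
  show ?case unfolding cm_diff_shift by (intro Suc.IH completely_monotone_difference Suc.prems)
qed (simp add: completely_monotone_nonneg)

lemma cm_diff_zero:
  assumes "completely_monotone g" "g 1 = 0"
  shows "cm_diff g n k = 0"
proof (induction n arbitrary: k)
  case 0
  show ?case using completely_monotone_antimono[OF assms(1), of 1 "real (Suc k)"]
      completely_monotone_nonneg[OF assms(1), of "real (Suc k)"] assms(2) by simp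
qed simp

text \<open>The exponent is \<open>(n - 1) + n * (Suc k / n - 1) = k\<close>. The assumption
  \<open>k > 0\<close> matters at \<open>t = 0\<close>, where \<open>powr\<close> gives 0 while
  \<open>t ^ 0\<close> would be 1.\<close>

lemma power_powr_collapse:
  fixes t :: real
  assumes "0 \<le> t" "n > 0" "k > 0"
  shows "t ^ (n - 1) * (t ^ n) powr (real (Suc k) / real n - 1) = t ^ k"
proof (cases "t = 0")
  case False
  hence t: "t > 0" using assms by simp
  have "t ^ (n - 1) * (t ^ n) powr (real (Suc k) / real n - 1) = t powr real (n - 1) * (t powr real n) powr (real (Suc k) / real n - 1)"
    using t by (simp add: powr_realpow)
  also have "\<dots> = t powr (real (n - 1) + real n * (real (Suc k) / real n - 1))"
    by (simp add: powr_powr powr_add)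
  also have "real (n - 1) + real n * (real (Suc k) / real n - 1) = real k"
    using assms(2) by (simp add: field_simps of_nat_diff)
  finally show ?thesis using t by (simp add: powr_realpow)
qed (use assms in \<open>simp add: power_0_left\<close>)

text \<open>The normalisation \<open>g 1 = 0\<close> only occurs for \<open>g = 0\<close>; the value \<open>1/2\<close> is then a dummy.\<close>
definition cm_moment :: "(real \<Rightarrow> real) \<Rightarrow> nat \<Rightarrow> nat \<Rightarrow> real" where
  "cm_moment g n k = (if g 1 = 0 then (1/2) ^ k * (1/2) ^ n else cm_diff g n k / g 1)"

lemma cm_moment_times: "completely_monotone g \<Longrightarrow> g 1 * cm_moment g n k = cm_diff g n k"
  by (simp add: cm_moment_def cm_diff_zero)

lemma cm_moment_measure_exists:
  assumes g: "completely_monotone g"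
  shows "\<exists>M. prob_space M \<and> unit_interval_measure M \<and> (\<forall>n k. mixed_moment M n k = cm_moment g n k)"
proof (rule hausdorff_moments.hausdorff_moment_problem, unfold_locales)
  have "g 1 \<ge> 0" using completely_monotone_nonneg[OF g, of 1] by simp
  thus "0 \<le> cm_moment g n k" for n k using cm_diff_nonneg[OF g] by (simp add: cm_moment_def)
  show "cm_moment g n k = cm_moment g (Suc n) k + cm_moment g n (Suc k)" for n k
    by (simp add: cm_moment_def diff_divide_distrib)
  show "cm_moment g 0 0 = 1" by (simp add: cm_moment_def)
qed

lemma scaled_cm_moment_measure:
  assumes g: "completely_monotone g" and M: "unit_interval_measure M" "\<And>n k. mixed_moment M n k = cm_moment g n k"
  defines "W \<equiv> density M (\<lambda>_. ennreal (g 1))"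
  shows "unit_interval_measure W" "(\<integral>t. t ^ k \<partial>W) = g (real (Suc k))"
proof -
  interpret finite_measure M using M by (simp add: unit_interval_measure_def)
  have [measurable_cong]: "sets M = sets borel" using M by (simp add: unit_interval_measure_def)
  have g1: "g 1 \<ge> 0" using completely_monotone_nonneg[OF g, of 1] by simp
  show "unit_interval_measure W"
    using M(1) g1 unfolding unit_interval_measure_def W_def
    by (auto simp: AE_density emeasure_density nn_integral_cmult ennreal_mult_eq_top_iff intro!: finite_measureI elim!: eventually_mono)
  have "(\<integral>t. t ^ k \<partial>W) = g 1 * mixed_moment M 0 k"
    unfolding W_def using g1 by (subst integral_density) auto
  thus "(\<integral>t. t ^ k \<partial>W) = g (real (Suc k))"
    unfolding M(2) cm_moment_times[OF g] by simp
qed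

lemma cm_measure_exists:
  assumes g: "completely_monotone g"
  obtains W where "unit_interval_measure W" "\<And>k. (\<integral>t. t ^ k \<partial>W) = g (real (Suc k))"
  using cm_moment_measure_exists[OF g] scaled_cm_moment_measure[OF g] by metis

lemma nn_integral_power_unit:
  assumes "unit_interval_measure W"
  shows "(\<integral>\<^sup>+t. ennreal (t ^ k) \<partial>W) = ennreal (\<integral>t. t ^ k \<partial>W)"
proof (rule nn_integral_eq_integral)
  show "integrable W (\<lambda>t. t ^ k)" using integrable_mixed_moment[OF assms, of k 0] by simp
  show "AE t in W. 0 \<le> t ^ k" using assms by (auto simp: unit_interval_measure_def elim!: eventually_mono)
qed

text \<open>The measure for the step size \<open>1/n\<close> is carried to the one for step size \<open>1\<close> by
  \<open>t \<mapsto> t\<^sup>n\<close>, since both have the same moments.\<close>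
lemma Bernstein_rational:
  assumes g: "completely_monotone g" and W: "unit_interval_measure W" "\<And>k. (\<integral>t. t ^ k \<partial>W) = g (real (Suc k))"
    and n: "n > 0" and k: "k > 0"
  shows "(\<integral>\<^sup>+t. ennreal (t powr (real (Suc k) / real n - 1)) \<partial>W) = ennreal (g (real (Suc k) / real n))"
proof -
  have "completely_monotone (\<lambda>x. g (1 / real n * x))"
    using n by (intro completely_monotone_scale g) simp
  then obtain V where V: "unit_interval_measure V" "\<And>k. (\<integral>t. t ^ k \<partial>V) = g (real (Suc k) / real n)"
    by (rule cm_measure_exists) (auto simp: field_simps)
  interpret V: finite_measure V using V by (simp add: unit_interval_measure_def)
  have [measurable_cong]: "sets V = sets borel" using V by (simp add: unit_interval_measure_def)
  have ae: "AE t in V. t \<in> {0..1}" using V by (simp add: unit_interval_measure_def)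
  \<comment> \<open>Moment \<open>j\<close> of \<open>V\<close> is \<open>g (Suc j / n)\<close>. The
    density \<open>t ^ (n - 1)\<close> corrects this shift of index: moment \<open>j\<close> of
    \<open>U\<close> is the moment of \<open>V\<close> of order \<open>n - 1 + n * j\<close>, whose
    successor is \<open>n * (j + 1)\<close>.\<close>
  define U where "U = distr (density V (\<lambda>t. ennreal (t ^ (n - 1)))) borel (\<lambda>t. t ^ n)"
  have "U = W"
  proof (rule pure_moments_determine)
    have "finite_measure (density V (\<lambda>t. ennreal (t ^ (n - 1))))"
      using nn_integral_power_unit[OF V(1), of "n - 1"]
      by (intro finite_measureI) (simp add: emeasure_density)
    hence "finite_measure U" unfolding U_def by (rule finite_measure.finite_measure_distr) simp
    moreover have "AE t in V. t ^ n \<in> {0..1}"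
      using ae by eventually_elim (auto simp: power_le_one)
    hence "AE t in density V (\<lambda>t. ennreal (t ^ (n - 1))). t ^ n \<in> {0..1}"
      by (subst AE_density, simp) (erule eventually_mono, simp)
    hence "AE t in U. t \<in> {0..1}" unfolding U_def by (subst AE_distr_iff) simp_all
    moreover have "sets U = sets borel" by (simp add: U_def)
    ultimately show "unit_interval_measure U" by (simp only: unit_interval_measure_def simp_thms)
    show "(\<integral>t. t ^ j \<partial>U) = (\<integral>t. t ^ j \<partial>W)" for j
    proof -
      have "(\<integral>t. t ^ j \<partial>U) = (\<integral>t. t ^ (n - 1) * (t ^ n) ^ j \<partial>V)"
        unfolding U_def using ae
        by (subst integral_distr, simp, simp, subst integral_density) (auto elim!: eventually_mono)
      also have "\<dots> = (\<integral>t. t ^ (n - 1 + n * j) \<partial>V)"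
        by (simp add: power_add power_mult)
      also have "\<dots> = g (real (Suc (n - 1 + n * j)) / real n)" by (rule V)
      also have "real (Suc (n - 1 + n * j)) / real n = real (Suc j)"
        using n by (cases n) (simp_all add: field_simps)
      finally show ?thesis by (simp only: W)
    qed
  qed (rule W)
  hence "(\<integral>\<^sup>+t. ennreal (t powr (real (Suc k) / real n - 1)) \<partial>W) = (\<integral>\<^sup>+t. ennreal (t powr (real (Suc k) / real n - 1)) \<partial>U)"
    by simp
  also have "\<dots> = (\<integral>\<^sup>+t. ennreal (t ^ (n - 1)) * ennreal ((t ^ n) powr (real (Suc k) / real n - 1)) \<partial>V)"
    unfolding U_def by (subst nn_integral_distr, simp, simp, subst nn_integral_density) auto
  also have "\<dots> = (\<integral>\<^sup>+t. ennreal (t ^ k) \<partial>V)"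
  proof (rule nn_integral_cong_AE)
    show "AE t in V. ennreal (t ^ (n - 1)) * ennreal ((t ^ n) powr (real (Suc k) / real n - 1)) = ennreal (t ^ k)"
      using ae
    proof eventually_elim
      case (elim t)
      thus ?case using power_powr_collapse[of t n k] n k by (subst ennreal_mult[symmetric]) auto
    qed
  qed
  finally show ?thesis by (simp only: nn_integral_power_unit[OF V(1)] V(2))
qed

text \<open>The integral is antitone in \<open>u\<close> and \<open>g\<close> is continuous, so the
  identity at fractions with denominator n extends to every \<open>u\<close> by squeezing. Since
  \<open>0 powr a = 0\<close>, the case \<open>u = 1\<close> also shows that \<open>W\<close> has no
  atom at 0.\<close>

lemma Bernstein_unnormalised:
  assumes g: "completely_monotone g" and W: "unit_interval_measure W" "\<And>k. (\<integral>t. t ^ k \<partial>W) = g (real (Suc k))"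
    and u: "u > 0"
  shows "(\<integral>\<^sup>+t. ennreal (t powr (u - 1)) \<partial>W) = ennreal (g u)"
proof -
  define F where "F u = (\<integral>\<^sup>+t. ennreal (t powr (u - 1)) \<partial>W)" for u
  have ae: "AE t in W. t \<in> {0..1}" using W by (simp add: unit_interval_measure_def)
  have F_mono: "F v \<le> F u" if "u \<le> v" for u v
    unfolding F_def
  proof (rule nn_integral_mono_AE)
    show "AE t in W. ennreal (t powr (v - 1)) \<le> ennreal (t powr (u - 1))"
      using ae by eventually_elim (use that in \<open>auto intro!: ennreal_leI powr_mono'\<close>)
  qed
  define k where "k n = nat \<lfloor>u * real n\<rfloor>" for n
  have k: "real (k n) \<le> u * real n" "u * real n < real (k n) + 1" for n
    using u by (simp_all add: k_def)
  have lim1: "(\<lambda>n. real (k n) / real n) \<longlonglongrightarrow> u"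
  proof (rule real_tendsto_sandwich)
    show "(\<lambda>n. u - 1 / real n) \<longlonglongrightarrow> u" by real_asymp
    show "\<forall>\<^sub>F n in sequentially. u - 1 / real n \<le> real (k n) / real n"
      using eventually_gt_at_top[of 0]
    proof eventually_elim
      case (elim n)
      have "u - 1 / real n = (u * real n - 1) / real n" using elim by (simp add: field_simps)
      also have "\<dots> \<le> real (k n) / real n" using k(2)[of n] by (intro divide_right_mono) auto
      finally show ?case .
    qed
    show "\<forall>\<^sub>F n in sequentially. real (k n) / real n \<le> u"
      using eventually_gt_at_top[of 0] by eventually_elim (use k(1) in \<open>auto simp: field_simps\<close>)
  qed simp
  have lim2: "(\<lambda>n. real (Suc (k n)) / real n) \<longlonglongrightarrow> u"
  proof -
    have "(\<lambda>n. real (k n) / real n + 1 / real n) \<longlonglongrightarrow> u + 0"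
      by (intro tendsto_add lim1) real_asymp
    thus ?thesis by (simp add: add_divide_distrib add.commute)
  qed
  \<comment> \<open>\<open>Bernstein_rational\<close> is applied with \<open>k n - 1\<close> in
    place of \<open>k\<close>, and that must be positive.\<close>
  have large: "\<forall>\<^sub>F n in sequentially. n > 0 \<and> k n \<ge> 2"
  proof -
    have "\<forall>\<^sub>F n in sequentially. u * real n \<ge> 3" using u by real_asymp
    thus ?thesis using eventually_gt_at_top[of 0]
    proof eventually_elim
      case (elim n)
      thus ?case using k(2)[of n] by linarith
    qed
  qed
  note cont = completely_monotone_continuous[OF g u]
  have "F u \<le> ennreal (g u)"
  proof (rule tendsto_lowerbound)
    show "(\<lambda>n. ennreal (g (real (k n) / real n))) \<longlonglongrightarrow> ennreal (g u)"
      by (intro tendsto_ennrealI isCont_tendsto_compose[OF cont lim1])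
    show "\<forall>\<^sub>F n in sequentially. F u \<le> ennreal (g (real (k n) / real n))"
      using large
    proof eventually_elim
      case (elim n)
      have "F u \<le> F (real (k n) / real n)" using k(1)[of n] elim by (intro F_mono) (simp add: field_simps)
      also have "\<dots> = ennreal (g (real (k n) / real n))"
        using Bernstein_rational[OF g W, of n "k n - 1"] elim by (simp add: F_def)
      finally show ?case .
    qed
  qed simp
  moreover have "ennreal (g u) \<le> F u"
  proof (rule tendsto_upperbound)
    show "(\<lambda>n. ennreal (g (real (Suc (k n)) / real n))) \<longlonglongrightarrow> ennreal (g u)"
      by (intro tendsto_ennrealI isCont_tendsto_compose[OF cont lim2])
    show "\<forall>\<^sub>F n in sequentially. ennreal (g (real (Suc (k n)) / real n)) \<le> F u"
      using large
    proof eventually_elim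
      case (elim n)
      have "ennreal (g (real (Suc (k n)) / real n)) = F (real (Suc (k n)) / real n)"
        unfolding F_def by (rule Bernstein_rational[OF g W, symmetric]) (use elim in auto)
      also have "\<dots> \<le> F u" using k(2)[of n] elim by (intro F_mono) (simp add: field_simps)
      finally show ?case .
    qed
  qed simp
  ultimately show ?thesis unfolding F_def by simp
qed

text \<open>With \<open>t = exp (- 1 / s)\<close> this is the Laplace representation, except that
  the exponent \<open>u - 1\<close> stores one factor \<open>t\<close> in the measure. This tilt
  keeps the measure finite when \<open>g\<close> explodes at 0, and normalises it to
  \<open>g 1\<close>.\<close>

theorem Bernstein:
  assumes g: "completely_monotone g"
    and M: "unit_interval_measure M" "\<And>n k. mixed_moment M n k = cm_moment g n k"
    and u: "u > 0"
  shows "ennreal (g u) = ennreal (g 1) * (\<integral>\<^sup>+t. ennreal (t powr (u - 1)) \<partial>M)"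
proof -
  have [measurable_cong]: "sets M = sets borel" using M by (simp add: unit_interval_measure_def)
  note W = scaled_cm_moment_measure[OF g M]
  have "(\<integral>\<^sup>+t. ennreal (t powr (u - 1)) \<partial>density M (\<lambda>_. ennreal (g 1))) = ennreal (g u)"
    using u by (intro Bernstein_unnormalised g W)
  thus ?thesis by (simp add: nn_integral_density nn_integral_cmult)
qed

section \<open>Disintegration and Laplace transforms\<close>

lemma nn_integral_mixed_moment:
  assumes "unit_interval_measure W"
  shows "(\<integral>\<^sup>+t. ennreal (t ^ k * (1 - t) ^ n) \<partial>W) = ennreal (mixed_moment W n k)"
proof (rule nn_integral_eq_integral)
  show "integrable W (\<lambda>t. t ^ k * (1 - t) ^ n)" by (rule integrable_mixed_moment[OF assms])
  have "AE t in W. t \<in> {0..1}" using assms by (simp add: unit_interval_measure_def)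
  thus "AE t in W. 0 \<le> t ^ k * (1 - t) ^ n" by eventually_elim simp
qed

lemma nn_mixed_moments_determine:
  assumes M: "unit_interval_measure M" and N: "unit_interval_measure N"
    and eq: "\<And>n k. (\<integral>\<^sup>+t. ennreal (t ^ k * (1 - t) ^ n) \<partial>M) = (\<integral>\<^sup>+t. ennreal (t ^ k * (1 - t) ^ n) \<partial>N)"
  shows "M = N"
proof (rule mixed_moments_determine[OF M N])
  have "0 \<le> mixed_moment L n k" if "unit_interval_measure L" for L n k
  proof (rule integral_nonneg_AE)
    have "AE t in L. t \<in> {0..1}" using that by (simp add: unit_interval_measure_def)
    thus "AE t in L. 0 \<le> t ^ k * (1 - t) ^ n" by eventually_elim simp
  qed
  thus "mixed_moment M n k = mixed_moment N n k" for n k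
    using eq[of k n] M N by (simp add: nn_integral_mixed_moment)
qed

lemma prob_algebra_sets: "K \<in> X \<rightarrow>\<^sub>M prob_algebra Y \<Longrightarrow> x \<in> space X \<Longrightarrow> sets (K x) = sets Y"
  by (drule measurable_space) (auto simp: space_prob_algebra)

lemma prob_algebra_prob: "K \<in> X \<rightarrow>\<^sub>M prob_algebra Y \<Longrightarrow> x \<in> space X \<Longrightarrow> prob_space (K x)"
  by (drule measurable_space) (auto simp: space_prob_algebra)

text \<open>Conditional laws are constructed from conditional moments. Only the second coordinate
  has to be real; the space \<open>X\<close> of directions needs no topology.\<close>

locale disintegration =
  fixes M :: "('b \<times> real) measure" and X :: "'b measure"
  assumes fin: "finite_measure M" and sets_M [measurable_cong]: "sets M = sets (X \<Otimes>\<^sub>M borel)"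
    and ae_M: "AE p in M. snd p \<in> {0<..<1}" and nonempty: "space X \<noteq> {}"
begin

definition lam :: "'b measure" where "lam = distr M X fst"

lemma sets_lam [simp, measurable_cong]: "sets lam = sets X" by (simp add: lam_def)
lemma space_lam [simp]: "space lam = space X" by (simp add: lam_def)

sublocale M: finite_measure M by (rule fin)
sublocale lam: finite_measure lam unfolding lam_def by (rule M.finite_measure_distr) measurable

definition \<mu> :: "nat \<Rightarrow> nat \<Rightarrow> 'b measure" where
  "\<mu> n k = distr (density M (\<lambda>p. ennreal (snd p ^ k * (1 - snd p) ^ n))) X fst"

lemma sets_\<mu> [simp]: "sets (\<mu> n k) = sets X" by (simp add: \<mu>_def)

lemma emeasure_\<mu>:
  assumes [measurable]: "E \<in> sets X"
  shows "emeasure (\<mu> n k) E = (\<integral>\<^sup>+p. ennreal (snd p ^ k * (1 - snd p) ^ n) * indicator E (fst p) \<partial>M)"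
  unfolding \<mu>_def by (subst nn_integral_indicator[symmetric], simp, subst nn_integral_distr, simp, simp, subst nn_integral_density) auto

lemma \<mu>_00: "\<mu> 0 0 = lam"
  by (simp add: \<mu>_def lam_def density_1)

lemma abs_cont_\<mu>: "absolutely_continuous lam (\<mu> n k)"
  unfolding absolutely_continuous_def
proof
  fix N assume N: "N \<in> null_sets lam"
  hence [measurable]: "N \<in> sets X" by auto
  have "(\<integral>\<^sup>+x. indicator N x \<partial>lam) = 0" using N by auto
  hence "(\<integral>\<^sup>+p. indicator N (fst p) \<partial>M) = 0" unfolding lam_def by (subst (asm) nn_integral_distr) auto
  hence "AE p in M. indicator N (fst p) = (0::ennreal)" by (subst (asm) nn_integral_0_iff_AE) auto
  hence "emeasure (\<mu> n k) N = 0"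
    by (subst emeasure_\<mu>, simp, subst nn_integral_0_iff_AE) (auto elim!: eventually_mono)
  thus "N \<in> null_sets (\<mu> n k)" by auto
qed

text \<open>The conditional expectation of \<open>t ^ k * (1 - t) ^ n\<close> given the first
  coordinate.\<close>

definition Q :: "nat \<Rightarrow> nat \<Rightarrow> 'b \<Rightarrow> ennreal" where "Q n k = RN_deriv lam (\<mu> n k)"

lemma measurable_Q [measurable]: "Q n k \<in> borel_measurable X"
proof -
  have "Q n k \<in> borel_measurable lam" unfolding Q_def by simp
  thus ?thesis by simp
qed

lemma density_Q: "density lam (Q n k) = \<mu> n k"
  unfolding Q_def by (rule lam.density_RN_deriv[OF abs_cont_\<mu>]) simp

text \<open>Integrating \<open>t + (1 - t) = 1\<close> over any measurable set of first coordinates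
  gives equal densities; they agree only almost everywhere.\<close>

lemma Q_rec: "AE x in lam. Q n k x = Q (Suc n) k x + Q n (Suc k) x"
proof (rule lam.density_unique)
  show "density lam (Q n k) = density lam (\<lambda>x. Q (Suc n) k x + Q n (Suc k) x)"
  proof (rule measure_eqI)
    fix E assume "E \<in> sets (density lam (Q n k))"
    hence [measurable]: "E \<in> sets X" by simp
    have "emeasure (density lam (\<lambda>x. Q (Suc n) k x + Q n (Suc k) x)) E = emeasure (density lam (Q (Suc n) k)) E + emeasure (density lam (Q n (Suc k))) E"
      by (simp add: emeasure_density nn_integral_add distrib_right)
    also have "\<dots> = (\<integral>\<^sup>+p. ennreal (snd p ^ k * (1 - snd p) ^ Suc n) * indicator E (fst p)
          + ennreal (snd p ^ Suc k * (1 - snd p) ^ n) * indicator E (fst p) \<partial>M)"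
      unfolding density_Q by (subst nn_integral_add) (simp_all add: emeasure_\<mu>)
    also have "\<dots> = (\<integral>\<^sup>+p. ennreal (snd p ^ k * (1 - snd p) ^ n) * indicator E (fst p) \<partial>M)"
    proof (rule nn_integral_cong_AE)
      show "AE p in M. ennreal (snd p ^ k * (1 - snd p) ^ Suc n) * indicator E (fst p)
          + ennreal (snd p ^ Suc k * (1 - snd p) ^ n) * indicator E (fst p) = ennreal (snd p ^ k * (1 - snd p) ^ n) * indicator E (fst p)"
        using ae_M
      proof eventually_elim
        case (elim p)
        hence "ennreal (snd p ^ k * (1 - snd p) ^ Suc n) + ennreal (snd p ^ Suc k * (1 - snd p) ^ n) = ennreal (snd p ^ k * (1 - snd p) ^ n)"
          by (subst ennreal_plus[symmetric]) (auto simp: algebra_simps)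
        thus ?case by (simp only: distrib_right[symmetric])
      qed
    qed
    also have "\<dots> = emeasure (density lam (Q n k)) E" unfolding density_Q by (simp add: emeasure_\<mu>)
    finally show "emeasure (density lam (Q n k)) E = emeasure (density lam (\<lambda>x. Q (Suc n) k x + Q n (Suc k) x)) E" ..
  qed simp
qed simp_all

lemma Q_00: "AE x in lam. Q 0 0 x = 1"
  by (rule lam.density_unique) (simp_all add: density_Q \<mu>_00 density_1)

text \<open>Countably many almost sure identities, required simultaneously so that a whole moment
  sequence is available at each such point.\<close>

definition good :: "'b \<Rightarrow> bool" where
  "good x \<longleftrightarrow> Q 0 0 x = 1 \<and> (\<forall>n k. Q n k x = Q (Suc n) k x + Q n (Suc k) x)"

lemma goodD: "good x \<Longrightarrow> Q 0 0 x = 1" "good x \<Longrightarrow> Q n k x = Q (Suc n) k x + Q n (Suc k) x"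
  unfolding good_def by blast+

lemma measurable_good [measurable]: "Measurable.pred X good"
  unfolding good_def by measurable

lemma AE_good: "AE x in lam. good x"
proof -
  have "AE x in lam. \<forall>n k. Q n k x = Q (Suc n) k x + Q n (Suc k) x"
    unfolding AE_all_countable by (intro allI Q_rec)
  with Q_00 show ?thesis by eventually_elim (unfold good_def, blast)
qed

text \<open>Each entry is a summand of an earlier one, back to \<open>Q 0 0 x = 1\<close>; in
  particular all entries are finite and may be read as reals.\<close>

lemma Q_le_1: "good x \<Longrightarrow> Q n k x \<le> 1"
proof -
  assume x: "good x"
  have 0: "Q 0 k x \<le> 1"
  proof (induction k)
    case (Suc k)
    have "Q 0 (Suc k) x \<le> Q (Suc 0) k x + Q 0 (Suc k) x" by (rule add_increasing) simp_all
    also have "\<dots> = Q 0 k x" by (rule goodD(2)[OF x, symmetric])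
    finally show ?case using Suc by (rule order_trans)
  qed (simp add: goodD(1)[OF x])
  show ?thesis
  proof (induction n)
    case (Suc n)
    have "Q (Suc n) k x \<le> Q (Suc n) k x + Q n (Suc k) x" by (rule add_increasing2) simp_all
    also have "\<dots> = Q n k x" by (rule goodD(2)[OF x, symmetric])
    finally show ?case using Suc by (rule order_trans)
  qed (rule 0)
qed

text \<open>Off the good set the moments of the unit mass at 1/2 serve as default, so that the
  moment problem is solvable at every point.\<close>

definition q :: "'b \<Rightarrow> nat \<Rightarrow> nat \<Rightarrow> real" where
  "q x n k = (if good x then enn2real (Q n k x) else (1/2) ^ k * (1/2) ^ n)"

lemma ennreal_q: "good x \<Longrightarrow> ennreal (q x n k) = Q n k x"
  using Q_le_1[of x n k] unfolding q_def by (simp add: ennreal_enn2real le_less_trans)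

lemma hausdorff_q: "hausdorff_moments (q x)"
proof
  show "0 \<le> q x n k" for n k by (simp add: q_def)
  show "q x 0 0 = 1" by (simp add: q_def goodD(1))
  show "q x n k = q x (Suc n) k + q x n (Suc k)" for n k
  proof (cases "good x")
    case True
    hence "Q (Suc n) k x < top" "Q n (Suc k) x < top"
      using Q_le_1[of x] by (meson ennreal_one_less_top le_less_trans)+
    moreover have "Q n k x = Q (Suc n) k x + Q n (Suc k) x" using True by (rule goodD(2))
    ultimately show ?thesis using True by (simp add: q_def enn2real_plus)
  qed (simp add: q_def)
qed

lemma measurable_q [measurable]: "(\<lambda>x. q x n k) \<in> borel_measurable X"
  unfolding q_def by measurable

definition K0 :: "'b \<Rightarrow> real measure" where
  "K0 x = (SOME W. prob_space W \<and> unit_interval_measure W \<and> (\<forall>n k. mixed_moment W n k = q x n k))"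

lemma K0: "prob_space (K0 x)" "unit_interval_measure (K0 x)" "mixed_moment (K0 x) n k = q x n k"
  using someI_ex[OF hausdorff_moments.hausdorff_moment_problem[OF hausdorff_q, of x]]
  unfolding K0_def by auto

lemma measurable_K0: "K0 \<in> X \<rightarrow>\<^sub>M prob_algebra borel"
  by (rule measurable_kernel_of_moments) (simp_all add: K0)

lemma measurable_K0_sub [measurable]: "K0 \<in> X \<rightarrow>\<^sub>M subprob_algebra borel"
  by (rule measurable_prob_algebraD[OF measurable_K0])

lemma sets_K0 [simp, measurable_cong]: "sets (K0 x) = sets borel"
  using K0(2)[of x] by (simp add: unit_interval_measure_def)

text \<open>For a fixed set \<open>E\<close> of first coordinates, both sides are finite measures on
  [0, 1] whose mixed moments equal \<open>emeasure (\<mu> n k) E\<close>.\<close>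

lemma slice_eq:
  assumes [measurable]: "E \<in> sets X"
  shows "distr (density M (\<lambda>p. indicator E (fst p))) borel snd = density lam (indicator E) \<bind> K0" (is "?L = ?R")
proof (rule nn_mixed_moments_determine)
  have ne: "space (density lam (indicator E)) \<noteq> {}" using nonempty by simp
  have K': "K0 \<in> density lam (indicator E) \<rightarrow>\<^sub>M subprob_algebra borel" by measurable
  have sets_R: "sets ?R = sets borel" by (rule sets_bind[OF _ ne]) simp
  have nnR: "(\<integral>\<^sup>+t. f t \<partial>?R) = (\<integral>\<^sup>+x. indicator E x * (\<integral>\<^sup>+t. f t \<partial>K0 x) \<partial>lam)"
    if [measurable]: "f \<in> borel_measurable borel" for f :: "real \<Rightarrow> ennreal"
  proof -
    have "(\<lambda>x. \<integral>\<^sup>+t. f t \<partial>K0 x) \<in> borel_measurable X"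
      by (rule measurable_compose[OF measurable_K0_sub nn_integral_measurable_subprob_algebra]) measurable
    thus ?thesis by (subst nn_integral_bind[OF _ K'], simp, subst nn_integral_density) simp_all
  qed
  have "AE t in ?L. t \<in> {0..1}"
  proof -
    have "AE p in density M (\<lambda>p. indicator E (fst p)). snd p \<in> {0..1}"
      using ae_M by (subst AE_density, simp) (erule eventually_mono, simp)
    thus ?thesis by (subst AE_distr_iff) simp_all
  qed
  moreover have "finite_measure ?L"
  proof (rule finite_measure.finite_measure_distr)
    have "(\<integral>\<^sup>+p. indicator E (fst p) \<partial>M) \<le> (\<integral>\<^sup>+p. 1 \<partial>M)"
      by (intro nn_integral_mono) (simp add: indicator_def)
    also have "\<dots> < \<infinity>" using M.emeasure_finite[of "space M"] by (simp add: less_top del: M.emeasure_finite)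
    finally show "finite_measure (density M (\<lambda>p. indicator E (fst p)))"
      by (intro finite_measureI) (simp add: emeasure_density)
  qed simp
  ultimately show "unit_interval_measure ?L" by (simp add: unit_interval_measure_def)
  have ind1: "(\<integral>\<^sup>+x. indicator E x \<partial>lam) < \<infinity>"
    using lam.emeasure_finite[of E] by (simp add: less_top del: lam.emeasure_finite)
  have "emeasure ?R UNIV = (\<integral>\<^sup>+x. indicator E x * emeasure (K0 x) UNIV \<partial>lam)"
    using nnR[of "\<lambda>_. 1"] sets_eq_imp_space_eq[OF sets_R] sets_eq_imp_space_eq[OF sets_K0] by simp
  also have "\<dots> = (\<integral>\<^sup>+x. indicator E x \<partial>lam)"
    using prob_space.emeasure_space_1[OF K0(1)] sets_eq_imp_space_eq[OF sets_K0] by simp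
  finally have "finite_measure ?R"
    using ind1 sets_eq_imp_space_eq[OF sets_R] by (intro finite_measureI) simp
  moreover have "AE t in ?R. t \<in> {0..1}"
  proof -
    have "emeasure ?R (- {0..1}) = (\<integral>\<^sup>+x. indicator E x * emeasure (K0 x) (- {0..1}) \<partial>lam)"
      using nnR[of "indicator (- {0..1})"] sets_R by simp
    also have "\<dots> = (\<integral>\<^sup>+x. 0 \<partial>lam)"
    proof (rule nn_integral_cong)
      fix x
      have "AE t in K0 x. \<not> t \<in> - {0..1}" using K0(2)[of x] by (auto simp: unit_interval_measure_def)
      hence "emeasure (K0 x) {t \<in> space (K0 x). t \<in> - {0..1}} = 0"
        by (subst (asm) AE_iff_measurable[OF _ refl]) auto
      moreover have "space (K0 x) = UNIV" using sets_eq_imp_space_eq[OF sets_K0[of x]] by simp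
      moreover have "{t. t \<in> - {0..1::real}} = - {0..1}" by auto
      ultimately show "indicator E x * emeasure (K0 x) (- {0..1}) = 0" by (metis (no_types, lifting) Collect_cong UNIV_I mult_zero_right)
    qed
    finally show ?thesis
      using sets_R by (intro AE_I[of _ _ "- {0..1}"]) auto
  qed
  ultimately show "unit_interval_measure ?R" using sets_R by (simp add: unit_interval_measure_def)
  fix n k
  have "(\<integral>\<^sup>+t. ennreal (t ^ k * (1 - t) ^ n) \<partial>?R) = (\<integral>\<^sup>+x. indicator E x * ennreal (q x n k) \<partial>lam)"
    by (subst nnR) (simp_all add: nn_integral_mixed_moment[OF K0(2)] K0(3))
  also have "\<dots> = (\<integral>\<^sup>+x. Q n k x * indicator E x \<partial>lam)"
    by (rule nn_integral_cong_AE, rule eventually_mono[OF AE_good]) (simp add: ennreal_q mult.commute)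
  also have "\<dots> = emeasure (\<mu> n k) E" by (simp add: density_Q[symmetric] emeasure_density)
  also have "\<dots> = (\<integral>\<^sup>+t. ennreal (t ^ k * (1 - t) ^ n) \<partial>?L)"
    by (simp add: emeasure_\<mu> nn_integral_distr nn_integral_density mult.commute)
  finally show "(\<integral>\<^sup>+t. ennreal (t ^ k * (1 - t) ^ n) \<partial>?L) = (\<integral>\<^sup>+t. ennreal (t ^ k * (1 - t) ^ n) \<partial>?R)" ..
qed

lemma emeasure_rectangle:
  assumes [measurable]: "E \<in> sets X" "A \<in> sets borel"
  shows "emeasure M (E \<times> A) = (\<integral>\<^sup>+x. indicator E x * emeasure (K0 x) A \<partial>lam)"
proof -
  have [measurable]: "(\<lambda>x. emeasure (K0 x) A) \<in> borel_measurable X"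
    by (rule measurable_emeasure_kernel[OF measurable_K0_sub]) simp
  have "emeasure M (E \<times> A) = (\<integral>\<^sup>+p. indicator (E \<times> A) p \<partial>M)" by simp
  also have "\<dots> = (\<integral>\<^sup>+p. indicator E (fst p) * indicator A (snd p) \<partial>M)"
    by (intro nn_integral_cong) (auto simp: indicator_def split: prod.splits)
  also have "\<dots> = (\<integral>\<^sup>+t. indicator A t \<partial>distr (density M (\<lambda>p. indicator E (fst p))) borel snd)"
    by (subst nn_integral_distr, simp, simp, subst nn_integral_density) simp_all
  also have "\<dots> = emeasure (density lam (indicator E) \<bind> K0) A"
    unfolding slice_eq[OF assms(1), symmetric] by simp
  also have "\<dots> = (\<integral>\<^sup>+x. emeasure (K0 x) A \<partial>density lam (indicator E))"
    using nonempty by (intro emeasure_bind[where N=borel]) simp_all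
  also have "\<dots> = (\<integral>\<^sup>+x. indicator E x * emeasure (K0 x) A \<partial>lam)"
    by (subst nn_integral_density) simp_all
  finally show ?thesis .
qed

lemma measurable_pair_kernel [measurable]:
  "(\<lambda>x. distr (K0 x) (X \<Otimes>\<^sub>M borel) (Pair x)) \<in> X \<rightarrow>\<^sub>M subprob_algebra (X \<Otimes>\<^sub>M borel)"
  by (rule measurable_distr2[where M=borel]) measurable

lemma M_eq_bind: "M = lam \<bind> (\<lambda>x. distr (K0 x) (X \<Otimes>\<^sub>M borel) (Pair x))"
proof (rule measure_eqI_generator_eq[OF Int_stable_pair_measure_generator[of X borel]])
  let ?B = "lam \<bind> (\<lambda>x. distr (K0 x) (X \<Otimes>\<^sub>M borel) (Pair x))"
  have ne: "space lam \<noteq> {}" using nonempty by simp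
  have sB: "sets ?B = sets (X \<Otimes>\<^sub>M borel)" by (rule sets_bind[OF _ ne]) simp
  show "{a \<times> b |a b. a \<in> sets X \<and> b \<in> sets borel} \<subseteq> Pow (space X \<times> UNIV)"
    using sets.sets_into_space by fastforce
  show "sets M = sigma_sets (space X \<times> UNIV) {a \<times> b |a b. a \<in> sets X \<and> b \<in> sets borel}"
    using sets_M by (simp add: sets_pair_measure)
  show "sets ?B = sigma_sets (space X \<times> UNIV) {a \<times> b |a b. a \<in> sets X \<and> b \<in> sets borel}"
    using sB by (simp add: sets_pair_measure)
  fix Z assume "Z \<in> {a \<times> b |a b. a \<in> sets X \<and> b \<in> sets (borel :: real measure)}"
  then obtain E A where Z: "Z = E \<times> A" and [measurable]: "E \<in> sets X" "A \<in> sets borel" by blast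
  have "emeasure ?B Z = (\<integral>\<^sup>+x. emeasure (distr (K0 x) (X \<Otimes>\<^sub>M borel) (Pair x)) Z \<partial>lam)"
    unfolding Z by (rule emeasure_bind[OF ne]) measurable
  also have "\<dots> = (\<integral>\<^sup>+x. indicator E x * emeasure (K0 x) A \<partial>lam)"
  proof (rule nn_integral_cong)
    fix x assume "x \<in> space lam"
    hence [measurable]: "x \<in> space X" by simp
    have "emeasure (distr (K0 x) (X \<Otimes>\<^sub>M borel) (Pair x)) Z = emeasure (K0 x) (Pair x -` Z \<inter> space (K0 x))"
      unfolding Z by (rule emeasure_distr) measurable
    also have "Pair x -` Z \<inter> space (K0 x) = (if x \<in> E then A else {})"
      using sets_eq_imp_space_eq[OF sets_K0[of x]] by (auto simp: Z)
    finally show "emeasure (distr (K0 x) (X \<Otimes>\<^sub>M borel) (Pair x)) Z = indicator E x * emeasure (K0 x) A" by simp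
  qed
  finally show "emeasure M Z = emeasure ?B Z" by (simp add: Z emeasure_rectangle)
next
  show "range (\<lambda>_::nat. space X \<times> UNIV) \<subseteq> {a \<times> b |a b. a \<in> sets X \<and> b \<in> sets (borel :: real measure)}"
    by (rule image_subsetI, rule CollectI, rule exI[of _ "space X"], rule exI[of _ UNIV]) simp
  show "(\<Union>i::nat. space X \<times> UNIV) = space X \<times> UNIV" by simp
  show "emeasure M (space X \<times> UNIV) \<noteq> \<infinity>" by simp
qed

text \<open>\<open>K0 x\<close> lives on the closed interval and may charge an endpoint for
  exceptional \<open>x\<close>. Replacing those values places every conditional law on the open
  interval, which later gives a positive radial density in every direction.\<close>

definition K :: "'b \<Rightarrow> real measure" where
  "K x = (if emeasure (K0 x) (- {0<..<1}) = 0 then K0 x else return borel (1/2))"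

lemma measurable_K: "K \<in> X \<rightarrow>\<^sub>M prob_algebra borel"
  unfolding K_def
proof (rule measurable_If[OF measurable_K0])
  show "(\<lambda>x. return borel (1/2)) \<in> X \<rightarrow>\<^sub>M prob_algebra (borel :: real measure)"
    by (rule measurable_const) (simp add: space_prob_algebra prob_space_return)
  have [measurable]: "(\<lambda>x. emeasure (K0 x) (- {0<..<1})) \<in> borel_measurable X"
    by (rule measurable_emeasure_kernel[OF measurable_K0_sub]) simp
  show "{x \<in> space X. emeasure (K0 x) (- {0<..<1}) = 0} \<in> sets X" by measurable
qed

lemma AE_K: "AE t in K x. t \<in> {0<..<1}"
proof (cases "emeasure (K0 x) (- {0<..<1}) = 0")
  case True
  thus ?thesis by (intro AE_I[of _ _ "- {0<..<1}"]) (auto simp: K_def)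
next
  case False
  have "AE t in return borel (1/2). t \<in> {0<..<1::real}" by (subst AE_return) simp_all
  thus ?thesis using False by (simp only: K_def if_False)
qed

text \<open>\<open>M\<close> puts no mass on the endpoints, so the change from \<open>K0\<close> to
  \<open>K\<close> happens only on a null set of \<open>lam\<close>.\<close>

lemma nn_integral_M:
  assumes [measurable]: "f \<in> borel_measurable (X \<Otimes>\<^sub>M borel)"
  shows "(\<integral>\<^sup>+p. f p \<partial>M) = (\<integral>\<^sup>+x. \<integral>\<^sup>+t. f (x, t) \<partial>K x \<partial>lam)"
proof -
  have k: "(\<lambda>x. distr (K0 x) (X \<Otimes>\<^sub>M borel) (Pair x)) \<in> lam \<rightarrow>\<^sub>M subprob_algebra (X \<Otimes>\<^sub>M borel)"
    by measurable
  have [measurable]: "(\<lambda>x. emeasure (K0 x) (- {0<..<1})) \<in> borel_measurable X"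
    by (rule measurable_emeasure_kernel[OF measurable_K0_sub]) simp
  have "AE p in M. snd p \<notin> - {0<..<1}" using ae_M by (auto elim!: eventually_mono)
  hence "emeasure M (space X \<times> (- {0<..<1})) = 0"
    by (subst (asm) AE_iff_measurable[of "space X \<times> (- {0<..<1})"])
       (auto simp: sets_eq_imp_space_eq[OF sets_M] space_pair_measure)
  hence null: "(\<integral>\<^sup>+x. indicator (space X) x * emeasure (K0 x) (- {0<..<1}) \<partial>lam) = 0"
    by (subst (asm) emeasure_rectangle) simp_all
  have ae: "AE x in lam. K x = K0 x"
  proof -
    from null have "AE x in lam. indicator (space X) x * emeasure (K0 x) (- {0<..<1}) = 0"
      by (subst (asm) nn_integral_0_iff_AE) simp_all
    with AE_space[of lam] show ?thesis by eventually_elim (simp add: K_def)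
  qed
  have "(\<integral>\<^sup>+p. f p \<partial>M) = (\<integral>\<^sup>+x. \<integral>\<^sup>+p. f p \<partial>distr (K0 x) (X \<Otimes>\<^sub>M borel) (Pair x) \<partial>lam)"
    by (subst M_eq_bind, subst nn_integral_bind[OF _ k]) simp_all
  also have "\<dots> = (\<integral>\<^sup>+x. \<integral>\<^sup>+t. f (x, t) \<partial>K0 x \<partial>lam)"
    by (intro nn_integral_cong) (simp add: nn_integral_distr)
  also have "\<dots> = (\<integral>\<^sup>+x. \<integral>\<^sup>+t. f (x, t) \<partial>K x \<partial>lam)"
    by (rule nn_integral_cong_AE, rule eventually_mono[OF ae]) simp
  finally show ?thesis .
qed

end

section \<open>Laplace transforms are completely monotone\<close>

lemma exp_diff_bound:
  fixes a b m :: real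
  assumes "a \<le> m" "b \<le> m"
  shows "\<bar>exp a - exp b\<bar> \<le> \<bar>a - b\<bar> * exp m"
proof -
  have *: "exp a - exp b \<le> (a - b) * exp m" if "b \<le> a" "a \<le> m" for a b
  proof -
    have "exp a - exp b = exp a * (1 - exp (b - a))" by (simp add: right_diff_distrib exp_diff)
    also have "\<dots> \<le> exp a * (a - b)" using exp_ge_add_one_self[of "b - a"] by (intro mult_left_mono) (linarith, simp)
    also have "\<dots> \<le> exp m * (a - b)" using that by (intro mult_right_mono) auto
    finally show ?thesis by (simp add: mult.commute)
  qed
  show ?thesis
    using *[of b a] *[of a b] assms by (cases "b \<le> a") (auto simp: abs_if)
qed

text \<open>Half of the exponential pays for one more power, since
  \<open>v x * exp (- (u / 2 * v x)) \<le> 2 / u\<close>; the induction therefore lets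
  \<open>u\<close> vary.\<close>

lemma laplace_moment_integrable:
  fixes c v :: "'b \<Rightarrow> real"
  assumes [measurable]: "c \<in> borel_measurable N" "v \<in> borel_measurable N"
    and nn: "\<And>x. 0 \<le> c x" "\<And>x. 0 \<le> v x"
    and int: "\<And>u. u > 0 \<Longrightarrow> integrable N (\<lambda>x. c x * exp (- (u * v x)))" and u: "u > 0"
  shows "integrable N (\<lambda>x. c x * v x ^ m * exp (- (u * v x)))"
  using u
proof (induction m arbitrary: u)
  case (Suc m)
  have "integrable N (\<lambda>x. 2 / u * (c x * v x ^ m * exp (- (u / 2 * v x))))"
    using Suc.IH[of "u / 2"] Suc.prems by (intro integrable_mult_right) simp
  thus ?case
  proof (rule Bochner_Integration.integrable_bound)
    show "AE x in N. norm (c x * v x ^ Suc m * exp (- (u * v x))) \<le> norm (2 / u * (c x * v x ^ m * exp (- (u / 2 * v x))))"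
    proof (rule AE_I2)
      fix x
      have "u / 2 * v x \<le> exp (u / 2 * v x)" using exp_ge_add_one_self[of "u / 2 * v x"] by linarith
      hence "u / 2 * v x * exp (- (u / 2 * v x)) \<le> 1"
        by (simp add: exp_minus field_simps)
      hence "v x * exp (- (u / 2 * v x)) \<le> 2 / u" using Suc.prems by (simp add: field_simps)
      hence "c x * v x ^ m * exp (- (u / 2 * v x)) * (v x * exp (- (u / 2 * v x))) \<le> c x * v x ^ m * exp (- (u / 2 * v x)) * (2 / u)"
        using nn[of x] by (intro mult_left_mono) auto
      moreover have "exp (- (u * v x)) = exp (- (u / 2 * v x)) * exp (- (u / 2 * v x))"
        by (simp add: exp_add[symmetric])
      ultimately have "c x * v x ^ Suc m * exp (- (u * v x)) \<le> 2 / u * (c x * v x ^ m * exp (- (u / 2 * v x)))"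
        by (simp only: power_Suc mult_ac)
      thus "norm (c x * v x ^ Suc m * exp (- (u * v x))) \<le> norm (2 / u * (c x * v x ^ m * exp (- (u / 2 * v x))))"
        using nn[of x] Suc.prems by (simp add: abs_mult)
    qed
  qed measurable
qed (use int in simp)

text \<open>Differentiation under the integral. Increments are restricted to
  \<open>\<bar>h\<bar> < u / 2\<close>, so that \<open>exp (- (u / 2 * v x))\<close> dominates all
  difference quotients.\<close>

lemma laplace_derivative:
  fixes c v :: "'b \<Rightarrow> real"
  assumes [measurable]: "c \<in> borel_measurable N" "v \<in> borel_measurable N"
    and nn: "\<And>x. 0 \<le> c x" "\<And>x. 0 \<le> v x"
    and int: "\<And>u. u > 0 \<Longrightarrow> integrable N (\<lambda>x. c x * exp (- (u * v x)))" and u: "u > 0"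
  shows "((\<lambda>u. \<integral>x. c x * v x ^ m * exp (- (u * v x)) \<partial>N) has_real_derivative
           - (\<integral>x. c x * v x ^ Suc m * exp (- (u * v x)) \<partial>N)) (at u)"
proof -
  note I = laplace_moment_integrable[OF assms(1,2) nn int]
  define f where "f u x = c x * v x ^ m * exp (- (u * v x))" for u x
  let ?S = "{- (u / 2)<..<u / 2}"
  have "((\<lambda>h. ((\<integral>x. f (u + h) x \<partial>N) - (\<integral>x. f u x \<partial>N)) / h) \<longlongrightarrow> - (\<integral>x. c x * v x ^ Suc m * exp (- (u * v x)) \<partial>N)) (at 0 within ?S)"
    unfolding tendsto_at_iff_sequentially comp_def
  proof (intro allI impI)
    fix h :: "nat \<Rightarrow> real" assume h: "\<forall>i. h i \<in> ?S - {0}" and lim: "h \<longlonglongrightarrow> 0"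
    have "(\<lambda>i. \<integral>x. (f (u + h i) x - f u x) / h i \<partial>N) \<longlonglongrightarrow> (\<integral>x. - (c x * v x ^ Suc m * exp (- (u * v x))) \<partial>N)"
    proof (rule integral_dominated_convergence[where w="\<lambda>x. c x * v x ^ Suc m * exp (- (u / 2 * v x))"])
      show "integrable N (\<lambda>x. c x * v x ^ Suc m * exp (- (u / 2 * v x)))" using u by (intro I) simp_all
      show "AE x in N. (\<lambda>i. (f (u + h i) x - f u x) / h i) \<longlonglongrightarrow> - (c x * v x ^ Suc m * exp (- (u * v x)))"
      proof (rule AE_I2)
        fix x
        have "((\<lambda>u. f u x) has_real_derivative - (c x * v x ^ Suc m * exp (- (u * v x)))) (at u)"
          unfolding f_def by (auto intro!: derivative_eq_intros)
        hence "((\<lambda>h. (f (u + h) x - f u x) / h) \<longlongrightarrow> - (c x * v x ^ Suc m * exp (- (u * v x)))) (at 0)"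
          by (rule DERIV_D)
        thus "(\<lambda>i. (f (u + h i) x - f u x) / h i) \<longlonglongrightarrow> - (c x * v x ^ Suc m * exp (- (u * v x)))"
          using h lim by (auto simp: tendsto_at_iff_sequentially comp_def)
      qed
      show "AE x in N. norm ((f (u + h i) x - f u x) / h i) \<le> c x * v x ^ Suc m * exp (- (u / 2 * v x))" for i
      proof (rule AE_I2)
        fix x
        have hi: "- (u / 2) < h i" "h i \<noteq> 0" using h by auto
        have "\<bar>exp (- ((u + h i) * v x)) - exp (- (u * v x))\<bar> \<le> \<bar>- ((u + h i) * v x) - - (u * v x)\<bar> * exp (- (u / 2 * v x))"
        proof (rule exp_diff_bound)
          have "u / 2 * v x \<le> (u + h i) * v x" "u / 2 * v x \<le> u * v x"
            using hi u nn(2)[of x] by (intro mult_right_mono; simp)+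
          thus "- ((u + h i) * v x) \<le> - (u / 2 * v x)" "- (u * v x) \<le> - (u / 2 * v x)" by linarith+
        qed
        also have "\<bar>- ((u + h i) * v x) - - (u * v x)\<bar> = \<bar>h i\<bar> * v x"
          using nn(2)[of x] by (simp add: algebra_simps abs_mult)
        finally have "\<bar>exp (- ((u + h i) * v x)) - exp (- (u * v x))\<bar> / \<bar>h i\<bar> \<le> v x * exp (- (u / 2 * v x))"
          using hi(2) by (simp add: divide_le_eq mult_ac)
        hence "c x * v x ^ m * (\<bar>exp (- ((u + h i) * v x)) - exp (- (u * v x))\<bar> / \<bar>h i\<bar>) \<le> c x * v x ^ m * (v x * exp (- (u / 2 * v x)))"
          using nn[of x] by (intro mult_left_mono) auto
        moreover have "norm ((f (u + h i) x - f u x) / h i) = c x * v x ^ m * (\<bar>exp (- ((u + h i) * v x)) - exp (- (u * v x))\<bar> / \<bar>h i\<bar>)"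
          using nn[of x] unfolding f_def right_diff_distrib[symmetric] by (simp add: abs_mult)
        ultimately show "norm ((f (u + h i) x - f u x) / h i) \<le> c x * v x ^ Suc m * exp (- (u / 2 * v x))"
          by (simp only: power_Suc mult_ac)
      qed
    qed (simp_all add: f_def)
    moreover have "(\<integral>x. (f (u + h i) x - f u x) / h i \<partial>N) = ((\<integral>x. f (u + h i) x \<partial>N) - (\<integral>x. f u x \<partial>N)) / h i" for i
    proof -
      have "- (u / 2) < h i" using h by auto
      hence "integrable N (f (u + h i))" "integrable N (f u)"
        unfolding f_def using u by (intro I; simp)+
      thus ?thesis by simp
    qed
    ultimately show "(\<lambda>i. ((\<integral>x. f (u + h i) x \<partial>N) - (\<integral>x. f u x \<partial>N)) / h i) \<longlonglongrightarrow> - (\<integral>x. c x * v x ^ Suc m * exp (- (u * v x)) \<partial>N)"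
      by (simp only: Bochner_Integration.integral_minus)
  qed
  hence "((\<lambda>h. ((\<integral>x. f (u + h) x \<partial>N) - (\<integral>x. f u x \<partial>N)) / h) \<longlongrightarrow> - (\<integral>x. c x * v x ^ Suc m * exp (- (u * v x)) \<partial>N)) (at 0)"
    using u by (subst (asm) at_within_open) auto
  thus ?thesis unfolding DERIV_def f_def .
qed

theorem laplace_completely_monotone:
  fixes c v :: "'b \<Rightarrow> real"
  assumes "c \<in> borel_measurable N" "v \<in> borel_measurable N"
    and "\<And>x. 0 \<le> c x" "\<And>x. 0 \<le> v x"
    and "\<And>u. u > 0 \<Longrightarrow> integrable N (\<lambda>x. c x * exp (- (u * v x)))"
  shows "completely_monotone (\<lambda>u. \<integral>x. c x * exp (- (u * v x)) \<partial>N)"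
  unfolding completely_monotone_def
proof (intro exI[of _ "\<lambda>n u. (-1) ^ n * (\<integral>x. c x * v x ^ n * exp (- (u * v x)) \<partial>N)"] conjI allI impI)
  fix n and u :: real assume "u > 0"
  from DERIV_cmult[OF laplace_derivative[OF assms this], of "(-1) ^ n" n]
  show "((\<lambda>u. (-1) ^ n * (\<integral>x. c x * v x ^ n * exp (- (u * v x)) \<partial>N)) has_real_derivative
     (-1) ^ Suc n * (\<integral>x. c x * v x ^ Suc n * exp (- (u * v x)) \<partial>N)) (at u)" by simp
  have "0 \<le> (\<integral>x. c x * v x ^ n * exp (- (u * v x)) \<partial>N)" using assms(3,4) by simp
  thus "0 \<le> (-1) ^ n * ((-1) ^ n * (\<integral>x. c x * v x ^ n * exp (- (u * v x)) \<partial>N))"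
    by (simp flip: mult.assoc power_mult_distrib)
qed simp

section \<open>Mixtures along rays\<close>

text \<open>Every \<open>x \<noteq> 0\<close> is spread along its own ray with radial density
  \<open>k r (norm x)\<close>. Building it from \<open>density\<close> and \<open>distr\<close>
  makes it a measure by construction, unlike the raw set functions in \<open>A1\<close> and
  \<open>Upsilon0\<close>.\<close>

definition radial_mix :: "(real \<Rightarrow> real \<Rightarrow> real) \<Rightarrow> 'a::euclidean_space measure \<Rightarrow> 'a measure" where
  "radial_mix k \<rho> = distr (density (\<rho> \<Otimes>\<^sub>M lborel) (\<lambda>(x, r). indicator (- {0}) x * ennreal (k r (norm x))))
     borel (\<lambda>(x, r). r *\<^sub>R (x /\<^sub>R norm x))"

lemma sets_radial_mix [simp, measurable_cong]: "sets (radial_mix k \<rho>) = sets borel"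
  by (simp add: radial_mix_def)

lemma space_radial_mix [simp]: "space (radial_mix k \<rho>) = UNIV"
  by (simp add: radial_mix_def)

lemma nn_integral_radial_mix:
  fixes \<rho> :: "'a::euclidean_space measure"
  assumes [measurable_cong]: "sets \<rho> = sets borel"
    and [measurable]: "(\<lambda>p. k (fst p) (snd p)) \<in> borel_measurable (borel \<Otimes>\<^sub>M borel)" "f \<in> borel_measurable borel"
  shows "(\<integral>\<^sup>+y. f y \<partial>radial_mix k \<rho>) =
    (\<integral>\<^sup>+x. indicator (- {0}) x * (\<integral>\<^sup>+r. ennreal (k r (norm x)) * f (r *\<^sub>R (x /\<^sub>R norm x)) \<partial>lborel) \<partial>\<rho>)"
proof -
  have [measurable]: "(\<lambda>p. k (snd p) (norm (fst p))) \<in> borel_measurable (\<rho> \<Otimes>\<^sub>M borel)"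
    using measurable_compose[OF _ assms(2), of "\<lambda>p. (snd p, norm (fst p))" "\<rho> \<Otimes>\<^sub>M borel"] by simp
  have [measurable]: "(\<lambda>r. k r s) \<in> borel_measurable borel" for s
    using measurable_compose[OF _ assms(2), of "\<lambda>r. (r, s)" borel] by simp
  have "(\<integral>\<^sup>+y. f y \<partial>radial_mix k \<rho>) = (\<integral>\<^sup>+p. indicator (- {0}) (fst p) * ennreal (k (snd p) (norm (fst p))) *
      f (snd p *\<^sub>R (fst p /\<^sub>R norm (fst p))) \<partial>(\<rho> \<Otimes>\<^sub>M lborel))"
    unfolding radial_mix_def split_beta by (subst nn_integral_distr, simp, simp, subst nn_integral_density) simp_all
  also have "\<dots> = (\<integral>\<^sup>+x. \<integral>\<^sup>+r. indicator (- {0}) x * ennreal (k r (norm x)) * f (r *\<^sub>R (x /\<^sub>R norm x)) \<partial>lborel \<partial>\<rho>)"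
    by (subst lborel.nn_integral_fst[symmetric]) simp_all
  also have "\<dots> = (\<integral>\<^sup>+x. indicator (- {0}) x * (\<integral>\<^sup>+r. ennreal (k r (norm x)) * f (r *\<^sub>R (x /\<^sub>R norm x)) \<partial>lborel) \<partial>\<rho>)"
    by (intro nn_integral_cong, subst nn_integral_cmult[symmetric]) (simp_all add: mult.assoc)
  finally show ?thesis .
qed

lemma emeasure_radial_mix:
  assumes "sets \<rho> = sets borel" "(\<lambda>p. k (fst p) (snd p)) \<in> borel_measurable (borel \<Otimes>\<^sub>M borel)" "B \<in> sets borel"
  shows "emeasure (radial_mix k \<rho>) B =
    (\<integral>\<^sup>+x. indicator (- {0}) x * (\<integral>\<^sup>+r. ennreal (k r (norm x)) * indicator B (r *\<^sub>R (x /\<^sub>R norm x)) \<partial>lborel) \<partial>\<rho>)"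
  using nn_integral_radial_mix[OF assms(1,2), of "indicator B"] assms(3) by simp

text \<open>\<open>measure_of\<close> is meaningful only for countably additive set functions;
  agreement with an existing measure provides that.\<close>

lemma measure_of_borel_eqI:
  fixes M :: "'a::topological_space measure"
  assumes "sets M = sets borel" "\<And>B. B \<in> sets borel \<Longrightarrow> F B = emeasure M B"
  shows "measure_of UNIV (sets borel) F = M"
proof -
  have "measure_of UNIV (sets borel) F = measure_of UNIV (sets borel) (emeasure M)"
    using assms(2) by (intro measure_of_eq) (auto simp: sets.sigma_sets_eq[of "borel :: 'a measure", simplified])
  also have "\<dots> = M"
    using measure_of_of_measure[of M] assms(1) sets_eq_imp_space_eq[OF assms(1)] by simp
  finally show ?thesis .
qed

lemma measurable_a1: "(\<lambda>p. a1 (fst p) (snd p)) \<in> borel_measurable (borel \<Otimes>\<^sub>M borel)"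
  unfolding a1_def by measurable

lemma A1_eq: "sets \<nu> = sets borel \<Longrightarrow> A1 \<nu> = radial_mix a1 \<nu>"
  unfolding A1_def by (rule measure_of_borel_eqI) (simp_all add: emeasure_radial_mix measurable_a1)

text \<open>As a function of \<open>r ^ p\<close> this is a multiple of
  \<open>exp (- u / s)\<close>; \<open>p = 1\<close> covers \<open>Upsilon0\<close> and
  \<open>p = 2\<close> its composition with \<open>A1\<close>, so both directions of the equivalence
  are proved once for both.\<close>

definition laplace_kernel :: "nat \<Rightarrow> (real \<Rightarrow> real) \<Rightarrow> real \<Rightarrow> real \<Rightarrow> real" where
  "laplace_kernel p w r s = (if 0 < r \<and> 0 < s then w s * exp (- (r ^ p / s)) else 0)"

lemma measurable_laplace_kernel:
  assumes [measurable]: "w \<in> borel_measurable borel"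
  shows "(\<lambda>q. laplace_kernel p w (fst q) (snd q)) \<in> borel_measurable (borel \<Otimes>\<^sub>M borel)"
  unfolding laplace_kernel_def by measurable

lemma borel_measurable_laplace_kernel [measurable (raw)]:
  assumes [measurable]: "w \<in> borel_measurable borel" "f \<in> borel_measurable M" "h \<in> borel_measurable M"
  shows "(\<lambda>x. laplace_kernel p w (f x) (h x)) \<in> borel_measurable M"
  unfolding laplace_kernel_def by measurable

lemma levy_measure_sets: "levy_measure \<nu> \<Longrightarrow> sets \<nu> = sets borel"
  by (simp add: levy_measure_def)

lemma levy_measure_AE_nonzero: "levy_measure \<nu> \<Longrightarrow> AE x in \<nu>. x \<noteq> 0"
  by (intro AE_I[of _ _ "{0}"]) (auto simp: levy_measure_def)

lemma levy_measure_outside_finite: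
  assumes \<nu>: "levy_measure \<nu>" and "\<epsilon> > 0"
  shows "emeasure \<nu> {x. \<epsilon> \<le> norm x} < \<infinity>"
proof -
  note [measurable_cong] = levy_measure_sets[OF \<nu>]
  have pos: "min 1 (\<epsilon>\<^sup>2) > 0" using assms(2) by simp
  have "ennreal (min 1 (\<epsilon>\<^sup>2)) * emeasure \<nu> {x. \<epsilon> \<le> norm x} = (\<integral>\<^sup>+x. ennreal (min 1 (\<epsilon>\<^sup>2)) * indicator {x. \<epsilon> \<le> norm x} x \<partial>\<nu>)"
    by (rule nn_integral_cmult_indicator[symmetric]) measurable
  also have "\<dots> \<le> (\<integral>\<^sup>+x. ennreal (min 1 ((norm x)\<^sup>2)) \<partial>\<nu>)"
  proof (rule nn_integral_mono)
    fix x
    show "ennreal (min 1 (\<epsilon>\<^sup>2)) * indicator {x. \<epsilon> \<le> norm x} x \<le> ennreal (min 1 ((norm x)\<^sup>2))"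
    proof (cases "\<epsilon> \<le> norm x")
      case True
      hence "\<epsilon>\<^sup>2 \<le> (norm x)\<^sup>2" using assms(2) by (intro power_mono) auto
      thus ?thesis using True by (auto intro!: ennreal_leI)
    qed simp
  qed
  also have "\<dots> < \<infinity>" using \<nu> by (simp add: levy_measure_def)
  finally show ?thesis using pos by (auto simp: ennreal_mult_less_top)
qed

lemma levy_measure_sigma_finite:
  assumes \<nu>: "levy_measure (\<nu> :: 'a::euclidean_space measure)"
  shows "sigma_finite_measure \<nu>"
proof
  let ?A = "insert {0} (range (\<lambda>n. {x::'a. inverse (real (Suc n)) \<le> norm x}))"
  have "x \<in> \<Union>?A" for x
  proof (cases "x = 0")
    case False
    then obtain n where "inverse (real (Suc n)) < norm x"
      using reals_Archimedean[of "norm x"] by auto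
    thus ?thesis by (auto intro: less_imp_le)
  qed simp
  hence "\<Union>?A = space \<nu>" using sets_eq_imp_space_eq[OF levy_measure_sets[OF \<nu>]] by auto
  moreover have "?A \<subseteq> sets \<nu>" unfolding levy_measure_sets[OF \<nu>] by auto
  moreover have "\<forall>a\<in>?A. emeasure \<nu> a \<noteq> \<infinity>"
    using levy_measure_outside_finite[OF \<nu>, of "inverse (real (Suc _))"] \<nu>
    by (auto simp: levy_measure_def less_top[symmetric])
  ultimately show "\<exists>A. countable A \<and> A \<subseteq> sets \<nu> \<and> \<Union>A = space \<nu> \<and> (\<forall>a\<in>A. emeasure \<nu> a \<noteq> \<infinity>)"
    by (intro exI[of _ ?A]) auto
qed

abbreviation k_exp :: "real \<Rightarrow> real \<Rightarrow> real" where
  "k_exp \<equiv> laplace_kernel 1 (\<lambda>s. 1 / s)"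

abbreviation k_gauss :: "real \<Rightarrow> real \<Rightarrow> real" where
  "k_gauss \<equiv> laplace_kernel 2 (\<lambda>s. 2 / sqrt (pi * s))"

lemma nn_integral_k_exp:
  assumes [measurable]: "f \<in> borel_measurable borel" and s: "s > 0"
  shows "(\<integral>\<^sup>+r. ennreal (k_exp r s) * f r \<partial>lborel) =
    (\<integral>\<^sup>+u. indicator {0<..} u * ennreal (exp (- u)) * f (s * u) \<partial>lborel)"
proof -
  have "(\<integral>\<^sup>+r. ennreal (k_exp r s) * f r \<partial>lborel) = ennreal \<bar>s\<bar> * (\<integral>\<^sup>+u. ennreal (k_exp (0 + s * u) s) * f (0 + s * u) \<partial>lborel)"
    using s by (intro nn_integral_real_affine) auto
  also have "\<dots> = (\<integral>\<^sup>+u. ennreal \<bar>s\<bar> * (ennreal (k_exp (0 + s * u) s) * f (0 + s * u)) \<partial>lborel)"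
    by (rule nn_integral_cmult[symmetric]) measurable
  also have "\<dots> = (\<integral>\<^sup>+u. indicator {0<..} u * ennreal (exp (- u)) * f (s * u) \<partial>lborel)"
  proof (rule nn_integral_cong)
    fix u
    show "ennreal \<bar>s\<bar> * (ennreal (k_exp (0 + s * u) s) * f (0 + s * u)) = indicator {0<..} u * ennreal (exp (- u)) * f (s * u)"
      using s by (auto simp: laplace_kernel_def zero_less_mult_iff ennreal_mult'[symmetric] simp flip: mult.assoc)
  qed
  finally show ?thesis .
qed

text \<open>Dilating \<open>x\<close> by an exponential variable is mixing on its ray, after the
  substitution \<open>r = norm x * u\<close>. Interchanging the integrals uses that Levy measures
  are sigma-finite.\<close>

lemma Upsilon0_eq:
  assumes \<rho>: "levy_measure (\<rho> :: 'a::euclidean_space measure)"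
  shows "Upsilon0 \<rho> = radial_mix k_exp \<rho>"
  unfolding Upsilon0_def
proof (rule measure_of_borel_eqI)
  note [measurable_cong] = levy_measure_sets[OF \<rho>]
  interpret \<rho>: sigma_finite_measure \<rho> by (rule levy_measure_sigma_finite[OF \<rho>])
  interpret P: pair_sigma_finite \<rho> lborel ..
  fix B :: "'a set" assume [measurable]: "B \<in> sets borel"
  have "(\<integral>\<^sup>+u. indicator {0<..} u * emeasure \<rho> ((\<lambda>x. u *\<^sub>R x) -` B) * ennreal (exp (- u)) \<partial>lborel) =
    (\<integral>\<^sup>+u. \<integral>\<^sup>+x. indicator {0<..} u * ennreal (exp (- u)) * indicator B (u *\<^sub>R x) \<partial>\<rho> \<partial>lborel)"
  proof (rule nn_integral_cong)
    fix u :: real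
    have "(\<lambda>x. u *\<^sub>R x) -` B \<inter> space borel \<in> sets borel" by (rule measurable_sets[of _ borel borel]) simp_all
    hence [measurable]: "(\<lambda>x. u *\<^sub>R x) -` B \<in> sets borel" by simp
    have "(\<integral>\<^sup>+x. indicator {0<..} u * ennreal (exp (- u)) * indicator B (u *\<^sub>R x) \<partial>\<rho>) =
       (\<integral>\<^sup>+x. (indicator {0<..} u * ennreal (exp (- u))) * indicator ((\<lambda>x. u *\<^sub>R x) -` B) x \<partial>\<rho>)"
      by (intro nn_integral_cong) (simp add: indicator_def)
    also have "\<dots> = indicator {0<..} u * ennreal (exp (- u)) * emeasure \<rho> ((\<lambda>x. u *\<^sub>R x) -` B)"
      by (rule nn_integral_cmult_indicator) (simp add: levy_measure_sets[OF \<rho>])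
    finally show "indicator {0<..} u * emeasure \<rho> ((\<lambda>x. u *\<^sub>R x) -` B) * ennreal (exp (- u)) =
       (\<integral>\<^sup>+x. indicator {0<..} u * ennreal (exp (- u)) * indicator B (u *\<^sub>R x) \<partial>\<rho>)" by (simp add: mult_ac)
  qed
  also have "\<dots> = (\<integral>\<^sup>+x. \<integral>\<^sup>+u. indicator {0<..} u * ennreal (exp (- u)) * indicator B (u *\<^sub>R x) \<partial>lborel \<partial>\<rho>)"
    by (rule P.Fubini') measurable
  also have "\<dots> = (\<integral>\<^sup>+x. indicator (- {0}) x * (\<integral>\<^sup>+r. ennreal (k_exp r (norm x)) * indicator B (r *\<^sub>R (x /\<^sub>R norm x)) \<partial>lborel) \<partial>\<rho>)"
  proof (rule nn_integral_cong_AE, rule eventually_mono[OF levy_measure_AE_nonzero[OF \<rho>]])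
    fix x :: 'a assume "x \<noteq> 0"
    thus "(\<integral>\<^sup>+u. indicator {0<..} u * ennreal (exp (- u)) * indicator B (u *\<^sub>R x) \<partial>lborel) =
       indicator (- {0}) x * (\<integral>\<^sup>+r. ennreal (k_exp r (norm x)) * indicator B (r *\<^sub>R (x /\<^sub>R norm x)) \<partial>lborel)"
      by (subst nn_integral_k_exp) (simp_all add: mult_ac)
  qed
  also have "\<dots> = emeasure (radial_mix k_exp \<rho>) B"
    by (rule emeasure_radial_mix[symmetric]) (simp_all add: levy_measure_sets[OF \<rho>] measurable_laplace_kernel)
  finally show "(\<integral>\<^sup>+u. indicator {0<..} u * emeasure \<rho> ((\<lambda>x. u *\<^sub>R x) -` B) * ennreal (exp (- u)) \<partial>lborel) =
     emeasure (radial_mix k_exp \<rho>) B" .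
qed simp

text \<open>The substitution \<open>r' = r\<^sup>2 + s * w\<close> splits off
  \<open>exp (- r\<^sup>2 / s)\<close> and leaves the integral for
  \<open>Gamma (1/2) = sqrt pi\<close>. For \<open>w \<le> 0\<close> the arcsine kernel
  vanishes.\<close>

lemma nn_integral_a1_k_exp:
  assumes s: "s > 0"
  shows "(\<integral>\<^sup>+r'. ennreal (k_exp r' s) * ennreal (a1 r r') \<partial>lborel) = ennreal (k_gauss r s)"
proof (cases "r > 0")
  case False
  thus ?thesis by (simp add: a1_def laplace_kernel_def)
next
  case r: True
  define C where "C = exp (- (r\<^sup>2 / s)) * (2 / pi) * s powr (-1/2)"
  have C: "C \<ge> 0" by (simp add: C_def)
  have [measurable]: "(\<lambda>r'. a1 r r') \<in> borel_measurable borel" unfolding a1_def by measurable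
  have "(\<integral>\<^sup>+r'. ennreal (k_exp r' s) * ennreal (a1 r r') \<partial>lborel) =
     ennreal \<bar>s\<bar> * (\<integral>\<^sup>+w. ennreal (k_exp (r\<^sup>2 + s * w) s) * ennreal (a1 r (r\<^sup>2 + s * w)) \<partial>lborel)"
    using s by (intro nn_integral_real_affine) auto
  also have "\<dots> = (\<integral>\<^sup>+w. ennreal \<bar>s\<bar> * (ennreal (k_exp (r\<^sup>2 + s * w) s) * ennreal (a1 r (r\<^sup>2 + s * w))) \<partial>lborel)"
    by (rule nn_integral_cmult[symmetric]) measurable
  also have "\<dots> = (\<integral>\<^sup>+w. ennreal C * ennreal (indicator {0..} w * w powr (1/2 - 1) / exp w) \<partial>lborel)"
  proof (rule nn_integral_cong)
    fix w :: real
    show "ennreal \<bar>s\<bar> * (ennreal (k_exp (r\<^sup>2 + s * w) s) * ennreal (a1 r (r\<^sup>2 + s * w))) = ennreal C * ennreal (indicator {0..} w * w powr (1/2 - 1) / exp w)"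
    proof (cases "w > 0")
      case False
      have "\<not> r < sqrt (r\<^sup>2 + s * w)"
      proof
        assume "r < sqrt (r\<^sup>2 + s * w)"
        hence "sqrt (r\<^sup>2) < sqrt (r\<^sup>2 + s * w)" using r by simp
        hence "s * w > 0" by (simp only: real_sqrt_less_iff)
        thus False using False s by (simp add: zero_less_mult_iff)
      qed
      thus ?thesis using False by (cases "w = 0") (auto simp: a1_def indicator_def)
    next
      case True
      have "r = sqrt (r\<^sup>2)" using r by simp
      also have "\<dots> < sqrt (r\<^sup>2 + s * w)" by (rule real_sqrt_less_mono) (use True s in simp)
      finally have a: "a1 r (r\<^sup>2 + s * w) = 2 / pi * (s powr (-1/2) * w powr (-1/2))"
        using r True s by (simp add: a1_def powr_mult)
      have k: "k_exp (r\<^sup>2 + s * w) s = exp (- (r\<^sup>2 / s)) / exp w / s"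
        using r True s by (simp add: laplace_kernel_def add_divide_distrib exp_diff add_pos_pos)
      show ?thesis
        unfolding a k using True s by (simp add: C_def ennreal_mult'[symmetric] field_simps)
    qed
  qed
  also have "\<dots> = ennreal C * ennreal (Gamma (1/2))"
    by (subst nn_integral_cmult) (simp_all only: Gamma_conv_nn_integral_real[of "1/2"], simp_all)
  also have "\<dots> = ennreal (k_gauss r s)"
  proof -
    have "C * Gamma (1/2) = k_gauss r s"
      using r s by (simp add: C_def laplace_kernel_def Gamma_one_half_real powr_minus powr_half_sqrt real_sqrt_mult field_simps)
    thus ?thesis using C by (simp add: ennreal_mult'[symmetric])
  qed
  finally show ?thesis .
qed

lemma measurable_k_exp: "(\<lambda>q. k_exp (fst q) (snd q)) \<in> borel_measurable (borel \<Otimes>\<^sub>M borel)"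
  by (rule measurable_laplace_kernel) measurable

lemma measurable_k_gauss: "(\<lambda>q. k_gauss (fst q) (snd q)) \<in> borel_measurable (borel \<Otimes>\<^sub>M borel)"
  by (rule measurable_laplace_kernel) measurable

text \<open>Both mixings keep the direction, so their composition is again a mixing, with the
  composed kernel computed in \<open>nn_integral_a1_k_exp\<close>.\<close>

lemma A1_Upsilon0_eq:
  assumes \<rho>: "levy_measure (\<rho> :: 'a::euclidean_space measure)"
  shows "A1 (Upsilon0 \<rho>) = radial_mix k_gauss \<rho>"
proof -
  note [measurable_cong] = levy_measure_sets[OF \<rho>]
  note sets = levy_measure_sets[OF \<rho>]
  have [measurable]: "(\<lambda>p. a1 (fst p) (snd p)) \<in> borel_measurable (borel \<Otimes>\<^sub>M borel)" by (rule measurable_a1)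
  have [measurable]: "(\<lambda>p. a1 (snd p) (norm (fst p :: 'a))) \<in> borel_measurable (borel \<Otimes>\<^sub>M borel)"
    unfolding a1_def by measurable
  have [measurable]: "(\<lambda>p. a1 (snd p) (fst p)) \<in> borel_measurable (borel \<Otimes>\<^sub>M borel)"
    unfolding a1_def by measurable
  have "A1 (Upsilon0 \<rho>) = radial_mix a1 (radial_mix k_exp \<rho>)"
    by (simp add: Upsilon0_eq[OF \<rho>] A1_eq)
  also have "\<dots> = radial_mix k_gauss \<rho>"
  proof (rule measure_eqI)
    fix B :: "'a set" assume "B \<in> sets (radial_mix a1 (radial_mix k_exp \<rho>))"
    hence [measurable]: "B \<in> sets borel" by simp
    define G where "G y = indicator (- {0}) y * (\<integral>\<^sup>+r. ennreal (a1 r (norm y)) * indicator B (r *\<^sub>R (y /\<^sub>R norm y)) \<partial>lborel)" for y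
    have [measurable]: "G \<in> borel_measurable borel" unfolding G_def by measurable
    have "emeasure (radial_mix a1 (radial_mix k_exp \<rho>)) B = (\<integral>\<^sup>+y. G y \<partial>radial_mix k_exp \<rho>)"
      unfolding G_def by (rule emeasure_radial_mix) (simp_all add: measurable_a1)
    also have "\<dots> = (\<integral>\<^sup>+x. indicator (- {0}) x * (\<integral>\<^sup>+r'. ennreal (k_exp r' (norm x)) * G (r' *\<^sub>R (x /\<^sub>R norm x)) \<partial>lborel) \<partial>\<rho>)"
      by (rule nn_integral_radial_mix[OF sets measurable_k_exp]) measurable
    also have "\<dots> = (\<integral>\<^sup>+x. indicator (- {0}) x * (\<integral>\<^sup>+r. ennreal (k_gauss r (norm x)) * indicator B (r *\<^sub>R (x /\<^sub>R norm x)) \<partial>lborel) \<partial>\<rho>)"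
    proof (rule nn_integral_cong)
      fix x :: 'a
      show "indicator (- {0}) x * (\<integral>\<^sup>+r'. ennreal (k_exp r' (norm x)) * G (r' *\<^sub>R (x /\<^sub>R norm x)) \<partial>lborel) =
        indicator (- {0}) x * (\<integral>\<^sup>+r. ennreal (k_gauss r (norm x)) * indicator B (r *\<^sub>R (x /\<^sub>R norm x)) \<partial>lborel)"
      proof (cases "x = 0")
        case False
        define \<xi> where "\<xi> = x /\<^sub>R norm x"
        have \<xi>: "norm \<xi> = 1" using False by (simp add: \<xi>_def)
        have "(\<integral>\<^sup>+r'. ennreal (k_exp r' (norm x)) * G (r' *\<^sub>R \<xi>) \<partial>lborel) =
          (\<integral>\<^sup>+r'. \<integral>\<^sup>+r. ennreal (k_exp r' (norm x)) * ennreal (a1 r r') * indicator B (r *\<^sub>R \<xi>) \<partial>lborel \<partial>lborel)"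
        proof (rule nn_integral_cong)
          fix r' :: real
          have [measurable]: "(\<lambda>r. a1 r r') \<in> borel_measurable borel" unfolding a1_def by measurable
          show "ennreal (k_exp r' (norm x)) * G (r' *\<^sub>R \<xi>) = (\<integral>\<^sup>+r. ennreal (k_exp r' (norm x)) * ennreal (a1 r r') * indicator B (r *\<^sub>R \<xi>) \<partial>lborel)"
          proof (cases "r' > 0")
            case True
            moreover have "\<xi> \<noteq> 0" using \<xi> by auto
            ultimately have "G (r' *\<^sub>R \<xi>) = (\<integral>\<^sup>+r. ennreal (a1 r r') * indicator B (r *\<^sub>R \<xi>) \<partial>lborel)"
              using \<xi> by (simp add: G_def)
            thus ?thesis by (simp add: nn_integral_cmult mult.assoc)
          qed (simp add: laplace_kernel_def)
        qed
        also have "\<dots> = (\<integral>\<^sup>+r. \<integral>\<^sup>+r'. ennreal (k_exp r' (norm x)) * ennreal (a1 r r') * indicator B (r *\<^sub>R \<xi>) \<partial>lborel \<partial>lborel)"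
          by (rule lborel_pair.Fubini'[symmetric]) measurable
        also have "\<dots> = (\<integral>\<^sup>+r. ennreal (k_gauss r (norm x)) * indicator B (r *\<^sub>R \<xi>) \<partial>lborel)"
        proof (rule nn_integral_cong)
          fix r
          have [measurable]: "(\<lambda>r'. a1 r r') \<in> borel_measurable borel" unfolding a1_def by measurable
          show "(\<integral>\<^sup>+r'. ennreal (k_exp r' (norm x)) * ennreal (a1 r r') * indicator B (r *\<^sub>R \<xi>) \<partial>lborel) = ennreal (k_gauss r (norm x)) * indicator B (r *\<^sub>R \<xi>)"
          proof -
            have "(\<integral>\<^sup>+r'. ennreal (k_exp r' (norm x)) * ennreal (a1 r r') * indicator B (r *\<^sub>R \<xi>) \<partial>lborel) =
               (\<integral>\<^sup>+r'. ennreal (k_exp r' (norm x)) * ennreal (a1 r r') \<partial>lborel) * indicator B (r *\<^sub>R \<xi>)"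
              by (rule nn_integral_multc) measurable
            also have "(\<integral>\<^sup>+r'. ennreal (k_exp r' (norm x)) * ennreal (a1 r r') \<partial>lborel) = ennreal (k_gauss r (norm x))"
              by (rule nn_integral_a1_k_exp) (use False in simp)
            finally show ?thesis .
          qed
        qed
        finally show ?thesis by (simp add: \<xi>_def)
      qed simp
    qed
    also have "\<dots> = emeasure (radial_mix k_gauss \<rho>) B"
      by (rule emeasure_radial_mix[symmetric]) (simp_all add: sets measurable_k_gauss)
    finally show "emeasure (radial_mix a1 (radial_mix k_exp \<rho>)) B = emeasure (radial_mix k_gauss \<rho>) B" .
  qed simp
  finally show ?thesis .
qed

section \<open>From completely monotone radial densities to mixtures\<close>

definition polar_cm :: "nat \<Rightarrow> 'a::euclidean_space measure \<Rightarrow> 'a measure \<Rightarrow> ('a \<Rightarrow> real \<Rightarrow> real) \<Rightarrow> bool" where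
  "polar_cm p \<nu> lam g \<longleftrightarrow>
     polar_decomposition \<nu> lam (\<lambda>\<xi>. density lborel (\<lambda>r. ennreal (indicator {0<..} r * g \<xi> (r ^ p)))) \<and>
     (\<lambda>q. g (fst q) (snd q)) \<in> borel_measurable (lam \<Otimes>\<^sub>M restrict_space borel {0<..}) \<and>
     (\<forall>\<xi>\<in>sphere 0 1. completely_monotone (g \<xi>))"

lemma completely_monotone_radial_measurable:
  assumes "completely_monotone g"
  shows "(\<lambda>r. indicator {0<..} r * g (r ^ p)) \<in> borel_measurable borel"
proof -
  have "continuous_on {0<..} (\<lambda>r. g (r ^ p))"
  proof (intro continuous_at_imp_continuous_on ballI)
    fix r :: real assume "r \<in> {0<..}"
    hence "isCont g (r ^ p)" by (intro completely_monotone_continuous[OF assms]) simp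
    moreover have "isCont (\<lambda>r. r ^ p) r" by simp
    ultimately show "isCont (\<lambda>r. g (r ^ p)) r" by (rule isCont_o2[rotated])
  qed
  from borel_measurable_continuous_on_indicator[OF _ this] show ?thesis by simp
qed

lemma measurable_cm_moment:
  assumes [measurable]: "\<And>u. u > 0 \<Longrightarrow> (\<lambda>\<xi>. g \<xi> u) \<in> borel_measurable M"
  shows "(\<lambda>\<xi>. cm_moment (g \<xi>) n k) \<in> borel_measurable M"
proof -
  have [measurable]: "(\<lambda>\<xi>. cm_diff (g \<xi>) n k) \<in> borel_measurable M" for n k
    by (induction n arbitrary: k) simp_all
  have [measurable]: "(\<lambda>\<xi>. g \<xi> 1) \<in> borel_measurable M" by simp
  show ?thesis unfolding cm_moment_def by measurable
qed

text \<open>The point \<open>t = 1\<close> corresponds to \<open>s = \<infinity>\<close>, which no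
  radius represents; it is separated to be shown negligible.\<close>

lemma unit_interval_split_one:
  assumes [measurable_cong]: "sets W = sets borel"
  shows "(\<integral>\<^sup>+t. ennreal (t powr a) \<partial>W) = (\<integral>\<^sup>+t. ennreal (t powr a) * indicator (- {1}) t \<partial>W) + emeasure W {1}"
proof -
  have "(\<integral>\<^sup>+t. ennreal (t powr a) \<partial>W) = (\<integral>\<^sup>+t. ennreal (t powr a) * indicator (- {1}) t + indicator {1} t \<partial>W)"
    by (intro nn_integral_cong) (auto simp: indicator_def)
  also have "\<dots> = (\<integral>\<^sup>+t. ennreal (t powr a) * indicator (- {1}) t \<partial>W) + (\<integral>\<^sup>+t. indicator {1} t \<partial>W)"
    by (rule nn_integral_add) measurable
  also have "(\<integral>\<^sup>+t. indicator {1} t \<partial>W) = emeasure W {1}"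
    by (rule nn_integral_indicator) (simp add: assms)
  finally show ?thesis .
qed

text \<open>By Bernstein's theorem each radial density is the Laplace transform of a measure \<open>W \<xi>\<close>
  in \<open>t = exp (- 1 / s)\<close>; the point with direction \<open>\<xi>\<close> and parameter \<open>t\<close> is placed at radius
  \<open>s = - 1 / ln t\<close>.  The atom at \<open>t = 1\<close> (that is, \<open>s = \<infinity>\<close>) vanishes since a Levy measure is
  finite away from the origin.\<close>
theorem polar_cm_imp_radial_mix:
  fixes \<nu> :: "'a::euclidean_space measure"
  assumes polar: "polar_cm p \<nu> lam g" and levy: "levy_measure \<nu>"
    and wm [measurable]: "w \<in> borel_measurable borel" and w_pos: "\<And>s. s > 0 \<Longrightarrow> w s > 0"
  shows "\<exists>\<rho>. sets \<rho> = sets borel \<and> emeasure \<rho> {0} = 0 \<and> \<nu> = radial_mix (laplace_kernel p w) \<rho>"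
proof -
  let ?X = "restrict_space borel (sphere (0::'a) 1)"
  have lam_sets [measurable_cong]: "sets lam = sets ?X"
    using polar by (simp add: polar_cm_def polar_decomposition_def)
  have lam_space: "space lam = sphere 0 1"
    using sets_eq_imp_space_eq[OF lam_sets] by (simp add: space_restrict_space)
  have cm: "\<And>\<xi>. \<xi> \<in> space lam \<Longrightarrow> completely_monotone (g \<xi>)"
    using polar unfolding lam_space polar_cm_def by blast
  have g_meas: "(\<lambda>q. g (fst q) (snd q)) \<in> borel_measurable (lam \<Otimes>\<^sub>M restrict_space borel {0<..})"
    using polar by (simp add: polar_cm_def)
  have gu [measurable]: "(\<lambda>\<xi>. g \<xi> u) \<in> borel_measurable lam" if "u > 0" for u
  proof -
    have "(\<lambda>\<xi>. (\<xi>, u)) \<in> lam \<rightarrow>\<^sub>M lam \<Otimes>\<^sub>M restrict_space borel {0<..}"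
      using that by (intro measurable_Pair measurable_ident_sets refl measurable_const) (simp add: space_restrict_space)
    from measurable_compose[OF this g_meas] show ?thesis by simp
  qed
  have gr [measurable]: "\<And>\<xi>. \<xi> \<in> space lam \<Longrightarrow> (\<lambda>r. indicator {0<..} r * g \<xi> (r ^ p)) \<in> borel_measurable borel"
    by (rule completely_monotone_radial_measurable[OF cm])
  have \<nu>_eq: "emeasure \<nu> B = (\<integral>\<^sup>+\<xi>. \<integral>\<^sup>+r. ennreal (indicator {0<..} r * g \<xi> (r ^ p)) * indicator B (r *\<^sub>R \<xi>) \<partial>lborel \<partial>lam)"
    if [measurable]: "B \<in> sets borel" for B
  proof -
    have "emeasure \<nu> B = (\<integral>\<^sup>+\<xi>. \<integral>\<^sup>+r. indicator B (r *\<^sub>R \<xi>) \<partial>density lborel (\<lambda>r. ennreal (indicator {0<..} r * g \<xi> (r ^ p))) \<partial>lam)"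
      using polar that unfolding polar_cm_def polar_decomposition_def by blast
    also have "\<dots> = (\<integral>\<^sup>+\<xi>. \<integral>\<^sup>+r. ennreal (indicator {0<..} r * g \<xi> (r ^ p)) * indicator B (r *\<^sub>R \<xi>) \<partial>lborel \<partial>lam)"
      by (rule nn_integral_cong, rule nn_integral_density) (use gr in measurable)
    finally show ?thesis .
  qed
  define W where "W \<xi> = (SOME M. prob_space M \<and> unit_interval_measure M \<and> (\<forall>n k. mixed_moment M n k = cm_moment (g \<xi>) n k))" for \<xi>
  have W: "prob_space (W \<xi>) \<and> unit_interval_measure (W \<xi>) \<and> (\<forall>n k. mixed_moment (W \<xi>) n k = cm_moment (g \<xi>) n k)"
    if "\<xi> \<in> space lam" for \<xi>
    using someI_ex[OF cm_moment_measure_exists[OF cm[OF that]]] unfolding W_def .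
  have W_sets: "sets (W \<xi>) = sets borel" if "\<xi> \<in> space lam" for \<xi>
    using W[OF that] by (simp add: unit_interval_measure_def)
  have W_unit: "AE t in W \<xi>. t \<in> {0..1}" if "\<xi> \<in> space lam" for \<xi>
    using W[OF that] by (simp only: unit_interval_measure_def)
  have bernstein: "ennreal (g \<xi> u) = ennreal (g \<xi> 1) * (\<integral>\<^sup>+t. ennreal (t powr (u - 1)) \<partial>W \<xi>)"
    if "\<xi> \<in> space lam" "u > 0" for \<xi> u
    using Bernstein[OF cm[OF that(1)]] W[OF that(1)] that(2) by blast
  have "W \<in> lam \<rightarrow>\<^sub>M prob_algebra borel"
  proof (rule measurable_kernel_of_moments)
    show "(\<lambda>\<xi>. mixed_moment (W \<xi>) n k) \<in> borel_measurable lam" for n k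
      by (subst measurable_cong[where g="\<lambda>\<xi>. cm_moment (g \<xi>) n k"]) (use W measurable_cm_moment[OF gu] in auto)
  qed (use W in auto)
  hence W_kernel [measurable]: "W \<in> lam \<rightarrow>\<^sub>M subprob_algebra borel" by (rule measurable_prob_algebraD)
  have id_meas: "(\<lambda>\<xi>. \<xi>) \<in> lam \<rightarrow>\<^sub>M borel"
    unfolding measurable_cong_sets[OF lam_sets refl] by (rule measurable_restrict_space1) simp
  \<comment> \<open>Mixture over directions of the Bernstein measures, transported to the rays; the
    factor \<open>g \<xi> 1\<close> undoes their normalisation.\<close>
  define P where "P = density lam (\<lambda>\<xi>. ennreal (g \<xi> 1)) \<bind> (\<lambda>\<xi>. distr (W \<xi>) borel (\<lambda>t. (- 1 / ln t) *\<^sub>R \<xi>))"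
  have kernel [measurable]: "(\<lambda>\<xi>. distr (W \<xi>) borel (\<lambda>t. (- 1 / ln t) *\<^sub>R \<xi>)) \<in> lam \<rightarrow>\<^sub>M subprob_algebra borel"
  proof (rule measurable_distr2[where M=borel])
    have [measurable]: "fst \<in> lam \<Otimes>\<^sub>M (borel :: real measure) \<rightarrow>\<^sub>M borel"
      by (rule measurable_compose[OF measurable_fst id_meas])
    show "(\<lambda>(\<xi>, t). (- 1 / ln t) *\<^sub>R \<xi>) \<in> lam \<Otimes>\<^sub>M borel \<rightarrow>\<^sub>M borel"
      unfolding split_beta by measurable
  qed (rule W_kernel)
  have "(SOME b. b \<in> Basis) \<in> sphere (0::'a) 1" using SOME_Basis by simp
  hence ne: "space lam \<noteq> {}" unfolding lam_space by blast
  have P_sets [measurable_cong]: "sets P = sets borel"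
    unfolding P_def using ne by (intro sets_bind) auto
  \<comment> \<open>With \<open>s = norm y\<close>, the factor \<open>exp (1 / s)\<close> removes
    the tilt \<open>t powr (u - 1)\<close> of Bernstein's theorem, and division by
    \<open>w s\<close> cancels the weight of the kernel.\<close>
  define h where "h y = indicator (- {0}) y * ennreal (exp (1 / norm y) / w (norm y))" for y :: 'a
  have h_meas [measurable]: "h \<in> borel_measurable borel" unfolding h_def by measurable
  define \<rho> where "\<rho> = density P h"
  have \<rho>_sets [measurable_cong]: "sets \<rho> = sets borel" by (simp add: \<rho>_def P_sets)
  have \<rho>_zero: "emeasure \<rho> {0} = 0"
  proof -
    have "emeasure \<rho> {0} = (\<integral>\<^sup>+y. h y * indicator {0} y \<partial>P)"
      unfolding \<rho>_def
    proof (rule emeasure_density)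
      show "h \<in> borel_measurable P" by (simp add: measurable_cong_sets[OF P_sets refl] h_meas)
      show "{0} \<in> sets P" by (simp add: P_sets)
    qed
    also have "\<dots> = (\<integral>\<^sup>+y. 0 \<partial>P)" by (intro nn_integral_cong) (auto simp: h_def indicator_def)
    finally show ?thesis by simp
  qed
  have nn_\<rho>: "(\<integral>\<^sup>+x. f x \<partial>\<rho>) = (\<integral>\<^sup>+\<xi>. ennreal (g \<xi> 1) * (\<integral>\<^sup>+t. h ((- 1 / ln t) *\<^sub>R \<xi>) * f ((- 1 / ln t) *\<^sub>R \<xi>) \<partial>W \<xi>) \<partial>lam)"
    if [measurable]: "f \<in> borel_measurable borel" for f
  proof -
    have "(\<integral>\<^sup>+x. f x \<partial>\<rho>) = (\<integral>\<^sup>+x. h x * f x \<partial>P)"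
      unfolding \<rho>_def
      by (rule nn_integral_density) (simp_all add: measurable_cong_sets[OF P_sets refl] h_meas)
    also have "\<dots> = (\<integral>\<^sup>+\<xi>. \<integral>\<^sup>+x. h x * f x \<partial>distr (W \<xi>) borel (\<lambda>t. (- 1 / ln t) *\<^sub>R \<xi>) \<partial>density lam (\<lambda>\<xi>. ennreal (g \<xi> 1)))"
      unfolding P_def by (rule nn_integral_bind[where B=borel]) measurable
    also have "\<dots> = (\<integral>\<^sup>+\<xi>. ennreal (g \<xi> 1) * (\<integral>\<^sup>+x. h x * f x \<partial>distr (W \<xi>) borel (\<lambda>t. (- 1 / ln t) *\<^sub>R \<xi>)) \<partial>lam)"
    proof (rule nn_integral_density)
      show "(\<lambda>\<xi>. \<integral>\<^sup>+x. h x * f x \<partial>distr (W \<xi>) borel (\<lambda>t. (- 1 / ln t) *\<^sub>R \<xi>)) \<in> borel_measurable lam"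
        by (rule measurable_compose[OF kernel nn_integral_measurable_subprob_algebra]) measurable
    qed measurable
    also have "\<dots> = (\<integral>\<^sup>+\<xi>. ennreal (g \<xi> 1) * (\<integral>\<^sup>+t. h ((- 1 / ln t) *\<^sub>R \<xi>) * f ((- 1 / ln t) *\<^sub>R \<xi>) \<partial>W \<xi>) \<partial>lam)"
    proof (rule nn_integral_cong)
      fix \<xi> assume "\<xi> \<in> space lam"
      have *: "(\<lambda>t. (- 1 / ln t) *\<^sub>R \<xi>) \<in> W \<xi> \<rightarrow>\<^sub>M borel"
        unfolding measurable_cong_sets[OF W_sets[OF \<open>\<xi> \<in> space lam\<close>] refl] by measurable
      show "ennreal (g \<xi> 1) * (\<integral>\<^sup>+x. h x * f x \<partial>distr (W \<xi>) borel (\<lambda>t. (- 1 / ln t) *\<^sub>R \<xi>)) =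
        ennreal (g \<xi> 1) * (\<integral>\<^sup>+t. h ((- 1 / ln t) *\<^sub>R \<xi>) * f ((- 1 / ln t) *\<^sub>R \<xi>) \<partial>W \<xi>)"
        by (subst nn_integral_distr[OF *]) simp_all
    qed
    finally show ?thesis .
  qed
  \<comment> \<open>An atom at \<open>t = 1\<close> bounds the radial density from below by a
    positive constant on \<open>{1..}\<close>, giving infinite mass outside the unit ball.
    Finiteness of an integral over \<open>lam\<close> excludes this for almost every
    direction.\<close>
  have atom: "AE \<xi> in lam. ennreal (g \<xi> 1) * emeasure (W \<xi>) {1} = 0"
  proof -
    let ?B = "{x::'a. 1 \<le> norm x}"
    let ?F = "\<lambda>\<xi>. \<integral>\<^sup>+r. ennreal (indicator {0<..} r * g \<xi> (r ^ p)) * indicator ?B (r *\<^sub>R \<xi>) \<partial>lborel"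
    have meas_E: "(\<lambda>\<xi>. emeasure (density lborel (\<lambda>r. ennreal (indicator {0<..} r * g \<xi> (r ^ p)))) {1..}) \<in> borel_measurable lam"
      using polar unfolding polar_cm_def polar_decomposition_def by simp
    have F_eq: "emeasure (density lborel (\<lambda>r. ennreal (indicator {0<..} r * g \<xi> (r ^ p)))) {1..} = ?F \<xi>" if "\<xi> \<in> space lam" for \<xi>
    proof -
      have "norm \<xi> = 1" using that lam_space by simp
      thus ?thesis using gr[OF that]
        by (subst emeasure_density) (auto intro!: nn_integral_cong simp: indicator_def)
    qed
    have [measurable]: "?F \<in> borel_measurable lam"
      using meas_E by (subst (asm) measurable_cong[OF F_eq]) simp_all
    have "(\<integral>\<^sup>+\<xi>. ?F \<xi> \<partial>lam) = emeasure \<nu> ?B" by (rule \<nu>_eq[symmetric]) measurable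
    also have "\<dots> < \<infinity>" by (rule levy_measure_outside_finite[OF levy]) simp
    finally have "AE \<xi> in lam. ?F \<xi> \<noteq> \<infinity>" by (intro nn_integral_PInf_AE) simp_all
    thus ?thesis using AE_space
    proof eventually_elim
      case (elim \<xi>)
      note [measurable_cong] = W_sets[OF elim(2)]
      define \<kappa> where "\<kappa> = ennreal (g \<xi> 1) * emeasure (W \<xi>) {1}"
      have \<xi>: "norm \<xi> = 1" using elim(2) lam_space by simp
      have "\<kappa> * emeasure lborel {1::real..} = (\<integral>\<^sup>+r. \<kappa> * indicator {1::real..} r \<partial>lborel)"
        by (rule nn_integral_cmult_indicator[symmetric]) simp
      also have "\<dots> \<le> ?F \<xi>"
      proof (rule nn_integral_mono)
        fix r :: real
        show "\<kappa> * indicator {1..} r \<le> ennreal (indicator {0<..} r * g \<xi> (r ^ p)) * indicator ?B (r *\<^sub>R \<xi>)"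
        proof (cases "1 \<le> r")
          case True
          have "\<kappa> \<le> ennreal (g \<xi> 1) * (\<integral>\<^sup>+t. ennreal (t powr (r ^ p - 1)) \<partial>W \<xi>)"
            unfolding \<kappa>_def unit_interval_split_one[OF W_sets[OF elim(2)]] by (intro mult_left_mono add_increasing) simp_all
          also have "\<dots> = ennreal (g \<xi> (r ^ p))" using True by (intro bernstein[symmetric] elim(2)) simp
          finally show ?thesis using True \<xi> by simp
        qed simp
      qed
      also have "\<dots> < \<infinity>" using elim(1) by (simp add: less_top)
      finally have "\<kappa> * emeasure lborel {1::real..} < \<infinity>" .
      moreover have "emeasure lborel {1::real..} = \<infinity>"
      proof -
        have "ennreal (real n) \<le> emeasure lborel {1::real..}" for n
        proof -
          have "ennreal (real n) = emeasure lborel {1..1 + real n}" by simp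
          also have "\<dots> \<le> emeasure lborel {1::real..}" by (rule emeasure_mono) auto
          finally show ?thesis .
        qed
        thus ?thesis using ennreal_Ex_less_of_nat[of "emeasure lborel {1::real..}"]
          by (metis ennreal_of_nat_eq_real_of_nat infinity_ennreal_def less_top not_less)
      qed
      ultimately show ?case unfolding \<kappa>_def[symmetric] by (auto simp: ennreal_mult_less_top)
    qed
  qed
  have "\<nu> = radial_mix (laplace_kernel p w) \<rho>"
  proof (rule measure_eqI)
    show "sets \<nu> = sets (radial_mix (laplace_kernel p w) \<rho>)" by (simp add: levy_measure_sets[OF levy])
    fix B assume "B \<in> sets \<nu>"
    hence [measurable]: "B \<in> sets borel" by (simp add: levy_measure_sets[OF levy])
    define f where "f x = indicator (- {0}) x * (\<integral>\<^sup>+r. ennreal (laplace_kernel p w r (norm x)) * indicator B (r *\<^sub>R (x /\<^sub>R norm x)) \<partial>lborel)" for x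
    have [measurable]: "f \<in> borel_measurable borel" unfolding f_def by measurable
    have "emeasure (radial_mix (laplace_kernel p w) \<rho>) B = (\<integral>\<^sup>+x. f x \<partial>\<rho>)"
      unfolding f_def by (rule emeasure_radial_mix) (simp_all add: \<rho>_sets measurable_laplace_kernel)
    also have "\<dots> = (\<integral>\<^sup>+\<xi>. ennreal (g \<xi> 1) * (\<integral>\<^sup>+t. h ((- 1 / ln t) *\<^sub>R \<xi>) * f ((- 1 / ln t) *\<^sub>R \<xi>) \<partial>W \<xi>) \<partial>lam)"
      by (rule nn_\<rho>) measurable
    also have "\<dots> = (\<integral>\<^sup>+\<xi>. \<integral>\<^sup>+r. ennreal (indicator {0<..} r * g \<xi> (r ^ p)) * indicator B (r *\<^sub>R \<xi>) \<partial>lborel \<partial>lam)"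
    proof (rule nn_integral_cong_AE)
      show "AE \<xi> in lam. ennreal (g \<xi> 1) * (\<integral>\<^sup>+t. h ((- 1 / ln t) *\<^sub>R \<xi>) * f ((- 1 / ln t) *\<^sub>R \<xi>) \<partial>W \<xi>) =
          (\<integral>\<^sup>+r. ennreal (indicator {0<..} r * g \<xi> (r ^ p)) * indicator B (r *\<^sub>R \<xi>) \<partial>lborel)"
        using atom AE_space
      proof eventually_elim
        case (elim \<xi>)
        note [measurable_cong] = W_sets[OF elim(2)]
        interpret W: prob_space "W \<xi>" using W[OF elim(2)] by simp
        interpret WL: pair_sigma_finite "W \<xi>" lborel ..
        have \<xi>: "norm \<xi> = 1" using elim(2) lam_space by simp
        let ?e = "\<lambda>t r. ennreal (t powr (r ^ p - 1)) * indicator (- {1}) t * (indicator {0<..} r * indicator B (r *\<^sub>R \<xi>))"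
        have e_meas: "(\<lambda>(t, r). ?e t r) \<in> borel_measurable (W \<xi> \<Otimes>\<^sub>M lborel)"
          unfolding measurable_cong_sets[OF sets_pair_measure_cong[OF W_sets[OF elim(2)] sets_lborel] refl] split_beta
          by measurable
        have "(\<integral>\<^sup>+t. h ((- 1 / ln t) *\<^sub>R \<xi>) * f ((- 1 / ln t) *\<^sub>R \<xi>) \<partial>W \<xi>) = (\<integral>\<^sup>+t. \<integral>\<^sup>+r. ?e t r \<partial>lborel \<partial>W \<xi>)"
        proof (rule nn_integral_cong_AE, rule eventually_mono[OF W_unit[OF elim(2)]])
          fix t :: real assume t: "t \<in> {0..1}"
          show "h ((- 1 / ln t) *\<^sub>R \<xi>) * f ((- 1 / ln t) *\<^sub>R \<xi>) = (\<integral>\<^sup>+r. ?e t r \<partial>lborel)"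
          \<comment> \<open>At both endpoints \<open>ln t = 0\<close>, so division by zero sends the
            point to the origin, where \<open>h\<close> vanishes. The right-hand side vanishes too,
            by \<open>0 powr a = 0\<close> and by the indicator of \<open>- {1}\<close>.\<close>
          proof (cases "t = 0 \<or> t = 1")
            case True
            thus ?thesis by (auto simp: h_def)
          next
            case False
            hence t01: "0 < t" "t < 1" using t by auto
            define s where "s = - 1 / ln t"
            have s: "s > 0" using t01 by (simp add: s_def divide_neg_neg)
            have ln_s: "ln t = - 1 / s" using t01 by (simp add: s_def)
            have "norm (s *\<^sub>R \<xi>) = s" "(s *\<^sub>R \<xi>) /\<^sub>R norm (s *\<^sub>R \<xi>) = \<xi>" "s *\<^sub>R \<xi> \<noteq> 0"
              using \<xi> s by auto
            hence "h (s *\<^sub>R \<xi>) * f (s *\<^sub>R \<xi>) = ennreal (exp (1 / s) / w s) * (\<integral>\<^sup>+r. ennreal (laplace_kernel p w r s) * indicator B (r *\<^sub>R \<xi>) \<partial>lborel)"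
              by (simp only: h_def f_def) simp
            also have "\<dots> = (\<integral>\<^sup>+r. ennreal (exp (1 / s) / w s) * (ennreal (laplace_kernel p w r s) * indicator B (r *\<^sub>R \<xi>)) \<partial>lborel)"
              by (rule nn_integral_cmult[symmetric]) measurable
            also have "\<dots> = (\<integral>\<^sup>+r. ?e t r \<partial>lborel)"
            proof (rule nn_integral_cong)
              fix r :: real
              show "ennreal (exp (1 / s) / w s) * (ennreal (laplace_kernel p w r s) * indicator B (r *\<^sub>R \<xi>)) = ?e t r"
              proof (cases "r > 0")
                case True
                have "exp (1 / s) / w s * laplace_kernel p w r s = t powr (r ^ p - 1)"
                  using True s t01 w_pos[OF s] by (simp add: laplace_kernel_def powr_def ln_s exp_add[symmetric] diff_divide_distrib)
                moreover have "exp (1 / s) / w s \<ge> 0" using w_pos[OF s] by simp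
                ultimately show ?thesis using True t01 by (simp add: ennreal_mult'[symmetric] flip: mult.assoc)
              qed (simp add: laplace_kernel_def)
            qed
            finally show ?thesis by (simp add: s_def)
          qed
        qed
        also have "\<dots> = (\<integral>\<^sup>+r. \<integral>\<^sup>+t. ?e t r \<partial>W \<xi> \<partial>lborel)"
          using WL.Fubini'[OF e_meas] by simp
        finally have "ennreal (g \<xi> 1) * (\<integral>\<^sup>+t. h ((- 1 / ln t) *\<^sub>R \<xi>) * f ((- 1 / ln t) *\<^sub>R \<xi>) \<partial>W \<xi>) = ennreal (g \<xi> 1) * (\<integral>\<^sup>+r. \<integral>\<^sup>+t. ?e t r \<partial>W \<xi> \<partial>lborel)"
          by simp
        also have "\<dots> = (\<integral>\<^sup>+r. ennreal (g \<xi> 1) * (\<integral>\<^sup>+t. ?e t r \<partial>W \<xi>) \<partial>lborel)"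
          using W.borel_measurable_nn_integral_fst[OF measurable_pair_swap[OF e_meas]]
          by (subst nn_integral_cmult) simp_all
        also have "\<dots> = (\<integral>\<^sup>+r. ennreal (indicator {0<..} r * g \<xi> (r ^ p)) * indicator B (r *\<^sub>R \<xi>) \<partial>lborel)"
        proof (rule nn_integral_cong)
          fix r :: real
          show "ennreal (g \<xi> 1) * (\<integral>\<^sup>+t. ?e t r \<partial>W \<xi>) = ennreal (indicator {0<..} r * g \<xi> (r ^ p)) * indicator B (r *\<^sub>R \<xi>)"
          proof (cases "r > 0 \<and> r *\<^sub>R \<xi> \<in> B")
            case True
            hence "(\<integral>\<^sup>+t. ?e t r \<partial>W \<xi>) = (\<integral>\<^sup>+t. ennreal (t powr (r ^ p - 1)) * indicator (- {1}) t \<partial>W \<xi>)" by simp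
            moreover have "ennreal (g \<xi> (r ^ p)) = ennreal (g \<xi> 1) * (\<integral>\<^sup>+t. ennreal (t powr (r ^ p - 1)) * indicator (- {1}) t \<partial>W \<xi>)
                 + ennreal (g \<xi> 1) * emeasure (W \<xi>) {1}"
              unfolding distrib_left[symmetric] unit_interval_split_one[OF W_sets[OF elim(2)], symmetric]
              using True by (intro bernstein elim(2)) simp
            ultimately show ?thesis using True elim(1) by simp
          qed auto
        qed
        finally show ?case .
      qed
    qed
    also have "\<dots> = emeasure \<nu> B" by (rule \<nu>_eq[symmetric]) measurable
    finally show "emeasure \<nu> B = emeasure (radial_mix (laplace_kernel p w) \<rho>) B" ..
  qed
  thus ?thesis using \<rho>_sets \<rho>_zero by blast
qed

section \<open>From mixtures to completely monotone radial densities\<close>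

text \<open>Used with \<open>a = 1 / s\<close>: one factor \<open>max 1 a\<close> comes from the
  assumed bound on \<open>w\<close>, the other from dividing by \<open>min 1 s\<close>.\<close>

lemma exp_weight_bound:
  fixes a u :: real
  assumes "a > 0" "u > 0"
  shows "(max 1 a)\<^sup>2 * exp (- (u * a)) \<le> 1 + 2 / u\<^sup>2"
proof -
  have "1 + u * a + (u * a)\<^sup>2 / 2 \<le> exp (u * a)"
    using assms by (intro exp_lower_Taylor_quadratic) simp
  hence "(u * a)\<^sup>2 / 2 \<le> exp (u * a)" using mult_pos_pos[OF assms(2,1)] by linarith
  hence "a\<^sup>2 * exp (- (u * a)) \<le> 2 / u\<^sup>2"
    using assms by (simp add: exp_minus field_simps power_mult_distrib)
  moreover have "exp (- (u * a)) \<le> 1" using mult_pos_pos[OF assms(2,1)] by simp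
  moreover have "(max 1 a)\<^sup>2 \<le> 1 + a\<^sup>2" by (simp add: max_def)
  hence "(max 1 a)\<^sup>2 * exp (- (u * a)) \<le> (1 + a\<^sup>2) * exp (- (u * a))" by (intro mult_right_mono) auto
  ultimately show ?thesis by (simp only: distrib_right mult_1)
qed

text \<open>The radial parts are parametrised by \<open>t = s / (1 + s)\<close>, and the weight \<open>min 1 s\<close> makes
  the measure finite while keeping every conditional Laplace transform finite.\<close>
theorem radial_mix_polar_cm:
  fixes \<rho> :: "'a::euclidean_space measure"
  assumes levy: "levy_measure1 \<rho>" and wm [measurable]: "w \<in> borel_measurable borel"
    and w_pos: "\<And>s. s > 0 \<Longrightarrow> w s > 0" and w_bound: "\<And>s. s > 0 \<Longrightarrow> w s \<le> C * max 1 (1 / s)"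
  shows "\<exists>lam g. polar_cm p (radial_mix (laplace_kernel p w) \<rho>) lam g"
proof -
  define X where "X = restrict_space borel (sphere (0::'a) 1)"
  have X_space: "space X = sphere 0 1" by (simp add: X_def space_restrict_space)
  have levy0: "levy_measure \<rho>" using levy by (simp add: levy_measure1_def)
  note \<rho>_sets [measurable_cong] = levy_measure_sets[OF levy0]
  \<comment> \<open>An arbitrary direction for the origin, which has no mass, so that
    \<open>dir\<close> maps everything into the sphere.\<close>
  define e where "e = (SOME b. b \<in> (Basis :: 'a set))"
  have e: "norm e = 1" unfolding e_def using SOME_Basis by simp
  define dir where "dir x = (if x = 0 then e else x /\<^sub>R norm x)" for x :: 'a
  have dir [measurable]: "dir \<in> borel \<rightarrow>\<^sub>M X"
    unfolding X_def
  proof (rule measurable_restrict_space2)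
    show "dir \<in> borel_measurable borel" unfolding dir_def by measurable
    show "dir \<in> space borel \<rightarrow> sphere 0 1" using e by (auto simp: dir_def)
  qed
  have id_meas: "(\<lambda>\<xi>. \<xi>) \<in> X \<rightarrow>\<^sub>M borel"
    unfolding X_def by (rule measurable_restrict_space1) simp
  define T where "T x = (dir x, norm x / (1 + norm x))" for x :: 'a
  have T [measurable]: "T \<in> borel \<rightarrow>\<^sub>M X \<Otimes>\<^sub>M borel" unfolding T_def by measurable
  define \<rho>' where "\<rho>' = density \<rho> (\<lambda>x. ennreal (min 1 (norm x)))"
  have \<rho>'_sets [measurable_cong]: "sets \<rho>' = sets borel" by (simp add: \<rho>'_def \<rho>_sets)
  have \<rho>'_fin: "finite_measure \<rho>'"
  proof (rule finite_measureI)
    have "emeasure \<rho>' (space \<rho>') = (\<integral>\<^sup>+x. ennreal (min 1 (norm x)) * indicator (space \<rho>) x \<partial>\<rho>)"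
      unfolding \<rho>'_def by (subst emeasure_density) simp_all
    also have "\<dots> = (\<integral>\<^sup>+x. ennreal (min 1 (norm x)) \<partial>\<rho>)" by (intro nn_integral_cong) simp
    finally show "emeasure \<rho>' (space \<rho>') \<noteq> \<infinity>" using levy by (simp add: levy_measure1_def less_top)
  qed
  define M where "M = distr \<rho>' (X \<Otimes>\<^sub>M borel) T"
  interpret D: disintegration M X
  proof (rule disintegration.intro)
    show "finite_measure M" unfolding M_def by (rule finite_measure.finite_measure_distr[OF \<rho>'_fin]) measurable
    show "sets M = sets (X \<Otimes>\<^sub>M borel)" by (simp add: M_def)
    have "AE x in \<rho>'. x \<noteq> 0" unfolding \<rho>'_def
      by (subst AE_density) (use levy_measure_AE_nonzero[OF levy0] in \<open>auto elim!: eventually_mono\<close>)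
    hence "AE x in \<rho>'. snd (T x) \<in> {0<..<1}"
      by eventually_elim (auto simp: T_def add_nonneg_pos divide_less_eq)
    thus "AE p in M. snd p \<in> {0<..<1}" unfolding M_def by (subst AE_distr_iff) simp_all
    have "e \<in> space X" using e by (simp add: X_space)
    thus "space X \<noteq> {}" by blast
  qed
  \<comment> \<open>In terms of \<open>s = t / (1 - t)\<close>: \<open>c\<close> is
    \<open>w s\<close> divided by the weight \<open>min 1 s\<close> used in \<open>\<rho>'\<close>,
    and \<open>v\<close> is \<open>1 / s\<close>. Thus \<open>c t * exp (- (u * v t))\<close> is the
    kernel at \<open>u = r ^ p\<close> relative to the weighted measure.\<close>
  define c :: "real \<Rightarrow> real" where "c t = (if 0 < t \<and> t < 1 then w (t / (1 - t)) / min 1 (t / (1 - t)) else 0)" for t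
  define v :: "real \<Rightarrow> real" where "v t = (if 0 < t \<and> t < 1 then (1 - t) / t else 0)" for t
  have [measurable]: "c \<in> borel_measurable borel" "v \<in> borel_measurable borel"
    unfolding c_def v_def by measurable
  have c_nonneg: "0 \<le> c t" and v_nonneg: "0 \<le> v t" for t
    using w_pos[of "t / (1 - t)"] by (auto simp: c_def v_def)
  have c_pos: "0 < c t" if "0 < t" "t < 1" for t
    using w_pos[of "t / (1 - t)"] that by (simp add: c_def)
  have C: "C \<ge> 0" using w_pos[of 1] w_bound[of 1] by simp
  have c_bound: "c t * exp (- (u * v t)) \<le> C * (1 + 2 / u\<^sup>2)" if u: "u > 0" for t u
  proof (cases "0 < t \<and> t < 1")
    case True
    define s where "s = t / (1 - t)"
    have s: "s > 0" "v t = 1 / s" "c t = w s / min 1 s" using True by (auto simp: s_def c_def v_def)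
    have "1 / min 1 s = max 1 (1 / s)" using s(1) by (simp add: min_def max_def divide_le_eq)
    hence "c t = w s * max 1 (1 / s)" unfolding s(3) by (metis times_divide_eq_right mult.right_neutral)
    also have "\<dots> \<le> C * max 1 (1 / s) * max 1 (1 / s)" by (intro mult_right_mono w_bound s) simp
    finally have "c t * exp (- (u * v t)) \<le> C * (max 1 (1 / s))\<^sup>2 * exp (- (u * (1 / s)))"
      unfolding s(2) by (intro mult_right_mono) (simp_all add: power2_eq_square mult.assoc)
    also have "\<dots> \<le> C * (1 + 2 / u\<^sup>2)"
      using exp_weight_bound[of "1 / s" u] s(1) u C by (simp only: mult.assoc mult_left_mono zero_less_divide_1_iff)
    finally show ?thesis .
  next
    case False
    show ?thesis unfolding c_def if_not_P[OF False] using C u by simp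
  qed
  define g where "g \<xi> u = enn2real (\<integral>\<^sup>+t. ennreal (c t * exp (- (u * v t))) \<partial>D.K \<xi>)" for \<xi> u
  have K_sets [measurable_cong]: "\<And>\<xi>. \<xi> \<in> space X \<Longrightarrow> sets (D.K \<xi>) = sets borel"
    by (rule prob_algebra_sets[OF D.measurable_K])
  have K_prob: "\<And>\<xi>. \<xi> \<in> space X \<Longrightarrow> prob_space (D.K \<xi>)"
    by (rule prob_algebra_prob[OF D.measurable_K])
  have int: "integrable (D.K \<xi>) (\<lambda>t. c t * exp (- (u * v t)))" if "\<xi> \<in> space X" "u > 0" for \<xi> u
  proof -
    interpret prob_space "D.K \<xi>" by (rule K_prob[OF that(1)])
    note [measurable_cong] = K_sets[OF that(1)]
    show ?thesis
      by (rule integrable_const_bound[where B="C * (1 + 2 / u\<^sup>2)"])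
         (use c_bound[OF that(2)] c_nonneg in \<open>simp_all add: abs_mult\<close>)
  qed
  have g_int: "g \<xi> u = (\<integral>t. c t * exp (- (u * v t)) \<partial>D.K \<xi>)" if "\<xi> \<in> space X" for \<xi> u
  proof -
    note [measurable_cong] = K_sets[OF that]
    show ?thesis unfolding g_def
      by (rule integral_eq_nn_integral[symmetric]) (simp_all add: c_nonneg)
  qed
  have g_nn: "ennreal (g \<xi> u) = (\<integral>\<^sup>+t. ennreal (c t * exp (- (u * v t))) \<partial>D.K \<xi>)" if "\<xi> \<in> space X" "u > 0" for \<xi> u
    unfolding g_int[OF that(1)] by (rule nn_integral_eq_integral[symmetric]) (simp_all add: int that c_nonneg)
  have cm: "completely_monotone (g \<xi>)" if "\<xi> \<in> space X" for \<xi>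
  proof -
    note [measurable_cong] = K_sets[OF that]
    have "completely_monotone (\<lambda>u. \<integral>t. c t * exp (- (u * v t)) \<partial>D.K \<xi>)"
      by (rule laplace_completely_monotone) (simp_all add: int that c_nonneg v_nonneg)
    thus ?thesis using g_int[OF that] by presburger
  qed
  \<comment> \<open>A polar decomposition demands positive radial mass in every direction. It holds
    because \<open>D.K \<xi>\<close> lives on the open interval, where \<open>c\<close> is
    positive.\<close>
  have g_pos: "g \<xi> u > 0" if "\<xi> \<in> space X" "u > 0" for \<xi> u
  proof (rule ccontr)
    interpret prob_space "D.K \<xi>" by (rule K_prob[OF that(1)])
    note [measurable_cong] = K_sets[OF that(1)]
    assume "\<not> g \<xi> u > 0"
    hence "(\<integral>\<^sup>+t. ennreal (c t * exp (- (u * v t))) \<partial>D.K \<xi>) = 0"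
      using g_nn[OF that] by (metis ennreal_neg not_less)
    hence "AE t in D.K \<xi>. ennreal (c t * exp (- (u * v t))) = 0" by (subst (asm) nn_integral_0_iff_AE) simp_all
    with D.AE_K[of \<xi>] have "AE t in D.K \<xi>. False"
    proof eventually_elim
      case (elim t)
      hence "0 < c t * exp (- (u * v t))" using c_pos[of t] by simp
      with elim(2) show ?case by simp
    qed
    thus False by simp
  qed
  have K_kernel [measurable]: "D.K \<in> X \<rightarrow>\<^sub>M subprob_algebra borel"
    by (rule measurable_prob_algebraD[OF D.measurable_K])
  have g_joint [measurable]: "(\<lambda>q. g (fst q) (snd q)) \<in> borel_measurable (X \<Otimes>\<^sub>M borel)"
  proof -
    have "(\<lambda>q. \<integral>\<^sup>+t. ennreal (c t * exp (- (snd q * v t))) \<partial>D.K (fst q)) \<in> borel_measurable (X \<Otimes>\<^sub>M borel)"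
      by (rule nn_integral_measurable_subprob_algebra2[where N=borel]) measurable
    thus ?thesis unfolding g_def by measurable
  qed
  let ?mix = "radial_mix (laplace_kernel p w) \<rho>"
  let ?nx = "\<lambda>\<xi>. density lborel (\<lambda>r. ennreal (indicator {0<..} r * g \<xi> (r ^ p)))"
  have [measurable]: "(\<lambda>q. g (fst q) (snd q ^ p)) \<in> borel_measurable (X \<Otimes>\<^sub>M borel)"
    using measurable_compose[OF _ g_joint, of "\<lambda>q. (fst q, snd q ^ p)" "X \<Otimes>\<^sub>M borel"] by simp
  have g_slice: "(\<lambda>r. g \<xi> (r ^ p)) \<in> borel_measurable borel" if "\<xi> \<in> space X" for \<xi>
    using measurable_compose[OF _ g_joint, of "\<lambda>r. (\<xi>, r ^ p)" borel] that by simp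
  have main: "emeasure ?mix B = (\<integral>\<^sup>+\<xi>. (\<integral>\<^sup>+r. indicator B (r *\<^sub>R \<xi>) \<partial>?nx \<xi>) \<partial>D.lam)" if [measurable]: "B \<in> sets borel" for B
  proof -
    define H where "H q = (\<integral>\<^sup>+r. indicator {0<..} r * ennreal (c (snd q) * exp (- (r ^ p * v (snd q)))) * indicator B (r *\<^sub>R fst q) \<partial>lborel)" for q
    have [measurable]: "(\<lambda>q. snd q *\<^sub>R fst (fst q)) \<in> borel_measurable ((X \<Otimes>\<^sub>M borel) \<Otimes>\<^sub>M borel)"
    proof -
      have "(\<lambda>q. fst (fst q)) \<in> (X \<Otimes>\<^sub>M borel) \<Otimes>\<^sub>M (borel :: real measure) \<rightarrow>\<^sub>M borel"
        by (rule measurable_compose[OF _ id_meas]) measurable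
      thus ?thesis by measurable
    qed
    have H [measurable]: "H \<in> borel_measurable (X \<Otimes>\<^sub>M borel)" unfolding H_def by measurable
    have "emeasure ?mix B = (\<integral>\<^sup>+x. indicator (- {0}) x * (\<integral>\<^sup>+r. ennreal (laplace_kernel p w r (norm x)) * indicator B (r *\<^sub>R (x /\<^sub>R norm x)) \<partial>lborel) \<partial>\<rho>)"
      by (rule emeasure_radial_mix) (simp_all add: \<rho>_sets measurable_laplace_kernel)
    also have "\<dots> = (\<integral>\<^sup>+x. ennreal (min 1 (norm x)) * H (T x) \<partial>\<rho>)"
    proof (rule nn_integral_cong)
      fix x :: 'a
      show "indicator (- {0}) x * (\<integral>\<^sup>+r. ennreal (laplace_kernel p w r (norm x)) * indicator B (r *\<^sub>R (x /\<^sub>R norm x)) \<partial>lborel) = ennreal (min 1 (norm x)) * H (T x)"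
      proof (cases "x = 0")
        case False
        define s where "s = norm x"
        have s: "s > 0" using False by (simp add: s_def)
        define t where "t = s / (1 + s)"
        have t: "0 < t" "t < 1" using s by (simp_all add: t_def divide_less_eq)
        have "1 - t = 1 / (1 + s)" using s by (simp add: t_def field_simps)
        hence st: "t / (1 - t) = s" "(1 - t) / t = 1 / s" using s by (simp_all add: t_def)
        have ct: "c t = w s / min 1 s" "v t = 1 / s" using t st by (simp_all add: c_def v_def)
        have "ennreal (min 1 (norm x)) * H (T x) = ennreal (min 1 s) * (\<integral>\<^sup>+r. indicator {0<..} r * ennreal (c t * exp (- (r ^ p * v t))) * indicator B (r *\<^sub>R (x /\<^sub>R norm x)) \<partial>lborel)"
          using False by (simp add: H_def T_def dir_def s_def t_def)
        also have "\<dots> = (\<integral>\<^sup>+r. ennreal (min 1 s) * (indicator {0<..} r * ennreal (c t * exp (- (r ^ p * v t))) * indicator B (r *\<^sub>R (x /\<^sub>R norm x))) \<partial>lborel)"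
          by (rule nn_integral_cmult[symmetric]) measurable
        also have "\<dots> = (\<integral>\<^sup>+r. ennreal (laplace_kernel p w r (norm x)) * indicator B (r *\<^sub>R (x /\<^sub>R norm x)) \<partial>lborel)"
        proof (rule nn_integral_cong)
          fix r :: real
          have "min 1 s * (c t * exp (- (r ^ p * v t))) = w s * exp (- (r ^ p / s))"
            using s by (simp add: ct)
          hence "ennreal (min 1 s) * ennreal (c t * exp (- (r ^ p * v t))) = ennreal (w s * exp (- (r ^ p / s)))"
            using s by (subst ennreal_mult'[symmetric]) simp_all
          thus "ennreal (min 1 s) * (indicator {0<..} r * ennreal (c t * exp (- (r ^ p * v t))) * indicator B (r *\<^sub>R (x /\<^sub>R norm x))) =
             ennreal (laplace_kernel p w r (norm x)) * indicator B (r *\<^sub>R (x /\<^sub>R norm x))"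
            using s by (simp add: laplace_kernel_def s_def indicator_def)
        qed
        finally show ?thesis using False by simp
      qed simp
    qed
    also have "\<dots> = (\<integral>\<^sup>+q. H q \<partial>M)"
      unfolding M_def \<rho>'_def by (subst nn_integral_distr, measurable, subst nn_integral_density) measurable
    also have "\<dots> = (\<integral>\<^sup>+\<xi>. \<integral>\<^sup>+t. H (\<xi>, t) \<partial>D.K \<xi> \<partial>D.lam)" by (rule D.nn_integral_M[OF H])
    also have "\<dots> = (\<integral>\<^sup>+\<xi>. (\<integral>\<^sup>+r. indicator B (r *\<^sub>R \<xi>) \<partial>?nx \<xi>) \<partial>D.lam)"
    proof (rule nn_integral_cong)
      fix \<xi> assume "\<xi> \<in> space D.lam"
      hence \<xi>: "\<xi> \<in> space X" by simp
      interpret K: prob_space "D.K \<xi>" by (rule K_prob[OF \<xi>])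
      interpret KL: pair_sigma_finite "D.K \<xi>" lborel ..
      note [measurable_cong] = K_sets[OF \<xi>] and [measurable] = g_slice[OF \<xi>]
      have "(\<integral>\<^sup>+t. H (\<xi>, t) \<partial>D.K \<xi>) = (\<integral>\<^sup>+r. \<integral>\<^sup>+t. indicator {0<..} r * ennreal (c t * exp (- (r ^ p * v t))) * indicator B (r *\<^sub>R \<xi>) \<partial>D.K \<xi> \<partial>lborel)"
        unfolding H_def fst_conv snd_conv by (rule KL.Fubini'[symmetric]) measurable
      also have "\<dots> = (\<integral>\<^sup>+r. ennreal (indicator {0<..} r * g \<xi> (r ^ p)) * indicator B (r *\<^sub>R \<xi>) \<partial>lborel)"
      proof (rule nn_integral_cong)
        fix r :: real
        show "(\<integral>\<^sup>+t. indicator {0<..} r * ennreal (c t * exp (- (r ^ p * v t))) * indicator B (r *\<^sub>R \<xi>) \<partial>D.K \<xi>) = ennreal (indicator {0<..} r * g \<xi> (r ^ p)) * indicator B (r *\<^sub>R \<xi>)"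
        proof (cases "r > 0 \<and> r *\<^sub>R \<xi> \<in> B")
          case True
          thus ?thesis using g_nn[OF \<xi>, of "r ^ p"] by simp
        qed auto
      qed
      also have "\<dots> = (\<integral>\<^sup>+r. indicator B (r *\<^sub>R \<xi>) \<partial>?nx \<xi>)"
        by (rule nn_integral_density[symmetric]) measurable
      finally show "(\<integral>\<^sup>+t. H (\<xi>, t) \<partial>D.K \<xi>) = (\<integral>\<^sup>+r. indicator B (r *\<^sub>R \<xi>) \<partial>?nx \<xi>)" .
    qed
    finally show ?thesis .
  qed
  have polar: "polar_decomposition ?mix D.lam ?nx"
    unfolding polar_decomposition_def
  proof (intro conjI ballI)
    show "sets D.lam = sets (restrict_space borel (sphere 0 1))" using D.sets_lam unfolding X_def .
    fix \<xi> :: 'a assume "\<xi> \<in> sphere 0 1"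
    hence \<xi>: "\<xi> \<in> space X" by (simp add: X_space)
    note gm [measurable] = g_slice[OF \<xi>]
    show "sets (?nx \<xi>) = sets borel" by simp
    have "emeasure (?nx \<xi>) {..0} = (\<integral>\<^sup>+r. ennreal (indicator {0<..} r * g \<xi> (r ^ p)) * indicator {..0} r \<partial>lborel)"
      by (rule emeasure_density) measurable
    also have "\<dots> = (\<integral>\<^sup>+r. 0 \<partial>(lborel :: real measure))" by (intro nn_integral_cong) (auto simp: indicator_def)
    finally show "emeasure (?nx \<xi>) {..0} = 0" by simp
    \<comment> \<open>Since \<open>g \<xi>\<close> is antitone, the radial density is at least
      \<open>g \<xi> 1\<close> on \<open>{0<..1}\<close>.\<close>
    have "0 < ennreal (g \<xi> 1) * emeasure lborel {0<..1::real}"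
      using g_pos[OF \<xi>, of 1] by simp
    also have "\<dots> = (\<integral>\<^sup>+r. ennreal (g \<xi> 1) * indicator {0<..1::real} r \<partial>lborel)"
      by (rule nn_integral_cmult_indicator[symmetric]) simp
    also have "\<dots> \<le> (\<integral>\<^sup>+r. ennreal (indicator {0<..} r * g \<xi> (r ^ p)) * indicator {0<..} r \<partial>lborel)"
    proof (rule nn_integral_mono)
      fix r :: real
      have "g \<xi> 1 \<le> g \<xi> (r ^ p)" if "0 < r" "r \<le> 1"
        using that by (intro completely_monotone_antimono[OF cm[OF \<xi>]]) (auto simp: power_le_one)
      thus "ennreal (g \<xi> 1) * indicator {0<..1} r \<le> ennreal (indicator {0<..} r * g \<xi> (r ^ p)) * indicator {0<..} r"
        by (auto simp: indicator_def ennreal_leI)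
    qed
    also have "\<dots> = emeasure (?nx \<xi>) {0<..}" by (rule emeasure_density[symmetric]) measurable
    finally show "0 < emeasure (?nx \<xi>) {0<..}" .
  next
    fix E :: "real set" assume [measurable]: "E \<in> sets borel"
    have int_meas: "(\<lambda>\<xi>. \<integral>\<^sup>+r. ennreal (indicator {0<..} r * g \<xi> (r ^ p)) * indicator E r \<partial>lborel) \<in> borel_measurable X"
      by measurable
    have eq: "emeasure (?nx \<xi>) E = (\<integral>\<^sup>+r. ennreal (indicator {0<..} r * g \<xi> (r ^ p)) * indicator E r \<partial>lborel)" if "\<xi> \<in> space X" for \<xi>
    proof -
      note [measurable] = g_slice[OF that]
      show ?thesis by (rule emeasure_density) measurable
    qed
    have "(\<lambda>\<xi>. emeasure (?nx \<xi>) E) \<in> borel_measurable X"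
      by (rule measurable_cong[THEN iffD2, OF eq int_meas])
    thus "(\<lambda>\<xi>. emeasure (?nx \<xi>) E) \<in> borel_measurable D.lam" by simp
  qed (rule main)
  have "(\<lambda>q. g (fst q) (snd q)) \<in> borel_measurable (D.lam \<Otimes>\<^sub>M restrict_space borel {0<..})"
  proof -
    have id0: "(\<lambda>u. u) \<in> restrict_space borel {0<..} \<rightarrow>\<^sub>M (borel :: real measure)"
      by (rule measurable_restrict_space1) simp
    have "fst \<in> D.lam \<Otimes>\<^sub>M restrict_space (borel :: real measure) {0<..} \<rightarrow>\<^sub>M X"
      using measurable_fst[of D.lam "restrict_space (borel :: real measure) {0<..}"]
      unfolding measurable_cong_sets[OF refl D.sets_lam] .
    hence "(\<lambda>q. (fst q, snd q)) \<in> D.lam \<Otimes>\<^sub>M restrict_space borel {0<..} \<rightarrow>\<^sub>M X \<Otimes>\<^sub>M (borel :: real measure)"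
      by (rule measurable_Pair[OF _ measurable_compose[OF measurable_snd id0]])
    from measurable_compose[OF this g_joint] show ?thesis by simp
  qed
  thus ?thesis using polar cm unfolding polar_cm_def X_space by blast
qed

section \<open>Uniqueness and integrability of the mixing measure\<close>

text \<open>The exponents add up to \<open>r\<^sup>2 * (1 / s + 1)\<close>. Scaling by
  \<open>b = sqrt (s / (1 + s))\<close> reduces the integral to the odd Gaussian moment
  \<open>fact j / 2\<close> and brings out a power of \<open>s / (1 + s)\<close>.\<close>

lemma nn_integral_k_gauss_moment:
  assumes s: "s > 0"
  shows "(\<integral>\<^sup>+r. ennreal (k_gauss r s) * ennreal (r ^ (2 * j + 1) * exp (- r\<^sup>2)) \<partial>lborel) =
    ennreal (fact j / sqrt (pi * s) * (s / (1 + s)) ^ (j + 1))"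
proof -
  define b where "b = sqrt (s / (1 + s))"
  have b: "b > 0" "b\<^sup>2 = s / (1 + s)" using s by (simp_all add: b_def)
  have b': "b\<^sup>2 / s + b\<^sup>2 = 1"
  proof -
    have "b\<^sup>2 / s = 1 / (1 + s)" using s by (simp add: b(2))
    hence "b\<^sup>2 / s + b\<^sup>2 = (1 + s) / (1 + s)" by (simp only: b(2) add_divide_distrib)
    thus ?thesis using s by simp
  qed
  define A where "A = 2 / sqrt (pi * s) * (b\<^sup>2) ^ (j + 1)"
  have A: "A \<ge> 0" using s b by (simp add: A_def)
  let ?f = "\<lambda>r. ennreal (k_gauss r s) * ennreal (r ^ (2 * j + 1) * exp (- r\<^sup>2))"
  let ?m = "\<lambda>y::real. indicator {0..} y *\<^sub>R (exp (- y\<^sup>2) * y ^ (2 * j + 1))"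
  have "(\<integral>\<^sup>+r. ?f r \<partial>lborel) = ennreal \<bar>b\<bar> * (\<integral>\<^sup>+y. ?f (0 + b * y) \<partial>lborel)"
    using b by (intro nn_integral_real_affine) auto
  also have "\<dots> = (\<integral>\<^sup>+y. ennreal \<bar>b\<bar> * ?f (0 + b * y) \<partial>lborel)"
    by (rule nn_integral_cmult[symmetric]) measurable
  also have "\<dots> = (\<integral>\<^sup>+y. ennreal A * ennreal (?m y) \<partial>lborel)"
  proof (rule nn_integral_cong)
    fix y :: real
    show "ennreal \<bar>b\<bar> * ?f (0 + b * y) = ennreal A * ennreal (?m y)"
    proof (cases "y > 0")
      case True
      have "exp (- ((b * y)\<^sup>2 / s)) * exp (- (b * y)\<^sup>2) = exp (- (y\<^sup>2 * (b\<^sup>2 / s + b\<^sup>2)))"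
        by (simp add: exp_add[symmetric] power_mult_distrib distrib_left mult.commute)
      hence e: "exp (- ((b * y)\<^sup>2 / s)) * exp (- (b * y)\<^sup>2) = exp (- y\<^sup>2)" unfolding b' by simp
      have pw: "b * (b * y) ^ (2 * j + 1) = (b\<^sup>2) ^ (j + 1) * y ^ (2 * j + 1)"
        by (simp add: power_mult_distrib power_mult[symmetric] power2_eq_square[symmetric] mult_ac)
      have k: "k_gauss (0 + b * y) s = 2 / sqrt (pi * s) * exp (- ((b * y)\<^sup>2 / s))"
        using True b s by (simp add: laplace_kernel_def)
      have "b * (k_gauss (0 + b * y) s * ((0 + b * y) ^ (2 * j + 1) * exp (- (0 + b * y)\<^sup>2))) =
          2 / sqrt (pi * s) * (exp (- ((b * y)\<^sup>2 / s)) * exp (- (b * y)\<^sup>2)) * (b * (b * y) ^ (2 * j + 1))"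
        unfolding k by (simp only: add_0 mult_ac)
      also have "\<dots> = A * (exp (- y\<^sup>2) * y ^ (2 * j + 1))"
        unfolding e pw A_def by (simp only: mult_ac)
      finally have "b * (k_gauss (0 + b * y) s * ((0 + b * y) ^ (2 * j + 1) * exp (- (0 + b * y)\<^sup>2))) = A * (exp (- y\<^sup>2) * y ^ (2 * j + 1))" .
      thus ?thesis using True b A s
        by (simp add: ennreal_mult'[symmetric] laplace_kernel_def)
    next
      case False
      thus ?thesis using b by (cases "y = 0") (auto simp: laplace_kernel_def indicator_def zero_less_mult_iff)
    qed
  qed
  also have "\<dots> = ennreal A * (\<integral>\<^sup>+y. ennreal (?m y) \<partial>lborel)"
    by (rule nn_integral_cmult) measurable
  also have "(\<integral>\<^sup>+y. ennreal (?m y) \<partial>lborel) = ennreal (fact j / 2)"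
    using gaussian_moment_odd_pos[of j] by (subst nn_integral_eq_integral) (auto simp: has_bochner_integral_iff indicator_def)
  also have "ennreal A * ennreal (fact j / 2) = ennreal (fact j / sqrt (pi * s) * (s / (1 + s)) ^ (j + 1))"
    using A by (subst ennreal_mult'[symmetric]) (simp_all add: A_def b(2) mult_ac)
  finally show ?thesis .
qed

lemma gauss_weight_bound:
  assumes s: "s > 0"
  shows "1 / sqrt s * (s / (1 + s))\<^sup>2 \<le> min 1 s"
proof -
  have "sqrt s * 2 \<le> 1 + s" using sum_squares_ge_zero[of "sqrt s - 1" 0] s by (simp add: algebra_simps)
  hence "sqrt s \<le> 1 + s" using s by (smt (verit) real_sqrt_ge_zero)
  have t: "0 \<le> s / (1 + s)" "s / (1 + s) \<le> 1" "s / (1 + s) \<le> s" using s by (simp_all add: divide_le_eq)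
  have "1 / sqrt s * (s / (1 + s)) = (s / sqrt s) / (1 + s)" by simp
  also have "s / sqrt s = sqrt s" using s by (simp add: real_div_sqrt)
  also have "sqrt s / (1 + s) \<le> 1" using \<open>sqrt s \<le> 1 + s\<close> s by (simp add: divide_le_eq)
  finally have "(1 / sqrt s * (s / (1 + s))) * (s / (1 + s)) \<le> 1 * (s / (1 + s))" by (rule mult_right_mono) (rule t)
  also have "\<dots> \<le> min 1 s" using t by simp
  finally show ?thesis by (simp add: power2_eq_square mult.assoc)
qed

text \<open>Testing against \<open>r ^ (2 j + 1) exp (- r\<^sup>2)\<close> turns the kernel into moments of
  \<open>t = s / (1 + s)\<close> in every cone of directions.\<close>
theorem radial_mix_k_gauss_unique:
  fixes \<rho>1 \<rho>2 :: "'a::euclidean_space measure"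
  assumes levy: "levy_measure1 \<rho>1" "levy_measure1 \<rho>2"
    and eq: "radial_mix k_gauss \<rho>1 = radial_mix k_gauss \<rho>2"
  shows "\<rho>1 = \<rho>2"
proof -
  define dir where "dir x = x /\<^sub>R norm x" for x :: 'a
  define \<tau> where "\<tau> x = norm x / (1 + norm x)" for x :: 'a
  \<comment> \<open>The test with index \<open>j\<close> yields
    \<open>\<tau> x ^ (j + 1) / sqrt (norm x)\<close>. For \<open>j = 0\<close> this is only of
    order \<open>sqrt (norm x)\<close> at the origin; from \<open>j = 1\<close> on the factor
    \<open>\<omega>\<close>, bounded by \<open>min 1 (norm x)\<close>, can be split off. This is why
    \<open>Suc k\<close> appears below.\<close>
  define \<omega> where "\<omega> x = 1 / sqrt (norm x) * (\<tau> x)\<^sup>2" for x :: 'a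
  have [measurable]: "dir \<in> borel_measurable borel" "\<tau> \<in> borel_measurable borel" "\<omega> \<in> borel_measurable borel"
    unfolding dir_def \<tau>_def \<omega>_def by measurable
  have \<tau>01: "\<tau> x \<in> {0..1}" for x
  proof -
    have "1 + norm x > 0" by (simp add: add_pos_nonneg)
    thus ?thesis by (simp add: \<tau>_def divide_le_eq)
  qed
  have \<omega>_nonneg: "0 \<le> \<omega> x" for x by (simp add: \<omega>_def)
  have \<omega>_le: "\<omega> x \<le> min 1 (norm x)" for x
    using gauss_weight_bound[of "norm x"] by (cases "x = 0") (simp_all add: \<omega>_def \<tau>_def)
  \<comment> \<open>The weighted law of \<open>\<tau>\<close> on the cone of directions in
    \<open>E\<close>. Its pure moments can be read off the mixed measure.\<close>
  define L where "L \<rho> E = distr (density \<rho> (\<lambda>x. ennreal (\<omega> x) * indicator E (dir x))) borel \<tau>" for \<rho> :: "'a measure" and E :: "'a set"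
  have levy0: "levy_measure \<rho>1" "levy_measure \<rho>2" using levy by (simp_all add: levy_measure1_def)
  have nnL: "(\<integral>\<^sup>+t. f t \<partial>L \<rho> E) = (\<integral>\<^sup>+x. ennreal (\<omega> x) * indicator E (dir x) * f (\<tau> x) \<partial>\<rho>)"
    if [measurable]: "E \<in> sets borel" "f \<in> borel_measurable borel" and [measurable_cong]: "sets \<rho> = sets borel" for \<rho> E and f :: "real \<Rightarrow> ennreal"
    unfolding L_def by (subst nn_integral_distr, measurable, subst nn_integral_density) measurable
  have unit: "unit_interval_measure (L \<rho> E)" if [measurable]: "E \<in> sets borel" and \<rho>: "levy_measure1 \<rho>" for \<rho> E
    unfolding unit_interval_measure_def
  proof (intro conjI)
    have [measurable_cong]: "sets \<rho> = sets borel" using \<rho> by (simp add: levy_measure1_def levy_measure_def)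
    have "emeasure (L \<rho> E) (space (L \<rho> E)) = (\<integral>\<^sup>+x. ennreal (\<omega> x) * indicator E (dir x) * 1 \<partial>\<rho>)"
      using nnL[of E "\<lambda>_. 1" \<rho>] \<rho> by (simp add: levy_measure1_def levy_measure_def)
    also have "\<dots> \<le> (\<integral>\<^sup>+x. ennreal (min 1 (norm x)) \<partial>\<rho>)"
      by (intro nn_integral_mono) (use \<omega>_le in \<open>auto simp: indicator_def ennreal_leI\<close>)
    also have "\<dots> < \<infinity>" using \<rho> by (simp add: levy_measure1_def)
    finally show "finite_measure (L \<rho> E)" by (intro finite_measureI) simp
    show "sets (L \<rho> E) = sets borel" by (simp add: L_def)
    show "AE t in L \<rho> E. t \<in> {0..1}" unfolding L_def
      by (subst AE_distr_iff) (use \<tau>01 in auto)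
  qed
  have pure: "(\<integral>\<^sup>+t. ennreal (t ^ k) \<partial>L \<rho> E) = ennreal (sqrt pi / fact (Suc k)) *
      (\<integral>\<^sup>+y. indicator E (dir y) * ennreal (norm y ^ (2 * Suc k + 1) * exp (- (norm y)\<^sup>2)) \<partial>radial_mix k_gauss \<rho>)"
    if [measurable]: "E \<in> sets borel" and \<rho>: "levy_measure \<rho>" for \<rho> E k
  proof -
    note \<rho>_sets [measurable_cong] = levy_measure_sets[OF \<rho>]
    let ?c = "sqrt pi / fact (Suc k)"
    let ?f = "\<lambda>y. indicator E (dir y) * ennreal (norm y ^ (2 * Suc k + 1) * exp (- (norm y)\<^sup>2))"
    have "(\<integral>\<^sup>+y. ?f y \<partial>radial_mix k_gauss \<rho>) = (\<integral>\<^sup>+x. indicator (- {0}) x * (\<integral>\<^sup>+r. ennreal (k_gauss r (norm x)) * ?f (r *\<^sub>R (x /\<^sub>R norm x)) \<partial>lborel) \<partial>\<rho>)"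
      by (rule nn_integral_radial_mix[OF \<rho>_sets measurable_k_gauss]) measurable
    also have "\<dots> = (\<integral>\<^sup>+x. indicator (- {0}) x * (indicator E (dir x) * ennreal (fact (Suc k) / sqrt (pi * norm x) * \<tau> x ^ (Suc k + 1))) \<partial>\<rho>)"
    proof (rule nn_integral_cong)
      fix x :: 'a
      show "indicator (- {0}) x * (\<integral>\<^sup>+r. ennreal (k_gauss r (norm x)) * ?f (r *\<^sub>R (x /\<^sub>R norm x)) \<partial>lborel) =
         indicator (- {0}) x * (indicator E (dir x) * ennreal (fact (Suc k) / sqrt (pi * norm x) * \<tau> x ^ (Suc k + 1)))"
      proof (cases "x = 0")
        case False
        have "(\<integral>\<^sup>+r. ennreal (k_gauss r (norm x)) * ?f (r *\<^sub>R (x /\<^sub>R norm x)) \<partial>lborel) =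
          (\<integral>\<^sup>+r. indicator E (dir x) * (ennreal (k_gauss r (norm x)) * ennreal (r ^ (2 * Suc k + 1) * exp (- r\<^sup>2))) \<partial>lborel)"
        proof (rule nn_integral_cong)
          fix r :: real
          show "ennreal (k_gauss r (norm x)) * ?f (r *\<^sub>R (x /\<^sub>R norm x)) = indicator E (dir x) * (ennreal (k_gauss r (norm x)) * ennreal (r ^ (2 * Suc k + 1) * exp (- r\<^sup>2)))"
          proof (cases "r > 0")
            case True
            have n: "norm (r *\<^sub>R (x /\<^sub>R norm x)) = r" using True False by simp
            have "dir (r *\<^sub>R (x /\<^sub>R norm x)) = dir x" unfolding dir_def n using True by simp
            with n show ?thesis by (simp only: mult_ac)
          qed (simp add: laplace_kernel_def)
        qed
        also have "\<dots> = indicator E (dir x) * (\<integral>\<^sup>+r. ennreal (k_gauss r (norm x)) * ennreal (r ^ (2 * Suc k + 1) * exp (- r\<^sup>2)) \<partial>lborel)"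
          by (rule nn_integral_cmult) measurable
        also have "\<dots> = indicator E (dir x) * ennreal (fact (Suc k) / sqrt (pi * norm x) * \<tau> x ^ (Suc k + 1))"
          unfolding \<tau>_def by (subst nn_integral_k_gauss_moment) (use False in simp_all)
        finally show ?thesis by simp
      qed simp
    qed
    finally have "ennreal ?c * (\<integral>\<^sup>+y. ?f y \<partial>radial_mix k_gauss \<rho>) =
      (\<integral>\<^sup>+x. ennreal ?c * (indicator (- {0}) x * (indicator E (dir x) * ennreal (fact (Suc k) / sqrt (pi * norm x) * \<tau> x ^ (Suc k + 1)))) \<partial>\<rho>)"
      by (simp only:) (rule nn_integral_cmult[symmetric], measurable)
    also have "\<dots> = (\<integral>\<^sup>+x. ennreal (\<omega> x) * indicator E (dir x) * ennreal (\<tau> x ^ k) \<partial>\<rho>)"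
    proof (rule nn_integral_cong)
      fix x :: 'a
      show "ennreal ?c * (indicator (- {0}) x * (indicator E (dir x) * ennreal (fact (Suc k) / sqrt (pi * norm x) * \<tau> x ^ (Suc k + 1)))) =
        ennreal (\<omega> x) * indicator E (dir x) * ennreal (\<tau> x ^ k)"
      proof (cases "x = 0")
        case False
        have "?c * (fact (Suc k) / sqrt (pi * norm x) * \<tau> x ^ (Suc k + 1)) = \<omega> x * \<tau> x ^ k"
          by (simp add: \<omega>_def real_sqrt_mult power2_eq_square del: fact_Suc)
        hence "ennreal ?c * ennreal (fact (Suc k) / sqrt (pi * norm x) * \<tau> x ^ (Suc k + 1)) = ennreal (\<omega> x) * ennreal (\<tau> x ^ k)"
          using \<omega>_nonneg[of x] by (subst (1 2) ennreal_mult'[symmetric]) (simp_all del: fact_Suc)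
        thus ?thesis using False by (auto simp: indicator_def simp del: fact_Suc)
      qed (simp add: \<omega>_def)
    qed
    also have "\<dots> = (\<integral>\<^sup>+t. ennreal (t ^ k) \<partial>L \<rho> E)" by (rule nnL[symmetric]) (simp_all add: \<rho>_sets)
    finally show ?thesis ..
  qed
  have L_eq: "L \<rho>1 E = L \<rho>2 E" if E: "E \<in> sets borel" for E
  proof (rule pure_moments_determine[OF unit[OF E levy(1)] unit[OF E levy(2)]])
    fix k
    have "(\<integral>\<^sup>+t. ennreal (t ^ k) \<partial>L \<rho>1 E) = (\<integral>\<^sup>+t. ennreal (t ^ k) \<partial>L \<rho>2 E)"
      using pure[OF E levy0(1)] pure[OF E levy0(2)] eq by simp
    moreover have "0 \<le> (\<integral>t. t ^ k \<partial>L \<rho> E)" if "levy_measure1 \<rho>" for \<rho>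
      using unit[OF E that] by (intro integral_nonneg_AE) (auto simp: unit_interval_measure_def elim!: eventually_mono)
    ultimately show "(\<integral>t. t ^ k \<partial>L \<rho>1 E) = (\<integral>t. t ^ k \<partial>L \<rho>2 E)"
      using levy unit[OF E] by (simp add: nn_integral_power_unit)
  qed
  define N where "N \<rho> = density \<rho> (\<lambda>x. ennreal (\<omega> x))" for \<rho> :: "'a measure"
  define J where "J \<rho> = distr (N \<rho>) (borel \<Otimes>\<^sub>M borel) (\<lambda>x. (dir x, \<tau> x))" for \<rho> :: "'a measure"
  have N_sets [measurable_cong]: "sets (N \<rho>1) = sets borel" "sets (N \<rho>2) = sets borel"
    using levy0 by (simp_all add: N_def levy_measure_sets)
  have J_rect: "emeasure (J \<rho>) (E \<times> A) = emeasure (L \<rho> E) A"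
    if [measurable]: "E \<in> sets borel" "A \<in> sets borel" and \<rho>[measurable_cong]: "sets \<rho> = sets borel" for \<rho> E A
  proof -
    have "emeasure (J \<rho>) (E \<times> A) = (\<integral>\<^sup>+q. indicator (E \<times> A) q \<partial>J \<rho>)"
      by (rule nn_integral_indicator[symmetric]) (simp add: J_def)
    also have "\<dots> = (\<integral>\<^sup>+x. ennreal (\<omega> x) * indicator (E \<times> A) (dir x, \<tau> x) \<partial>\<rho>)"
      unfolding J_def N_def by (subst nn_integral_distr, measurable, subst nn_integral_density) measurable
    also have "\<dots> = (\<integral>\<^sup>+x. ennreal (\<omega> x) * indicator E (dir x) * indicator A (\<tau> x) \<partial>\<rho>)"
      by (intro nn_integral_cong) (auto simp: indicator_def)
    also have "\<dots> = (\<integral>\<^sup>+t. indicator A t \<partial>L \<rho> E)" by (rule nnL[symmetric]) (simp_all add: \<rho>)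
    also have "\<dots> = emeasure (L \<rho> E) A" by (rule nn_integral_indicator) (simp add: L_def)
    finally show ?thesis .
  qed
  have J_eq: "J \<rho>1 = J \<rho>2"
  proof (rule measure_eqI_generator_eq[OF Int_stable_pair_measure_generator[of borel borel]])
    show "{a \<times> b |a b. a \<in> sets borel \<and> b \<in> sets borel} \<subseteq> Pow (UNIV :: ('a \<times> real) set)" by auto
    show "sets (J \<rho>1) = sigma_sets UNIV {a \<times> b |a b. a \<in> sets borel \<and> b \<in> sets borel}"
      "sets (J \<rho>2) = sigma_sets UNIV {a \<times> b |a b. a \<in> sets borel \<and> b \<in> sets borel}"
      by (simp_all add: J_def sets_pair_measure)
    fix Z assume "Z \<in> {a \<times> b |a b. a \<in> sets (borel :: 'a measure) \<and> b \<in> sets (borel :: real measure)}"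
    then obtain E A where Z: "Z = E \<times> A" and EA: "E \<in> sets borel" "A \<in> sets borel" by blast
    show "emeasure (J \<rho>1) Z = emeasure (J \<rho>2) Z"
      unfolding Z J_rect[OF EA levy_measure_sets[OF levy0(1)]] J_rect[OF EA levy_measure_sets[OF levy0(2)]] L_eq[OF EA(1)] ..
  next
    show "range (\<lambda>_::nat. UNIV \<times> UNIV) \<subseteq> {a \<times> b |a b. a \<in> sets (borel :: 'a measure) \<and> b \<in> sets (borel :: real measure)}"
      by (rule image_subsetI, rule CollectI, rule exI[of _ UNIV], rule exI[of _ UNIV]) simp
    show "(\<Union>i::nat. UNIV \<times> UNIV) = (UNIV :: ('a \<times> real) set)" by simp
    interpret finite_measure "L \<rho>1 UNIV" using unit[of UNIV \<rho>1] levy by (simp add: unit_interval_measure_def)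
    show "emeasure (J \<rho>1) (UNIV \<times> UNIV) \<noteq> \<infinity>" for i :: nat
      by (subst J_rect) (simp_all add: levy_measure_sets levy0)
  qed
  \<comment> \<open>\<open>x\<close> is a function of its direction and of \<open>\<tau> x\<close>,
    because \<open>\<tau> x / (1 - \<tau> x) = norm x\<close>.\<close>
  have recover: "distr (J \<rho>) borel (\<lambda>q. (snd q / (1 - snd q)) *\<^sub>R fst q) = N \<rho>" if "sets (N \<rho>) = sets borel" for \<rho>
  proof -
    note [measurable_cong] = that
    have "(\<tau> x / (1 - \<tau> x)) *\<^sub>R dir x = x" for x
    proof (cases "x = 0")
      case False
      have "1 + norm x > 0" by (simp add: add_pos_nonneg)
      hence "1 - \<tau> x = 1 / (1 + norm x)" by (simp add: \<tau>_def field_simps)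
      hence "\<tau> x / (1 - \<tau> x) = norm x" using \<open>1 + norm x > 0\<close> by (simp add: \<tau>_def)
      thus ?thesis using False by (simp add: dir_def)
    qed (simp add: dir_def)
    hence "distr (J \<rho>) borel (\<lambda>q. (snd q / (1 - snd q)) *\<^sub>R fst q) = distr (N \<rho>) borel (\<lambda>x. x)"
      unfolding J_def by (subst distr_distr) (simp_all add: comp_def)
    also have "\<dots> = N \<rho>" using that by (simp add: distr_id2)
    finally show ?thesis .
  qed
  have "N \<rho>1 = N \<rho>2"
    using recover[OF N_sets(1)] recover[OF N_sets(2)] J_eq by simp
  show ?thesis
  proof (rule density_cancel)
    show "sets \<rho>1 = sets \<rho>2" using levy0 by (simp add: levy_measure_sets)
    show "(\<lambda>x. ennreal (\<omega> x)) \<in> borel_measurable \<rho>1"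
      unfolding measurable_cong_sets[OF levy_measure_sets[OF levy0(1)] refl] by measurable
    show "density \<rho>1 (\<lambda>x. ennreal (\<omega> x)) = density \<rho>2 (\<lambda>x. ennreal (\<omega> x))"
      using \<open>N \<rho>1 = N \<rho>2\<close> by (simp only: N_def)
    have pos: "0 < ennreal (\<omega> x) \<and> ennreal (\<omega> x) < \<infinity>" if "x \<noteq> 0" for x
    proof -
      have "1 + norm x > 0" by (simp add: add_pos_nonneg)
      thus ?thesis using that by (simp add: \<omega>_def \<tau>_def zero_less_mult_iff)
    qed
    show "AE x in \<rho>1. 0 < ennreal (\<omega> x) \<and> ennreal (\<omega> x) < \<infinity>"
      using levy_measure_AE_nonzero[OF levy0(1)] by eventually_elim (rule pos)
    show "AE x in \<rho>2. 0 < ennreal (\<omega> x) \<and> ennreal (\<omega> x) < \<infinity>"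
      using levy_measure_AE_nonzero[OF levy0(2)] by eventually_elim (rule pos)
  qed
qed

section \<open>Integrability of the mixing measure and of its image\<close>

text \<open>\<open>\<sigma>\<close> is the p-th root of \<open>s\<close>, the scale of the kernel.
  On \<open>{\<sigma> / 2..\<sigma>}\<close> the exponential is at least \<open>exp (-1)\<close> and
  \<open>min 1 (r ^ p)\<close> at least \<open>min 1 s / 2 ^ p\<close>; the length
  \<open>\<sigma> / 2\<close> cancels the denominator of \<open>w s\<close>.\<close>

lemma laplace_kernel_truncated_moment:
  assumes s: "s > 0" and \<sigma>: "\<sigma> > 0" "\<sigma> ^ p = s" and w: "w s = c / \<sigma>" and c: "c \<ge> 0"
  shows "ennreal (c * exp (-1) / 2 ^ (p + 1)) * ennreal (min 1 s) \<le>
    (\<integral>\<^sup>+r. ennreal (laplace_kernel p w r s) * ennreal (min 1 (r ^ p)) \<partial>lborel)"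
proof -
  define C where "C = c / \<sigma> * exp (-1) * (min 1 s / 2 ^ p)"
  have "C \<ge> 0" using s \<sigma> c by (simp add: C_def)
  have "ennreal (c * exp (-1) / 2 ^ (p + 1)) * ennreal (min 1 s) = ennreal (c * exp (-1) / 2 ^ (p + 1) * min 1 s)"
    using c by (subst ennreal_mult'[symmetric]) simp_all
  also have "c * exp (-1) / 2 ^ (p + 1) * min 1 s = C * (\<sigma> / 2)" using \<sigma> by (simp add: C_def field_simps)
  also have "ennreal (C * (\<sigma> / 2)) = ennreal C * emeasure lborel {\<sigma> / 2..\<sigma>}"
    using \<sigma> \<open>C \<ge> 0\<close> by (simp add: ennreal_mult'[symmetric])
  also have "\<dots> = (\<integral>\<^sup>+r. ennreal C * indicator {\<sigma> / 2..\<sigma>} r \<partial>lborel)"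
    by (rule nn_integral_cmult_indicator[symmetric]) simp
  also have "\<dots> \<le> (\<integral>\<^sup>+r. ennreal (laplace_kernel p w r s) * ennreal (min 1 (r ^ p)) \<partial>lborel)"
  proof (rule nn_integral_mono)
    fix r :: real
    show "ennreal C * indicator {\<sigma> / 2..\<sigma>} r \<le> ennreal (laplace_kernel p w r s) * ennreal (min 1 (r ^ p))"
    proof (cases "r \<in> {\<sigma> / 2..\<sigma>}")
      case True
      hence r: "r > 0" using \<sigma> by simp
      have "r ^ p \<le> \<sigma> ^ p" using True r by (intro power_mono) auto
      hence "exp (-1) \<le> exp (- (r ^ p / s))" using s \<sigma> by simp
      have "(\<sigma> / 2) ^ p \<le> r ^ p" using True \<sigma> by (intro power_mono) auto
      hence "s / 2 ^ p \<le> r ^ p" by (simp add: power_divide \<sigma>)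
      moreover have "min 1 s / 2 ^ p \<le> 1" "min 1 s / 2 ^ p \<le> s / 2 ^ p"
        using s by (simp_all add: divide_le_eq divide_right_mono order_trans[OF min.cobounded1])
      ultimately have "min 1 s / 2 ^ p \<le> min 1 (r ^ p)" by simp
      have "C \<le> c / \<sigma> * exp (- (r ^ p / s)) * min 1 (r ^ p)"
        unfolding C_def using c \<sigma> s
        by (intro mult_mono \<open>exp (-1) \<le> exp (- (r ^ p / s))\<close> \<open>min 1 s / 2 ^ p \<le> min 1 (r ^ p)\<close>) auto
      also have "\<dots> = laplace_kernel p w r s * min 1 (r ^ p)" using r s by (simp add: laplace_kernel_def w)
      finally show ?thesis using True r s c \<sigma> by (simp add: ennreal_mult'[symmetric] ennreal_leI laplace_kernel_def w)
    qed simp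
  qed
  finally show ?thesis .
qed

lemma levy_measure1I:
  fixes \<rho> :: "'a::euclidean_space measure"
  assumes "sets \<rho> = sets borel" "emeasure \<rho> {0} = 0"
    and fin: "(\<integral>\<^sup>+x. ennreal (min 1 (norm x)) \<partial>\<rho>) < \<infinity>"
  shows "levy_measure1 \<rho>"
proof -
  have "(\<integral>\<^sup>+x. ennreal (min 1 (norm x ^ 2)) \<partial>\<rho>) \<le> (\<integral>\<^sup>+x. ennreal (min 1 (norm x)) \<partial>\<rho>)"
  proof (intro nn_integral_mono ennreal_leI)
    fix x :: 'a
    show "min 1 (norm x ^ 2) \<le> min 1 (norm x)"
      using power_decreasing[of 1 2 "norm x"] by (cases "norm x \<le> 1") auto
  qed
  with assms show ?thesis by (auto simp: levy_measure1_def levy_measure_def)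
qed

text \<open>Integrating the previous lower bound over \<open>\<rho>\<close>. Both
  \<open>levy_measure1\<close> of the image for \<open>p = 1\<close> and \<open>levy_measure\<close>
  of the image for \<open>p = 2\<close> lead to the same class for \<open>\<rho>\<close>.\<close>

lemma levy_measure1_of_radial_mix:
  fixes \<rho> :: "'a::euclidean_space measure"
  assumes \<rho>: "sets \<rho> = sets borel" "emeasure \<rho> {0} = 0" and wm: "w \<in> borel_measurable borel"
    and \<sigma>: "\<And>s. s > 0 \<Longrightarrow> \<sigma> s > 0 \<and> \<sigma> s ^ p = s \<and> w s = c / \<sigma> s" and c: "c > 0"
    and fin: "(\<integral>\<^sup>+y. ennreal (min 1 (norm y ^ p)) \<partial>radial_mix (laplace_kernel p w) \<rho>) < \<infinity>"
  shows "levy_measure1 \<rho>"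
proof -
  note [measurable_cong] = \<rho>(1)
  define C where "C = c * exp (-1) / 2 ^ (p + 1)"
  have C: "C > 0" using c by (simp add: C_def)
  have "ennreal C * (\<integral>\<^sup>+x. ennreal (min 1 (norm x)) \<partial>\<rho>) = (\<integral>\<^sup>+x. ennreal C * ennreal (min 1 (norm x)) \<partial>\<rho>)"
    by (rule nn_integral_cmult[symmetric]) measurable
  also have "\<dots> \<le> (\<integral>\<^sup>+x. indicator (- {0}) x * (\<integral>\<^sup>+r. ennreal (laplace_kernel p w r (norm x)) * ennreal (min 1 (norm (r *\<^sub>R (x /\<^sub>R norm x)) ^ p)) \<partial>lborel) \<partial>\<rho>)"
  proof (rule nn_integral_mono)
    fix x :: 'a
    show "ennreal C * ennreal (min 1 (norm x)) \<le> indicator (- {0}) x * (\<integral>\<^sup>+r. ennreal (laplace_kernel p w r (norm x)) * ennreal (min 1 (norm (r *\<^sub>R (x /\<^sub>R norm x)) ^ p)) \<partial>lborel)"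
    proof (cases "x = 0")
      case False
      have "ennreal C * ennreal (min 1 (norm x)) \<le> (\<integral>\<^sup>+r. ennreal (laplace_kernel p w r (norm x)) * ennreal (min 1 (r ^ p)) \<partial>lborel)"
        unfolding C_def using False \<sigma>[of "norm x"] c
        by (intro laplace_kernel_truncated_moment[of _ "\<sigma> (norm x)"]) auto
      also have "\<dots> = (\<integral>\<^sup>+r. ennreal (laplace_kernel p w r (norm x)) * ennreal (min 1 (norm (r *\<^sub>R (x /\<^sub>R norm x)) ^ p)) \<partial>lborel)"
      proof (rule nn_integral_cong)
        fix r :: real
        show "ennreal (laplace_kernel p w r (norm x)) * ennreal (min 1 (r ^ p)) = ennreal (laplace_kernel p w r (norm x)) * ennreal (min 1 (norm (r *\<^sub>R (x /\<^sub>R norm x)) ^ p))"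
        proof (cases "r > 0")
          case True
          have "norm (r *\<^sub>R (x /\<^sub>R norm x)) = r" using True False by simp
          thus ?thesis by (simp only:)
        qed (simp add: laplace_kernel_def)
      qed
      finally show ?thesis using False by simp
    qed simp
  qed
  also have "\<dots> = (\<integral>\<^sup>+y. ennreal (min 1 (norm y ^ p)) \<partial>radial_mix (laplace_kernel p w) \<rho>)"
    by (rule nn_integral_radial_mix[symmetric]) (simp_all add: \<rho> wm measurable_laplace_kernel)
  finally have "ennreal C * (\<integral>\<^sup>+x. ennreal (min 1 (norm x)) \<partial>\<rho>) < \<infinity>" using fin by simp
  hence *: "(\<integral>\<^sup>+x. ennreal (min 1 (norm x)) \<partial>\<rho>) < \<infinity>" using C by (auto simp: ennreal_mult_less_top)
  from \<rho> * show ?thesis by (rule levy_measure1I)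
qed

text \<open>The mean of \<open>min 1 (s * u)\<close> under the exponential law is at most
  \<open>min 1 s\<close>, since that law has total mass 1 and mean 1.\<close>

lemma levy_measure1_radial_mix_k_exp:
  fixes \<rho> :: "'a::euclidean_space measure"
  assumes \<rho>: "levy_measure1 \<rho>"
  shows "levy_measure1 (radial_mix k_exp \<rho>)"
proof -
  have levy0: "levy_measure \<rho>" using \<rho> by (simp add: levy_measure1_def)
  note \<rho>_sets [measurable_cong] = levy_measure_sets[OF levy0]
  let ?\<nu> = "radial_mix k_exp \<rho>"
  have "emeasure ?\<nu> {0} = (\<integral>\<^sup>+x. indicator (- {0}) x * (\<integral>\<^sup>+r. ennreal (k_exp r (norm x)) * indicator {0} (r *\<^sub>R (x /\<^sub>R norm x)) \<partial>lborel) \<partial>\<rho>)"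
    by (rule emeasure_radial_mix[OF \<rho>_sets measurable_k_exp]) simp
  also have "\<dots> = (\<integral>\<^sup>+x. 0 \<partial>\<rho>)"
  proof (rule nn_integral_cong)
    fix x :: 'a
    show "indicator (- {0}) x * (\<integral>\<^sup>+r. ennreal (k_exp r (norm x)) * indicator {0} (r *\<^sub>R (x /\<^sub>R norm x)) \<partial>lborel) = 0"
    proof (cases "x = 0")
      case False
      hence "ennreal (k_exp r (norm x)) * indicator {0} (r *\<^sub>R (x /\<^sub>R norm x)) = 0" for r
        by (simp add: laplace_kernel_def indicator_def)
      thus ?thesis by (simp only: nn_integral_const mult_zero_left mult_zero_right)
    qed simp
  qed
  finally have zero: "emeasure ?\<nu> {0} = 0" by simp
  have "(\<integral>\<^sup>+y. ennreal (min 1 (norm y)) \<partial>?\<nu>) = (\<integral>\<^sup>+x. indicator (- {0}) x * (\<integral>\<^sup>+r. ennreal (k_exp r (norm x)) * ennreal (min 1 (norm (r *\<^sub>R (x /\<^sub>R norm x)))) \<partial>lborel) \<partial>\<rho>)"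
    by (rule nn_integral_radial_mix[OF \<rho>_sets measurable_k_exp]) measurable
  also have "\<dots> \<le> (\<integral>\<^sup>+x. ennreal (min 1 (norm x)) \<partial>\<rho>)"
  proof (rule nn_integral_mono)
    fix x :: 'a
    show "indicator (- {0}) x * (\<integral>\<^sup>+r. ennreal (k_exp r (norm x)) * ennreal (min 1 (norm (r *\<^sub>R (x /\<^sub>R norm x)))) \<partial>lborel) \<le> ennreal (min 1 (norm x))"
    proof (cases "x = 0")
      case False
      define s where "s = norm x"
      have s: "s > 0" using False by (simp add: s_def)
      have "(\<integral>\<^sup>+r. ennreal (k_exp r (norm x)) * ennreal (min 1 (norm (r *\<^sub>R (x /\<^sub>R norm x)))) \<partial>lborel) =
         (\<integral>\<^sup>+r. ennreal (k_exp r s) * ennreal (min 1 \<bar>r\<bar>) \<partial>lborel)"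
      proof -
        have "norm (r *\<^sub>R (x /\<^sub>R norm x)) = \<bar>r\<bar>" for r
          unfolding norm_scaleR using False by simp
        thus ?thesis by (simp only: s_def)
      qed
      also have "\<dots> = (\<integral>\<^sup>+u. indicator {0<..} u * ennreal (exp (- u)) * ennreal (min 1 \<bar>s * u\<bar>) \<partial>lborel)"
        by (rule nn_integral_k_exp) (use s in simp_all)
      finally have I: "(\<integral>\<^sup>+r. ennreal (k_exp r (norm x)) * ennreal (min 1 (norm (r *\<^sub>R (x /\<^sub>R norm x)))) \<partial>lborel) =
         (\<integral>\<^sup>+u. indicator {0<..} u * ennreal (exp (- u)) * ennreal (min 1 \<bar>s * u\<bar>) \<partial>lborel)" (is "_ = ?I") .
      have "?I \<le> (\<integral>\<^sup>+u. ennreal (u ^ 0 * exp (- u)) * indicator {0..} u \<partial>lborel)"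
      proof (rule nn_integral_mono)
        fix u :: real
        have "ennreal (exp (- u)) * ennreal (min 1 \<bar>s * u\<bar>) \<le> ennreal (exp (- u)) * 1"
          by (intro mult_left_mono) simp_all
        thus "indicator {0<..} u * ennreal (exp (- u)) * ennreal (min 1 \<bar>s * u\<bar>) \<le> ennreal (u ^ 0 * exp (- u)) * indicator {0..} u"
          by (auto simp: indicator_def)
      qed
      also have "\<dots> = ennreal 1" by (subst nn_intergal_power_times_exp_Ici) simp
      finally have I1: "?I \<le> ennreal 1" .
      have "?I \<le> (\<integral>\<^sup>+u. ennreal s * (ennreal (u ^ 1 * exp (- u)) * indicator {0..} u) \<partial>lborel)"
      proof (rule nn_integral_mono)
        fix u :: real
        show "indicator {0<..} u * ennreal (exp (- u)) * ennreal (min 1 \<bar>s * u\<bar>) \<le> ennreal s * (ennreal (u ^ 1 * exp (- u)) * indicator {0..} u)"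
        proof (cases "u > 0")
          case True
          have "ennreal (exp (- u)) * ennreal (min 1 \<bar>s * u\<bar>) \<le> ennreal (exp (- u)) * ennreal (s * u)"
            using True s by (intro mult_left_mono ennreal_leI) auto
          also have "\<dots> = ennreal s * ennreal (u ^ 1 * exp (- u))"
            using True s by (simp add: ennreal_mult'[symmetric] mult_ac)
          finally show ?thesis using True by simp
        qed simp
      qed
      also have "\<dots> = ennreal s * (\<integral>\<^sup>+u. ennreal (u ^ 1 * exp (- u)) * indicator {0..} u \<partial>lborel)"
        by (rule nn_integral_cmult) measurable
      also have "\<dots> = ennreal s" by (subst nn_intergal_power_times_exp_Ici) simp
      finally have "?I \<le> ennreal s" .
      with I1 have "?I \<le> ennreal (min 1 s)" by (simp add: min_def)
      thus ?thesis using False unfolding I by (simp add: s_def)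
    qed simp
  qed
  also have "\<dots> < \<infinity>" using \<rho> by (simp add: levy_measure1_def)
  finally have *: "(\<integral>\<^sup>+y. ennreal (min 1 (norm y)) \<partial>?\<nu>) < \<infinity>" .
  show ?thesis by (rule levy_measure1I[OF sets_radial_mix zero *])
qed

text \<open>Supplies the growth condition of \<open>radial_mix_polar_cm\<close> with constant
  2.\<close>

lemma k_gauss_weight_bound:
  assumes s: "s > 0"
  shows "2 / sqrt (pi * s) \<le> 2 * max 1 (1 / s)"
proof -
  have "1 / sqrt s \<le> max 1 (1 / s)"
  proof (cases "s \<ge> 1")
    case False
    hence "s \<le> sqrt s" using s by (intro real_le_rsqrt) (simp add: power2_eq_square mult_left_le)
    hence "1 / sqrt s \<le> 1 / s" using s by (intro divide_left_mono) auto
    thus ?thesis by simp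
  qed simp
  moreover have "sqrt s \<le> sqrt (pi * s)" using s pi_gt3 by simp
  hence "2 / sqrt (pi * s) \<le> 2 / sqrt s" using s by (intro divide_left_mono) auto
  ultimately show ?thesis by linarith
qed

text \<open>The case \<open>p = 1\<close> of both mixture theorems. It reduces (b) to (c), for
  existence as well as for uniqueness.\<close>

lemma levy_measure_B_iff_Upsilon0:
  fixes \<nu> :: "'a::euclidean_space measure"
  shows "levy_measure_B \<nu> \<and> levy_measure1 \<nu> \<longleftrightarrow> (\<exists>\<rho>. levy_measure1 \<rho> \<and> \<nu> = Upsilon0 \<rho>)"
proof
  assume \<nu>: "levy_measure_B \<nu> \<and> levy_measure1 \<nu>"
  then obtain lam l where "polar_cm 1 \<nu> lam l"
    unfolding levy_measure_B_def polar_cm_def by auto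
  moreover have "levy_measure \<nu>" using \<nu> by (simp add: levy_measure1_def)
  ultimately have "\<exists>\<rho>. sets \<rho> = sets borel \<and> emeasure \<rho> {0} = 0 \<and> \<nu> = radial_mix k_exp \<rho>"
    by (rule polar_cm_imp_radial_mix) simp_all
  then obtain \<rho> where \<rho>: "sets \<rho> = sets borel" "emeasure \<rho> {0} = 0" "\<nu> = radial_mix k_exp \<rho>" by blast
  have "levy_measure1 \<rho>"
  proof (rule levy_measure1_of_radial_mix[OF \<rho>(1,2), where p=1 and w="\<lambda>s. 1 / s" and c=1 and \<sigma>="\<lambda>s. s"])
    show "(\<integral>\<^sup>+y. ennreal (min 1 (norm y ^ 1)) \<partial>radial_mix k_exp \<rho>) < \<infinity>"
      using \<nu> unfolding \<rho>(3) by (simp add: levy_measure1_def)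
  qed simp_all
  moreover from this have "\<nu> = Upsilon0 \<rho>" unfolding \<rho>(3) by (simp add: Upsilon0_eq levy_measure1_def)
  ultimately show "\<exists>\<rho>. levy_measure1 \<rho> \<and> \<nu> = Upsilon0 \<rho>" by blast
next
  assume "\<exists>\<rho>. levy_measure1 \<rho> \<and> \<nu> = Upsilon0 \<rho>"
  then obtain \<rho> where \<rho>: "levy_measure1 \<rho>" "\<nu> = Upsilon0 \<rho>" by blast
  hence \<nu>: "\<nu> = radial_mix k_exp \<rho>" by (simp add: Upsilon0_eq levy_measure1_def)
  have levy1: "levy_measure1 \<nu>" unfolding \<nu> by (rule levy_measure1_radial_mix_k_exp[OF \<rho>(1)])
  have "\<exists>lam g. polar_cm 1 \<nu> lam g"
    unfolding \<nu> by (rule radial_mix_polar_cm[OF \<rho>(1), where C=1]) simp_all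
  then obtain lam g where "polar_cm 1 \<nu> lam g" by blast
  with levy1 show "levy_measure_B \<nu> \<and> levy_measure1 \<nu>"
    unfolding levy_measure_B_def polar_cm_def power_one_right levy_measure1_def by blast
qed

section \<open>The equivalence\<close>

theorem theorem3p5:
  fixes \<mu> :: "'a::euclidean_space measure" and \<Sigma> :: "'a \<Rightarrow> 'a"
    and \<nu>t :: "'a measure" and \<gamma> :: 'a
  assumes "LK_triplet \<mu> \<Sigma> \<nu>t \<gamma>"
  shows "(\<mu> \<in> typeG \<longleftrightarrow> (\<exists>\<nu>. levy_measure_B \<nu> \<and> levy_measure1 \<nu> \<and> \<nu>t = A1 \<nu>))
       \<and> (\<mu> \<in> typeG \<longleftrightarrow> (\<exists>\<rho>. levy_measure1 \<rho> \<and> \<nu>t = A1 (Upsilon0 \<rho>)))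
       \<and> (\<forall>\<nu>1 \<nu>2. levy_measure_B \<nu>1 \<and> levy_measure1 \<nu>1 \<and> \<nu>t = A1 \<nu>1 \<and>
                  levy_measure_B \<nu>2 \<and> levy_measure1 \<nu>2 \<and> \<nu>t = A1 \<nu>2 \<longrightarrow> \<nu>1 = \<nu>2)
       \<and> (\<forall>\<rho>1 \<rho>2. levy_measure1 \<rho>1 \<and> \<nu>t = A1 (Upsilon0 \<rho>1) \<and>
                  levy_measure1 \<rho>2 \<and> \<nu>t = A1 (Upsilon0 \<rho>2) \<longrightarrow> \<rho>1 = \<rho>2)"
proof -
  have levy: "levy_measure \<nu>t" using assms by (simp add: LK_triplet_def)
  have A1_U: "A1 (Upsilon0 \<rho>) = radial_mix k_gauss \<rho>" if "levy_measure1 \<rho>" for \<rho> :: "'a measure"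
    using that by (simp add: A1_Upsilon0_eq levy_measure1_def)
  \<comment> \<open>\<open>typeG\<close> quantifies over some triplet of \<open>\<mu>\<close>;
    uniqueness of the Levy measure makes it the given \<open>\<nu>t\<close>.\<close>
  have typeG_iff: "\<mu> \<in> typeG \<longleftrightarrow> (\<exists>lam g. polar_cm 2 \<nu>t lam g)"
    using LK_levy_measure_unique[OF assms] assms unfolding typeG_def polar_cm_def by blast
  have c: "\<mu> \<in> typeG \<longleftrightarrow> (\<exists>\<rho>. levy_measure1 \<rho> \<and> \<nu>t = A1 (Upsilon0 \<rho>))"
  proof
    assume "\<mu> \<in> typeG"
    then obtain lam g where "polar_cm 2 \<nu>t lam g" unfolding typeG_iff by blast
    hence "\<exists>\<rho>. sets \<rho> = sets borel \<and> emeasure \<rho> {0} = 0 \<and> \<nu>t = radial_mix k_gauss \<rho>"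
      using levy by (rule polar_cm_imp_radial_mix) simp_all
    then obtain \<rho> where \<rho>: "sets \<rho> = sets borel" "emeasure \<rho> {0} = 0" "\<nu>t = radial_mix k_gauss \<rho>" by blast
    have "levy_measure1 \<rho>"
    proof (rule levy_measure1_of_radial_mix[OF \<rho>(1,2), where p=2 and w="\<lambda>s. 2 / sqrt (pi * s)" and c="2 / sqrt pi" and \<sigma>=sqrt])
      show "(\<integral>\<^sup>+y. ennreal (min 1 (norm y ^ 2)) \<partial>radial_mix k_gauss \<rho>) < \<infinity>"
        using levy unfolding \<rho>(3) by (simp add: levy_measure_def)
    qed (simp_all add: real_sqrt_mult)
    thus "\<exists>\<rho>. levy_measure1 \<rho> \<and> \<nu>t = A1 (Upsilon0 \<rho>)"
      using \<rho>(3) by (intro exI[of _ \<rho>]) (simp only: A1_U)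
  next
    assume "\<exists>\<rho>. levy_measure1 \<rho> \<and> \<nu>t = A1 (Upsilon0 \<rho>)"
    then obtain \<rho> where \<rho>: "levy_measure1 \<rho>" "\<nu>t = radial_mix k_gauss \<rho>" using A1_U by auto
    show "\<mu> \<in> typeG"
      unfolding typeG_iff \<rho>(2)
      by (rule radial_mix_polar_cm[OF \<rho>(1), where C=2]) (simp_all add: k_gauss_weight_bound)
  qed
  have b: "(\<exists>\<nu>. levy_measure_B \<nu> \<and> levy_measure1 \<nu> \<and> \<nu>t = A1 \<nu>) \<longleftrightarrow> (\<exists>\<rho>. levy_measure1 \<rho> \<and> \<nu>t = A1 (Upsilon0 \<rho>))"
  proof
    assume "\<exists>\<nu>. levy_measure_B \<nu> \<and> levy_measure1 \<nu> \<and> \<nu>t = A1 \<nu>"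
    then obtain \<nu> where \<nu>: "levy_measure_B \<nu> \<and> levy_measure1 \<nu>" "\<nu>t = A1 \<nu>" by blast
    from \<nu>(1) obtain \<rho> where "levy_measure1 \<rho>" "\<nu> = Upsilon0 \<rho>"
      unfolding levy_measure_B_iff_Upsilon0 by blast
    with \<nu>(2) show "\<exists>\<rho>. levy_measure1 \<rho> \<and> \<nu>t = A1 (Upsilon0 \<rho>)" by (intro exI[of _ \<rho>]) simp
  next
    assume "\<exists>\<rho>. levy_measure1 \<rho> \<and> \<nu>t = A1 (Upsilon0 \<rho>)"
    then obtain \<rho> where \<rho>: "levy_measure1 \<rho>" "\<nu>t = A1 (Upsilon0 \<rho>)" by blast
    have "levy_measure_B (Upsilon0 \<rho>) \<and> levy_measure1 (Upsilon0 \<rho>)"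
      unfolding levy_measure_B_iff_Upsilon0 using \<rho>(1) by (intro exI[of _ \<rho>]) simp
    with \<rho>(2) show "\<exists>\<nu>. levy_measure_B \<nu> \<and> levy_measure1 \<nu> \<and> \<nu>t = A1 \<nu>"
      by (intro exI[of _ "Upsilon0 \<rho>"]) simp
  qed
  have unique: "\<rho>1 = \<rho>2"
    if "levy_measure1 \<rho>1" "\<nu>t = A1 (Upsilon0 \<rho>1)" "levy_measure1 \<rho>2" "\<nu>t = A1 (Upsilon0 \<rho>2)" for \<rho>1 \<rho>2 :: "'a measure"
    using radial_mix_k_gauss_unique[OF that(1,3)] that(2,4)
    unfolding A1_U[OF that(1)] A1_U[OF that(3)] by metis
  \<comment> \<open>Both measures are images under \<open>Upsilon0\<close>, and their preimages
    coincide by the uniqueness in (c).\<close>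
  have unique_b: "\<nu>1 = \<nu>2"
    if asm: "levy_measure_B \<nu>1" "levy_measure1 \<nu>1" "\<nu>t = A1 \<nu>1" "levy_measure_B \<nu>2" "levy_measure1 \<nu>2" "\<nu>t = A1 \<nu>2"
    for \<nu>1 \<nu>2 :: "'a measure"
  proof -
    obtain \<rho>1 where 1: "levy_measure1 \<rho>1" "\<nu>1 = Upsilon0 \<rho>1"
      using conjI[OF asm(1,2)] unfolding levy_measure_B_iff_Upsilon0 by (elim exE conjE)
    obtain \<rho>2 where 2: "levy_measure1 \<rho>2" "\<nu>2 = Upsilon0 \<rho>2"
      using conjI[OF asm(4,5)] unfolding levy_measure_B_iff_Upsilon0 by (elim exE conjE)
    have "\<rho>1 = \<rho>2"
      using unique[OF 1(1) _ 2(1)] asm(3,6) unfolding 1(2) 2(2) by metis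
    thus ?thesis using 1 2 by simp
  qed
  show ?thesis
  proof (intro conjI allI impI)
    show "\<mu> \<in> typeG \<longleftrightarrow> (\<exists>\<nu>. levy_measure_B \<nu> \<and> levy_measure1 \<nu> \<and> \<nu>t = A1 \<nu>)"
      unfolding b by (rule c)
  qed (rule c, (elim conjE, rule unique_b, assumption+), (elim conjE, rule unique, assumption+))
qed

end
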